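(* Let $H_2\subset H_1$ be Hilbert spaces with dense and compact inclusion of $H_2$ into $H_1$, and let $\phi\colon H_1\to H_1$ be tame with $\phi(0)=0$. Then the map $$T\Phi\colon\big(W^{1,2}(\mathbb R,H_1)\cap L^2(\mathbb R,H_2)\big)\times L^2(\mathbb R,H_1)\to\big(W^{1,2}(\mathbb R,H_1)\cap L^2(\mathbb R,H_2)\big)\times L^2(\mathbb R,H_1),$$ $$(\xi,\eta)\mapsto\big(\phi\circ\xi,\ d\phi|_\xi\,\eta\big),\qquad (d\phi|_\xi\eta)(s):=d\phi|_{\xi(s)}\eta(s),$$ is well defined and continuously differentiable.
   Context: Norms are $|\cdot|_1:=\|\cdot\|_{H_1}$, $|\cdot|_2:=\|\cdot\|_{H_2}$, normalized so that $|\cdot|_1\le|\cdot|_2$ on $H_2$. For $U_1\subset H_1$ open and $U_2:=U_1\cap H_2$, a $C^2$ map $\phi\colon U_1\to H_1$ is *tame* if (i) $\phi(U_2)\subset H_2$ and $\phi|_{U_2}\colon U_2\to H_2$ is $C^2$; (ii) for every $x\in U_1$ there are an $H_1$-open neighborhood $W_x\subset U_1$ of $x$ and a constant $\kappa>0$ such that for all $y\in W_x\cap H_2$ and all $\xi,\eta\in H_2$: $|d^2\phi|_y(\xi,\eta)|_2\le\kappa\big(|\xi|_1|\eta|_2+|\xi|_2|\eta|_1+|y|_2|\xi|_1|\eta|_1\big)$. $W^{1,2}(\mathbb R,H_1)\cap L^2(\mathbb R,H_2)$ is a Hilbert space with inner product $\int_{\mathbb R}\langle\dot\xi,\dot\eta\rangle_{H_1}ds+\int_{\mathbb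 R}\langle\xi,\eta\rangle_{H_2}ds$. Elements of $W^{1,2}(\mathbb R,H_1)$ are identified with their continuous representatives. *)

theory Defs
  imports "HOL-Analysis.Analysis" "HOL-Library.Function_Algebras"
begin

instantiation "fun" :: (type, real_vector) real_vector
begin

definition scaleR_fun :: "real \<Rightarrow> ('a \<Rightarrow> 'b) \<Rightarrow> 'a \<Rightarrow> 'b" where
  "scaleR_fun c f = (\<lambda>x. c *\<^sub>R f x)"

instance
  by standard (simp_all add: scaleR_fun_def fun_eq_iff algebra_simps)

end

text \<open>Derivatives as operator-valued maps. \<open>fderiv f x\<close> is the Frechet derivative of \<open>f\<close> at \<open>x\<close>
  whenever \<open>f\<close> is differentiable there (and an unspecified operator otherwise); hence
  \<open>fderiv (fderiv f) x u v\<close> is the second derivative of \<open>f\<close> at \<open>x\<close>, applied to \<open>(u, v)\<close>.\<close>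

definition fderiv :: "('v::real_normed_vector \<Rightarrow> 'w::real_normed_vector) \<Rightarrow> 'v \<Rightarrow> 'v \<Rightarrow>\<^sub>L 'w" where
  "fderiv f x = Blinfun (frechet_derivative f (at x))"

definition C2_on :: "'v::real_normed_vector set \<Rightarrow> ('v \<Rightarrow> 'w::real_normed_vector) \<Rightarrow> bool" where
  "C2_on U f \<longleftrightarrow>
     (\<forall>x\<in>U. f differentiable (at x)) \<and>
     (\<forall>x\<in>U. fderiv f differentiable (at x)) \<and>
     continuous_on U (fderiv (fderiv f))"

text \<open>The dense subspace \<open>H\<^sub>2 \<subseteq> H\<^sub>1\<close> with its own Hilbert space structure is modelled by a type \<open>'b\<close>
  together with the inclusion \<open>j :: 'b \<Rightarrow> 'a\<close>; as a set, \<open>H\<^sub>2\<close> is \<open>range j\<close>, and for \<open>x \<in> range j\<close> the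
  \<open>H\<^sub>2\<close>-norm of \<open>x\<close> is \<open>norm (inv j x)\<close>.\<close>

definition dense_compact_inclusion ::
    "('b::{real_inner, banach} \<Rightarrow> 'a::{real_inner, banach}) \<Rightarrow> bool" where
  "dense_compact_inclusion j \<longleftrightarrow>
     bounded_linear j \<and> inj j \<and> closure (range j) = UNIV \<and>
     (\<forall>B. bounded B \<longrightarrow> compact (closure (j ` B)))"

text \<open>The restriction of \<open>\<phi>\<close> to \<open>H\<^sub>2\<close>, as a map into \<open>H\<^sub>2\<close>; meaningful at \<open>y\<close> if \<open>\<phi> (j y) \<in> range j\<close>.\<close>

definition restr :: "('b \<Rightarrow> 'a) \<Rightarrow> ('a \<Rightarrow> 'a) \<Rightarrow> 'b \<Rightarrow> 'b" where
  "restr j \<phi> = (\<lambda>y. inv j (\<phi> (j y)))"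

text \<open>For \<open>y\<close>, \<open>\<xi>\<close>, \<open>\<eta>\<close> in \<open>H\<^sub>2\<close> the second derivative of \<open>\<phi>\<close> at \<open>y\<close> applied to \<open>(\<xi>, \<eta>)\<close> is that of
  the restricted map, which is \<open>H\<^sub>2\<close>-valued.\<close>

definition tame ::
    "('b::{real_inner, banach} \<Rightarrow> 'a::{real_inner, banach}) \<Rightarrow> 'a set \<Rightarrow> ('a \<Rightarrow> 'a) \<Rightarrow> bool" where
  "tame j U \<phi> \<longleftrightarrow>
     open U \<and> C2_on U \<phi> \<and>
     \<phi> ` (U \<inter> range j) \<subseteq> range j \<and> C2_on (j -` U) (restr j \<phi>) \<and>
     (\<forall>x\<in>U. \<exists>W \<kappa>. open W \<and> x \<in> W \<and> W \<subseteq> U \<and> \<kappa> > 0 \<and>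
        (\<forall>y \<xi> \<eta>. j y \<in> W \<longrightarrow>
           norm (blinfun_apply (blinfun_apply (fderiv (fderiv (restr j \<phi>)) y) \<xi>) \<eta>)
             \<le> \<kappa> * (norm (j \<xi>) * norm \<eta> + norm \<xi> * norm (j \<eta>)
                     + norm y * norm (j \<xi>) * norm (j \<eta>))))"

text \<open>Square integrable functions with values in a normed space. No separability is built into the
  types, so measurability is strong (Bochner) measurability. Elements of the space \<open>L\<^sup>2\<close> are represented
  by functions, and \<open>L2_norm\<close> is the corresponding seminorm: its kernel consists of the functions
  vanishing almost everywhere.\<close>

definition strongly_measurable :: "(real \<Rightarrow> 'a::real_normed_vector) \<Rightarrow> bool" where
  "strongly_measurable f \<longleftrightarrow>
     (\<exists>F. (\<forall>n. simple_function lebesgue (F n)) \<and>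
          (AE s in lebesgue. (\<lambda>n::nat. F n s) \<longlonglongrightarrow> f s))"

definition L2 :: "(real \<Rightarrow> 'a::real_normed_vector) set" where
  "L2 = {f. strongly_measurable f \<and> integrable lebesgue (\<lambda>s. (norm (f s))\<^sup>2)}"

definition L2_norm :: "(real \<Rightarrow> 'a::real_normed_vector) \<Rightarrow> real" where
  "L2_norm f = sqrt (LINT s|lebesgue. (norm (f s))\<^sup>2)"

text \<open>Weak derivatives, tested against compactly supported \<open>C\<^sup>1\<close> functions with values in the Hilbert
  space.\<close>

definition has_weak_derivative ::
    "(real \<Rightarrow> 'a::real_inner) \<Rightarrow> (real \<Rightarrow> 'a) \<Rightarrow> bool" where
  "has_weak_derivative \<xi> v \<longleftrightarrow>
     (\<forall>\<psi> \<psi>'. (\<forall>s. (\<psi> has_vector_derivative \<psi>' s) (at s)) \<and> continuous_on UNIV \<psi>' \<and>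
             (\<exists>R. \<forall>s. \<bar>s\<bar> > R \<longrightarrow> \<psi> s = 0) \<longrightarrow>
        (LINT s|lebesgue. inner (\<psi>' s) (\<xi> s)) = - (LINT s|lebesgue. inner (\<psi> s) (v s)))"

definition W12 :: "(real \<Rightarrow> 'a::real_inner) set" where
  "W12 = {\<xi>. \<xi> \<in> L2 \<and> continuous_on UNIV \<xi> \<and> (\<exists>v\<in>L2. has_weak_derivative \<xi> v)}"

text \<open>Unique up to equality almost everywhere, for \<open>\<xi> \<in> W12\<close>.\<close>

definition weak_deriv :: "(real \<Rightarrow> 'a::real_inner) \<Rightarrow> real \<Rightarrow> 'a" where
  "weak_deriv \<xi> = (SOME v. v \<in> L2 \<and> has_weak_derivative \<xi> v)"

text \<open>The space \<open>W\<^sup>1\<^sup>,\<^sup>2(\<real>, H\<^sub>1) \<inter> L\<^sup>2(\<real>, H\<^sub>2)\<close>, consisting of continuous representatives \<open>\<real> \<Rightarrow> H\<^sub>1\<close>. Such a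
  representative need only take values in \<open>H\<^sub>2\<close> almost everywhere.\<close>

definition W_space :: "('b::real_inner \<Rightarrow> 'a::real_inner) \<Rightarrow> (real \<Rightarrow> 'a) set" where
  "W_space j =
     {\<xi>. \<xi> \<in> W12 \<and> (AE s in lebesgue. \<xi> s \<in> range j) \<and> (\<lambda>s. inv j (\<xi> s)) \<in> L2}"

definition W_norm :: "('b::real_inner \<Rightarrow> 'a::real_inner) \<Rightarrow> (real \<Rightarrow> 'a) \<Rightarrow> real" where
  "W_norm j \<xi> =
     sqrt ((LINT s|lebesgue. (norm (weak_deriv \<xi> s))\<^sup>2) +
           (LINT s|lebesgue. (norm (inv j (\<xi> s)))\<^sup>2))"

definition E_space :: "('b::real_inner \<Rightarrow> 'a::real_inner) \<Rightarrow> ((real \<Rightarrow> 'a) \<times> (real \<Rightarrow> 'a)) set" where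
  "E_space j = W_space j \<times> L2"

definition E_norm :: "('b::real_inner \<Rightarrow> 'a::real_inner) \<Rightarrow> (real \<Rightarrow> 'a) \<times> (real \<Rightarrow> 'a) \<Rightarrow> real" where
  "E_norm j z = sqrt ((W_norm j (fst z))\<^sup>2 + (L2_norm (snd z))\<^sup>2)"

text \<open>Calculus between linear subspaces \<open>V\<close>, \<open>V'\<close> of vector spaces carrying seminorms \<open>p\<close>, \<open>p'\<close>. Linear
  maps and derivatives in this sense are exactly representatives of those between the normed quotients
  by the kernels of the seminorms.\<close>

definition bounded_linear_between ::
    "'x::real_vector set \<Rightarrow> ('x \<Rightarrow> real) \<Rightarrow> 'y::real_vector set \<Rightarrow> ('y \<Rightarrow> real) \<Rightarrow> ('x \<Rightarrow> 'y) \<Rightarrow> bool" where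
  "bounded_linear_between V p V' p' L \<longleftrightarrow>
     (\<forall>x\<in>V. L x \<in> V') \<and>
     (\<forall>x\<in>V. \<forall>y\<in>V. L (x + y) = L x + L y) \<and>
     (\<forall>c. \<forall>x\<in>V. L (c *\<^sub>R x) = c *\<^sub>R L x) \<and>
     (\<exists>K. \<forall>x\<in>V. p' (L x) \<le> K * p x)"

definition C1_between ::
    "'x::real_vector set \<Rightarrow> ('x \<Rightarrow> real) \<Rightarrow> 'y::real_vector set \<Rightarrow> ('y \<Rightarrow> real) \<Rightarrow> ('x \<Rightarrow> 'y) \<Rightarrow> bool" where
  "C1_between V p V' p' F \<longleftrightarrow>
     (\<forall>z\<in>V. F z \<in> V') \<and>
     (\<exists>D. \<forall>z\<in>V.
        bounded_linear_between V p V' p' (D z) \<and>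
        (\<forall>\<epsilon>>0. \<exists>\<delta>>0. \<forall>h\<in>V. p h < \<delta> \<longrightarrow> p' (F (z + h) - F z - D z h) \<le> \<epsilon> * p h) \<and>
        (\<forall>\<epsilon>>0. \<exists>\<delta>>0. \<forall>h\<in>V. p h < \<delta> \<longrightarrow>
           (\<forall>k\<in>V. p' (D (z + h) k - D z k) \<le> \<epsilon> * p k)))"

definition tangent_map ::
    "('a::real_normed_vector \<Rightarrow> 'a) \<Rightarrow> (real \<Rightarrow> 'a) \<times> (real \<Rightarrow> 'a) \<Rightarrow> (real \<Rightarrow> 'a) \<times> (real \<Rightarrow> 'a)" where
  "tangent_map \<phi> = (\<lambda>(\<xi>, \<eta>). (\<phi> \<circ> \<xi>, \<lambda>s. blinfun_apply (fderiv \<phi> (\<xi> s)) (\<eta> s)))"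

end

theory Submission
  imports Defs
begin

text \<open>The candidate derivative at \<open>(\<xi>, \<eta>)\<close> is \<open>(a, b) \<mapsto> (d\<phi>\<^bsub>\<xi>\<^esub> a, d\<^sup>2\<phi>\<^bsub>\<xi>\<^esub>(a, \<eta>) + d\<phi>\<^bsub>\<xi>\<^esub> b)\<close>. A curve in the path
  space is bounded in \<open>H\<^sub>1\<close> by its norm and vanishes at infinity, so it stays in a compact set that is
  star-shaped about \<open>0\<close>. Near this set \<open>d\<phi>\<close> and \<open>d\<^sup>2\<phi>\<close> are bounded and uniformly continuous, and the
  tameness constant can be chosen uniformly. The \<open>L\<^sup>2(H\<^sub>2)\<close> parts of all remainders are
  then quadratic by Taylor's formula and tameness. The weak derivative of \<open>d\<phi>\<^bsub>\<xi>\<^esub> a\<close> is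
  \<open>d\<^sup>2\<phi>\<^bsub>\<xi>\<^esub>(a, \<xi>') + d\<phi>\<^bsub>\<xi>\<^esub> a'\<close> by symmetry of \<open>d\<^sup>2\<phi>\<close>; this is the second component of the derivative with
  \<open>(\<eta>, b)\<close> replaced by \<open>(\<xi>', a')\<close>, so both components obey the same estimates.\<close>

section \<open>Strongly measurable and square integrable functions\<close>

text \<open>Since \<phi> is only C2, the o(h) remainder of \<open>fderiv \<phi>\<close> cannot come
  from a third derivative; it comes from uniform continuity of the second derivative near the
  compact H1-range of the curve. The lift of the curve to H2 is merely square integrable and its
  values need not lie in a compact set, so continuity of the derivatives of
  \<open>restr j \<phi>\<close> gives nothing uniform along it. In H2 only the tame inequality is
  used, and its shape is decisive: each term has exactly one H2 norm, the other factors being H1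
  norms. Along curves the H2 factor is measured in L2 and the H1 factors in the supremum norm, which
  the path space norm controls. Star-shapedness lets the same inequality, expanded from 0 with
  \<phi>(0) = 0, show that \<open>restr j \<phi>\<close> maps L2 curves of this kind to L2. The
  second obstacle is that the Hilbert spaces may be nonseparable. Measurability therefore always
  goes through simple functions, and derivatives of curves through integrals tested against vectors.
  Weak derivatives are translated to and from that form by smoothed indicators of intervals and by
  integration by parts.\<close>

lemma borel_measurable_lebesgue_AE:
  fixes f g :: "real \<Rightarrow> 'c::topological_space"
  assumes f: "f \<in> borel_measurable lebesgue" and eq: "AE s in lebesgue. f s = g s"
  shows "g \<in> borel_measurable lebesgue"
proof (rule measurableI)
  fix A :: "'c set" assume "A \<in> sets borel"
  then have "f -` A \<inter> space lebesgue \<in> sets lebesgue"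
    using f by (rule measurable_sets[rotated])
  moreover have "AE s in lebesgue. s \<in> f -` A \<inter> space lebesgue \<longleftrightarrow> s \<in> g -` A \<inter> space lebesgue"
    using eq by eventually_elim auto
  ultimately show "g -` A \<inter> space lebesgue \<in> sets lebesgue"
    using complete_measure.in_sets_AE[OF completion.complete_measure_axioms] by (metis inf_le2)
qed simp

lemma strongly_measurable_AE_cong:
  assumes "strongly_measurable f" "AE s in lebesgue. f s = g s"
  shows "strongly_measurable g"
proof -
  obtain F where F: "\<And>n. simple_function lebesgue (F n)"
    and lim: "AE s in lebesgue. (\<lambda>n::nat. F n s) \<longlonglongrightarrow> f s"
    using assms(1) unfolding strongly_measurable_def by auto
  from lim assms(2) have "AE s in lebesgue. (\<lambda>n::nat. F n s) \<longlonglongrightarrow> g s"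
    by eventually_elim simp
  with F show ?thesis unfolding strongly_measurable_def by auto
qed

text \<open>A function of two simple functions is again simple, and continuity of \<open>h\<close>
  passes to the limit, so no separability of the value spaces enters. The closure properties below
  reduce to this.\<close>

lemma strongly_measurable_compose2:
  fixes h :: "'c::real_normed_vector \<Rightarrow> 'd::real_normed_vector \<Rightarrow> 'e::real_normed_vector"
  assumes f: "strongly_measurable f" and g: "strongly_measurable g"
    and h: "continuous_on UNIV (\<lambda>p. h (fst p) (snd p))"
  shows "strongly_measurable (\<lambda>s. h (f s) (g s))"
proof -
  obtain F where F: "\<And>n. simple_function lebesgue (F n)"
    and limF: "AE s in lebesgue. (\<lambda>n::nat. F n s) \<longlonglongrightarrow> f s"
    using f unfolding strongly_measurable_def by auto
  obtain G where G: "\<And>n. simple_function lebesgue (G n)"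
    and limG: "AE s in lebesgue. (\<lambda>n::nat. G n s) \<longlonglongrightarrow> g s"
    using g unfolding strongly_measurable_def by auto
  have "AE s in lebesgue. (\<lambda>n. h (F n s) (G n s)) \<longlonglongrightarrow> h (f s) (g s)"
    using limF limG
  proof eventually_elim
    case (elim s)
    have "isCont (\<lambda>p. h (fst p) (snd p)) (f s, g s)"
      using h continuous_on_eq_continuous_at[OF open_UNIV] by blast
    then have "(\<lambda>n. h (fst (F n s, G n s)) (snd (F n s, G n s))) \<longlonglongrightarrow> h (fst (f s, g s)) (snd (f s, g s))"
      by (rule isCont_tendsto_compose) (intro tendsto_Pair elim)
    then show ?case by simp
  qed
  moreover have "simple_function lebesgue (\<lambda>s. h (F n s) (G n s))" for n
    by (rule simple_function_compose2[OF F G])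
  ultimately show ?thesis
    unfolding strongly_measurable_def by (intro exI[of _ "\<lambda>n s. h (F n s) (G n s)"]) auto
qed

lemma strongly_measurable_compose:
  fixes h :: "'c::real_normed_vector \<Rightarrow> 'e::real_normed_vector"
  assumes f: "strongly_measurable f" and h: "continuous_on UNIV h"
  shows "strongly_measurable (\<lambda>s. h (f s))"
  by (rule strongly_measurable_compose2[OF f f, of "\<lambda>x y. h x"])
     (intro continuous_on_compose2[OF h] continuous_intros subset_UNIV)

text \<open>Discretising the argument instead of the values makes this work for any normed target:
  \<open>f\<close> is composed with simple functions that converge to the identity.\<close>

lemma strongly_measurable_continuous:
  fixes f :: "real \<Rightarrow> 'c::real_normed_vector"
  assumes f: "continuous_on UNIV f"
  shows "strongly_measurable f"
proof -
  \<comment> \<open>Rounds \<open>s\<close> down to a multiple of 1/n and clamps the result to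
    [-n, n], which leaves finitely many values.\<close>
  define c :: "nat \<Rightarrow> real \<Rightarrow> real" where
    "c n s = max (- real n) (min (real n) (real_of_int \<lfloor>(real n) * s\<rfloor> / real n))" for n s
  have fin: "finite (range (c n))" for n
  proof (rule finite_subset)
    show "range (c n) \<subseteq> insert (real n) (insert (- real n) ((\<lambda>k. real_of_int k / real n) ` {- int n * int n .. int n * int n}))"
    proof
      fix x assume "x \<in> range (c n)"
      then obtain s where x: "x = c n s" by auto
      let ?k = "\<lfloor>(real n) * s\<rfloor>"
      have "x = real n \<or> x = - real n \<or> (x = real_of_int ?k / real n \<and> n > 0 \<and>
          - real n \<le> real_of_int ?k / real n \<and> real_of_int ?k / real n \<le> real n)"
        unfolding x c_def by (cases "n = 0") (simp, simp add: max_def min_def)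
      then consider "x = real n" | "x = - real n" | "x = real_of_int ?k / real n" "n > 0"
          "- real n \<le> real_of_int ?k / real n" "real_of_int ?k / real n \<le> real n"
        by blast
      then show "x \<in> insert (real n) (insert (- real n) ((\<lambda>k. real_of_int k / real n) ` {- int n * int n .. int n * int n}))"
      proof cases
        case 3
        then have "- real_of_int (int n * int n) \<le> real_of_int ?k" "real_of_int ?k \<le> real_of_int (int n * int n)"
          by (auto simp: field_simps)
        then have "?k \<in> {- int n * int n .. int n * int n}"
          by (simp del: of_int_mult of_int_minus add: of_int_minus[symmetric])
        then have "real_of_int ?k / real n \<in> (\<lambda>k. real_of_int k / real n) ` {- int n * int n .. int n * int n}"
          by (rule imageI)
        then show ?thesis unfolding 3(1) by (intro insertI2)
      qed auto
    qed
  qed auto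
  have "c n \<in> borel_measurable lebesgue" for n
    unfolding c_def by (rule measurable_completion) measurable
  then have simple: "simple_function lebesgue (c n)" for n
    using fin by (intro simple_function_borel_measurable) auto
  have lim: "(\<lambda>n. c n s) \<longlonglongrightarrow> s" for s
  proof (rule LIMSEQ_I)
    fix r :: real assume "r > 0"
    \<comment> \<open>Beyond this index the clamp is inactive at \<open>s\<close> and the rounding
      error 1/n is below \<open>r\<close>.\<close>
    obtain N where N: "real N > \<bar>s\<bar> + 1 + 1 / r" using reals_Archimedean2 by blast
    have "norm (c n s - s) < r" if "n \<ge> N" for n
    proof -
      have n: "real n > \<bar>s\<bar> + 1 + 1 / r" using that N by linarith
      then have n0: "real n > 1" using \<open>r > 0\<close> by (smt (verit) zero_less_divide_1_iff)
      have a: "real_of_int \<lfloor>(real n) * s\<rfloor> \<le> real n * s" "real_of_int \<lfloor>(real n) * s\<rfloor> > real n * s - 1"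
        by linarith+
      have "real_of_int \<lfloor>(real n) * s\<rfloor> / real n \<le> s" "real_of_int \<lfloor>(real n) * s\<rfloor> / real n > s - 1 / real n"
        using a n0 by (simp_all add: pos_divide_le_eq pos_less_divide_eq mult.commute left_diff_distrib right_diff_distrib)
      moreover have "1 / real n < r" 
      proof -
        have "1 / r < real n" using n by linarith
        then show ?thesis using \<open>r > 0\<close> n0 by (simp add: field_simps)
      qed
      moreover have "1 / real n < 1" using n0 by simp
      moreover have "1 / r > 0" using \<open>r>0\<close> by simp
      ultimately show ?thesis unfolding c_def real_norm_def max_def min_def using n by (smt (verit))
    qed
    then show "\<exists>no. \<forall>n\<ge>no. norm (c n s - s) < r" by blast
  qed
  have "(\<lambda>n. f (c n s)) \<longlonglongrightarrow> f s" for s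
    by (rule isCont_tendsto_compose[OF _ lim]) (use f continuous_on_eq_continuous_at[OF open_UNIV] in blast)
  moreover have "simple_function lebesgue (\<lambda>s. f (c n s))" for n
    using simple_function_compose[OF simple, of f n] by (simp add: o_def)
  ultimately show ?thesis
    unfolding strongly_measurable_def by (intro exI[of _ "\<lambda>n s. f (c n s)"]) auto
qed

text \<open>The approximants converge only almost everywhere. Their \<open>lim\<close> is
  measurable, and completeness of Lebesgue measure transfers this to \<open>f\<close>.\<close>

lemma strongly_measurable_imp_borel:
  fixes f :: "real \<Rightarrow> real"
  assumes "strongly_measurable f"
  shows "f \<in> borel_measurable lebesgue"
proof -
  obtain F where F: "\<And>n. simple_function lebesgue (F n)"
    and lim: "AE s in lebesgue. (\<lambda>n::nat. F n s) \<longlonglongrightarrow> f s"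
    using assms unfolding strongly_measurable_def by auto
  have "F n \<in> borel_measurable lebesgue" for n by (rule borel_measurable_simple_function[OF F])
  then have "(\<lambda>s. lim (\<lambda>n. F n s)) \<in> borel_measurable lebesgue"
    by (rule borel_measurable_lim_metric)
  moreover have "AE s in lebesgue. lim (\<lambda>n. F n s) = f s"
    using lim by eventually_elim (rule limI)
  ultimately show ?thesis by (rule borel_measurable_lebesgue_AE)
qed

lemma strongly_measurable_norm:
  "strongly_measurable f \<Longrightarrow> (\<lambda>s. norm (f s)) \<in> borel_measurable lebesgue"
  by (rule strongly_measurable_imp_borel, rule strongly_measurable_compose[where h=norm])
     (assumption, intro continuous_intros)

lemma strongly_measurable_inner:
  "strongly_measurable f \<Longrightarrow> strongly_measurable g \<Longrightarrow> (\<lambda>s. inner (f s) (g s)) \<in> borel_measurable lebesgue"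
  by (rule strongly_measurable_imp_borel, rule strongly_measurable_compose2[where h=inner])
     (assumption, assumption, intro continuous_intros)

lemma strongly_measurable_const: "strongly_measurable (\<lambda>s. c)"
  by (rule strongly_measurable_continuous) simp

lemma strongly_measurable_add:
  assumes "strongly_measurable f" "strongly_measurable g"
  shows "strongly_measurable (\<lambda>s. f s + g s)"
  by (rule strongly_measurable_compose2[OF assms, of "\<lambda>x y. x + y"]) (intro continuous_intros)

lemma strongly_measurable_diff:
  assumes "strongly_measurable f" "strongly_measurable g"
  shows "strongly_measurable (\<lambda>s. f s - g s)"
  by (rule strongly_measurable_compose2[OF assms, of "\<lambda>x y. x - y"]) (intro continuous_intros)

lemma strongly_measurable_Pair:
  assumes "strongly_measurable f" "strongly_measurable g"
  shows "strongly_measurable (\<lambda>s. (f s, g s))"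
  by (rule strongly_measurable_compose2[OF assms, of "\<lambda>x y. (x, y)"]) (intro continuous_intros)

lemma strongly_measurable_blinfun_apply:
  assumes "strongly_measurable f" "strongly_measurable g"
  shows "strongly_measurable (\<lambda>s. blinfun_apply (f s) (g s))"
  by (rule strongly_measurable_compose2[OF assms, of "\<lambda>x y. blinfun_apply x y"]) (intro continuous_intros)

lemma strongly_measurable_scaleR:
  assumes "strongly_measurable f"
  shows "strongly_measurable (\<lambda>s. c *\<^sub>R f s)"
  by (rule strongly_measurable_compose[OF assms, of "\<lambda>x. c *\<^sub>R x"]) (intro continuous_intros)

lemma L2_strongly_measurable: "f \<in> L2 \<Longrightarrow> strongly_measurable f"
  by (simp add: L2_def)

lemma L2_integrable_square: "f \<in> L2 \<Longrightarrow> integrable lebesgue (\<lambda>s. (norm (f s))\<^sup>2)"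
  by (simp add: L2_def)

lemma L2_norm_nonneg [simp]: "L2_norm f \<ge> 0"
  by (simp add: L2_norm_def)

lemma L2_norm_power2: "(L2_norm f)\<^sup>2 = (LINT s|lebesgue. (norm (f s))\<^sup>2)"
  by (simp add: L2_norm_def)

lemma L2_norm_AE_cong:
  assumes "f \<in> L2" "AE s in lebesgue. f s = g s"
  shows "g \<in> L2" "L2_norm g = L2_norm f"
proof -
  have g: "strongly_measurable g"
    using assms strongly_measurable_AE_cong L2_strongly_measurable by blast
  have eq: "AE s in lebesgue. (norm (g s))\<^sup>2 = (norm (f s))\<^sup>2"
    using assms(2) by eventually_elim simp
  note m = strongly_measurable_norm[OF g] strongly_measurable_norm[OF L2_strongly_measurable[OF assms(1)]]
  show "g \<in> L2"
    using integrable_cong_AE[THEN iffD2, OF _ _ eq] m L2_integrable_square[OF assms(1)] g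
    by (simp add: L2_def)
  show "L2_norm g = L2_norm f"
    unfolding L2_norm_def using m by (intro arg_cong[where f=sqrt] integral_cong_AE eq) simp_all
qed

text \<open>A substitute for Minkowski's inequality; the constant is irrelevant for what follows.\<close>

lemma L2_dominated:
  assumes f: "strongly_measurable f" and g: "g1 \<in> L2" "g2 \<in> L2" "g3 \<in> L2"
    and c: "c1 \<ge> 0" "c2 \<ge> 0" "c3 \<ge> 0"
    and le: "AE s in lebesgue. norm (f s) \<le> c1 * norm (g1 s) + c2 * norm (g2 s) + c3 * norm (g3 s)"
  shows "f \<in> L2" "L2_norm f \<le> 2 * (c1 * L2_norm g1 + c2 * L2_norm g2 + c3 * L2_norm g3)"
proof -
  let ?h = "\<lambda>s. 3 * (c1\<^sup>2 * (norm (g1 s))\<^sup>2 + c2\<^sup>2 * (norm (g2 s))\<^sup>2 + c3\<^sup>2 * (norm (g3 s))\<^sup>2)"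
  have three: "(x + y + z)\<^sup>2 \<le> 3 * (x\<^sup>2 + y\<^sup>2 + z\<^sup>2)" for x y z :: real
    using sum_squares_ge_zero[of "x - y" "y - z"] zero_le_power2[of "x - z"]
    by (simp add: power2_eq_square algebra_simps)
  have le': "AE s in lebesgue. (norm (f s))\<^sup>2 \<le> ?h s"
    using le
  proof eventually_elim
    case (elim s)
    have "(norm (f s))\<^sup>2 \<le> (c1 * norm (g1 s) + c2 * norm (g2 s) + c3 * norm (g3 s))\<^sup>2"
      using elim by (intro power_mono) auto
    also have "\<dots> \<le> ?h s" using three[of "c1 * norm (g1 s)" "c2 * norm (g2 s)" "c3 * norm (g3 s)"]
      by (simp add: power_mult_distrib)
    finally show ?case .
  qed
  note gi = g[THEN L2_integrable_square]
  have h: "integrable lebesgue ?h" using gi by simp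
  have "AE s in lebesgue. norm ((norm (f s))\<^sup>2) \<le> norm (?h s)"
    using le' by eventually_elim simp
  then have i: "integrable lebesgue (\<lambda>s. (norm (f s))\<^sup>2)"
    using strongly_measurable_norm[OF f] by (intro Bochner_Integration.integrable_bound[OF h]) auto
  then show "f \<in> L2" using f by (simp add: L2_def)
  have "(L2_norm f)\<^sup>2 \<le> (LINT s|lebesgue. ?h s)"
    unfolding L2_norm_power2 by (rule integral_mono_AE[OF i h le'])
  also have "\<dots> = 3 * ((c1 * L2_norm g1)\<^sup>2 + (c2 * L2_norm g2)\<^sup>2 + (c3 * L2_norm g3)\<^sup>2)"
    using gi by (simp add: L2_norm_power2 power_mult_distrib)
  \<comment> \<open>The factor 2 is a convenient majorant of the square root of 3.\<close>
  also have "\<dots> \<le> (2 * (c1 * L2_norm g1 + c2 * L2_norm g2 + c3 * L2_norm g3))\<^sup>2"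
  proof -
    have "3 * (x\<^sup>2 + y\<^sup>2 + z\<^sup>2) \<le> (2 * (x + y + z))\<^sup>2" if "x \<ge> 0" "y \<ge> 0" "z \<ge> 0" for x y z :: real
      using mult_nonneg_nonneg[OF that(1,2)] mult_nonneg_nonneg[OF that(1,3)] mult_nonneg_nonneg[OF that(2,3)]
        zero_le_power2[of x] zero_le_power2[of y] zero_le_power2[of z]
      unfolding power2_eq_square by (simp add: algebra_simps)
    then show ?thesis using c by simp
  qed
  finally show "L2_norm f \<le> 2 * (c1 * L2_norm g1 + c2 * L2_norm g2 + c3 * L2_norm g3)"
    by (rule power2_le_imp_le) (use c in auto)
qed

lemma L2_dominated2:
  assumes "strongly_measurable f" "g1 \<in> L2" "g2 \<in> L2" "c1 \<ge> 0" "c2 \<ge> 0"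
    and "AE s in lebesgue. norm (f s) \<le> c1 * norm (g1 s) + c2 * norm (g2 s)"
  shows "f \<in> L2" "L2_norm f \<le> 2 * (c1 * L2_norm g1 + c2 * L2_norm g2)"
  using L2_dominated[of f g1 g2 g2 c1 c2 0] assms by auto

lemma L2_dominated1:
  assumes "strongly_measurable f" "g1 \<in> L2" "c1 \<ge> 0"
    and "AE s in lebesgue. norm (f s) \<le> c1 * norm (g1 s)"
  shows "f \<in> L2" "L2_norm f \<le> 2 * (c1 * L2_norm g1)"
  using L2_dominated2[of f g1 g1 c1 0] assms by auto

lemma L2_norm_mono:
  assumes f: "strongly_measurable f" and g: "g \<in> L2" and le: "AE s in lebesgue. norm (f s) \<le> norm (g s)"
  shows "L2_norm f \<le> L2_norm g"
proof -
  have "f \<in> L2" using L2_dominated1[OF f g, of 1] le by simp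
  then show ?thesis
    unfolding L2_norm_def using L2_integrable_square[OF g] L2_integrable_square[of f] le
    by (intro real_sqrt_le_mono integral_mono_AE) (auto elim!: eventually_mono intro: power_mono)
qed

lemma L2_add: assumes "f \<in> L2" "g \<in> L2" shows "(\<lambda>s. f s + g s) \<in> L2"
  by (rule L2_dominated2(1)[OF strongly_measurable_add[OF assms[THEN L2_strongly_measurable]] assms, of 1 1])
     (auto intro: norm_triangle_ineq)

lemma L2_scaleR: assumes "f \<in> L2" shows "(\<lambda>s. c *\<^sub>R f s) \<in> L2"
  by (rule L2_dominated1(1)[OF strongly_measurable_scaleR[OF assms[THEN L2_strongly_measurable]] assms, of "\<bar>c\<bar>"])
     auto

lemma L2_diff: assumes "f \<in> L2" "g \<in> L2" shows "(\<lambda>s. f s - g s) \<in> L2"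
  using L2_add[OF assms(1) L2_scaleR[OF assms(2), of "-1"]] by simp

lemma L2_Pair: assumes "f \<in> L2" "g \<in> L2" shows "(\<lambda>s. (f s, g s)) \<in> L2"
  by (rule L2_dominated2(1)[OF strongly_measurable_Pair[OF assms[THEN L2_strongly_measurable]] assms, of 1 1])
     (auto intro: norm_Pair_le)

lemma L2_inner_integrable:
  assumes "f \<in> L2" "g \<in> L2" shows "integrable lebesgue (\<lambda>s. inner (f s) (g s))"
proof (rule Bochner_Integration.integrable_bound)
  show "integrable lebesgue (\<lambda>s. (norm (f s))\<^sup>2 + (norm (g s))\<^sup>2)"
    using assms[THEN L2_integrable_square] by simp
  show "(\<lambda>s. inner (f s) (g s)) \<in> borel_measurable lebesgue"
    using assms by (intro strongly_measurable_inner L2_strongly_measurable)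
  have "\<bar>inner (f s) (g s)\<bar> \<le> (norm (f s))\<^sup>2 + (norm (g s))\<^sup>2" for s
  proof -
    have "\<bar>inner (f s) (g s)\<bar> \<le> norm (f s) * norm (g s)" by (rule Cauchy_Schwarz_ineq2)
    also have "\<dots> \<le> (norm (f s))\<^sup>2 + (norm (g s))\<^sup>2"
      using sum_squares_bound[of "norm (f s)" "norm (g s)"]
        mult_nonneg_nonneg[OF norm_ge_zero norm_ge_zero, of "f s" "g s"] by linarith
    finally show ?thesis .
  qed
  then show "AE s in lebesgue. norm (inner (f s) (g s)) \<le> norm ((norm (f s))\<^sup>2 + (norm (g s))\<^sup>2)"
    by (simp add: order_trans[OF _ abs_ge_self])
qed

section \<open>Absolutely continuous curves and the chain rule\<close>

text \<open>Variational proof: \<open>J\<close> is bounded below, the parallelogram law makes a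
  minimising sequence Cauchy, and the first variation at the minimiser \<open>w\<close> vanishes,
  which is the representation.\<close>

lemma riesz_representation:
  fixes l :: "'c::{real_inner, banach} \<Rightarrow> real"
  assumes l: "bounded_linear l"
  obtains w where "\<And>x. l x = inner w x"
proof -
  interpret l: bounded_linear l by fact
  obtain B where B: "B > 0" "\<And>x. \<bar>l x\<bar> \<le> norm x * B" using l.pos_bounded by auto
  define J where "J x = (norm x)\<^sup>2 - 2 * l x" for x
  have lower: "J x \<ge> - B\<^sup>2" for x
  proof -
    have "2 * l x \<le> 2 * (norm x * B)" using B(2)[of x] by linarith
    also have "\<dots> \<le> (norm x)\<^sup>2 + B\<^sup>2" using sum_squares_bound[of "norm x" B] by linarith
    finally show ?thesis unfolding J_def by linarith
  qed
  define m where "m = (INF x. J x)"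
  have bdd: "bdd_below (range J)" using lower by (intro bdd_belowI[of _ "- B\<^sup>2"]) auto
  have m: "m \<le> J x" for x unfolding m_def by (rule cINF_lower[OF bdd]) simp
  have "\<exists>x. J x < m + 1 / real (Suc n)" for n
    using cINF_less_iff[OF _ bdd, of "m + 1 / real (Suc n)"] unfolding m_def by auto
  then obtain X where X: "\<And>n. J (X n) < m + 1 / real (Suc n)" by metis
  \<comment> \<open>Compares the midpoint value of \<open>J\<close> with the infimum, using the
    parallelogram law.\<close>
  have par: "(norm (x - y))\<^sup>2 \<le> 2 * (J x - m) + 2 * (J y - m)" for x y
  proof -
    have "m \<le> J ((1/2) *\<^sub>R (x + y))" by (rule m)
    also have "\<dots> = (norm (x + y))\<^sup>2 / 4 - l x - l y"
      unfolding J_def by (simp add: l.scaleR l.add power_mult_distrib power_divide add_divide_distrib)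
    finally have "m \<le> (norm (x + y))\<^sup>2 / 4 - l x - l y" .
    moreover have "(norm (x - y))\<^sup>2 = 2 * (norm x)\<^sup>2 + 2 * (norm y)\<^sup>2 - (norm (x + y))\<^sup>2"
      by (simp add: power2_norm_eq_inner inner_add_left inner_add_right inner_diff_left inner_diff_right inner_commute)
    moreover have "N \<le> 2 * (c - 2 * a - k) + 2 * (d - 2 * b - k)"
      if "k \<le> P / 4 - a - b" "N = 2 * c + 2 * d - P" for N P a b c d k :: real
      using that by argo
    ultimately show ?thesis unfolding J_def by blast
  qed
  have "Cauchy X"
  proof (rule metric_CauchyI)
    fix e :: real assume "e > 0"
    then obtain N where N: "1 / real (Suc N) < e\<^sup>2 / 4" 
      using reals_Archimedean[of "e\<^sup>2 / 4"] by (auto simp: inverse_eq_divide)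
    have small: "J (X n) - m < e\<^sup>2 / 4" if "n \<ge> N" for n
    proof -
      have "1 / real (Suc n) \<le> 1 / real (Suc N)" using that by (simp add: frac_le)
      then show ?thesis using X[of n] N by linarith
    qed
    have "dist (X i) (X k) < e" if "i \<ge> N" "k \<ge> N" for i k
    proof -
      have "(norm (X i - X k))\<^sup>2 < e\<^sup>2" using par[of "X i" "X k"] small[OF that(1)] small[OF that(2)] by argo
      then show ?thesis using \<open>e > 0\<close> by (simp add: dist_norm power_less_imp_less_base)
    qed
    then show "\<exists>M. \<forall>i\<ge>M. \<forall>k\<ge>M. dist (X i) (X k) < e" by blast
  qed
  then obtain w where w: "X \<longlonglongrightarrow> w" using Cauchy_convergent_iff convergent_def by metis
  have Jw: "J w \<le> m"
  proof (rule LIMSEQ_le)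
    show "(\<lambda>n. J (X n)) \<longlonglongrightarrow> J w" unfolding J_def by (intro tendsto_intros w l.tendsto)
    show "(\<lambda>n. m + 1 / real (Suc n)) \<longlonglongrightarrow> m"
      using tendsto_add[OF tendsto_const[of m] LIMSEQ_inverse_real_of_nat] by (simp add: inverse_eq_divide)
    show "\<exists>N. \<forall>n\<ge>N. J (X n) \<le> m + 1 / real (Suc n)" using X less_imp_le by blast
  qed
  have "l x = inner w x" for x
  proof -
    define a where "a = inner w x - l x"
    have q: "0 \<le> 2 * t * a + t\<^sup>2 * (norm x)\<^sup>2" for t
    proof -
      have "J w \<le> J (w + t *\<^sub>R x)" using Jw m order_trans by blast
      moreover have "J (w + t *\<^sub>R x) = J w + 2 * t * a + t\<^sup>2 * (norm x)\<^sup>2"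
        unfolding J_def a_def power2_norm_eq_inner
        by (simp add: inner_add_left inner_add_right inner_commute l.add l.scaleR power2_eq_square algebra_simps)
      ultimately show ?thesis by linarith
    qed
    have "a = 0"
    proof (cases "norm x = 0")
      case True
      then show ?thesis using q[of 1] q[of "-1"] by simp
    next
      case False
      \<comment> \<open>The choice of t minimises the quadratic in \<open>q\<close>, so
        nonnegativity there forces \<open>a\<close> to vanish.\<close>
      have "0 \<le> 2 * (- a / (norm x)\<^sup>2) * a + (- a / (norm x)\<^sup>2)\<^sup>2 * (norm x)\<^sup>2" by (rule q)
      also have "\<dots> = - (a\<^sup>2 / (norm x)\<^sup>2)" using False by (simp add: field_simps power2_eq_square)
      finally have "a\<^sup>2 / (norm x)\<^sup>2 \<le> 0" by linarith
      then show ?thesis using False by (auto simp: divide_le_0_iff)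
    qed
    then show ?thesis by (simp add: a_def)
  qed
  then show ?thesis using that by blast
qed

text \<open>Stronger than uniform continuity on \<open>K\<close>: only one of the two points lies in
  \<open>K\<close>. This matters because neighbourhoods of compact sets are not relatively compact
  in infinite dimensions.\<close>

lemma continuous_near_compact:
  fixes f :: "'c::real_normed_vector \<Rightarrow> 'd::real_normed_vector"
  assumes K: "compact K" and f: "continuous_on UNIV f" and e: "e > 0"
  shows "\<exists>d>0. \<forall>x\<in>K. \<forall>y. norm (y - x) < d \<longrightarrow> norm (f y - f x) < e"
proof -
  have "\<forall>x. \<exists>r>0. \<forall>y. norm (y - x) < r \<longrightarrow> norm (f y - f x) < e / 2"
  proof
    fix x
    have "isCont f x" using f continuous_on_eq_continuous_at[OF open_UNIV] by blast
    then show "\<exists>r>0. \<forall>y. norm (y - x) < r \<longrightarrow> norm (f y - f x) < e / 2"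
      using e unfolding continuous_at_eps_delta dist_norm by (metis half_gt_zero)
  qed
  then obtain r where r: "\<And>x. r x > 0" "\<And>x y. norm (y - x) < r x \<Longrightarrow> norm (f y - f x) < e / 2" by metis
  have "K \<subseteq> (\<Union>x\<in>K. ball x (r x / 2))" using r(1) by fastforce
  then obtain C where C: "C \<subseteq> K" "finite C" "K \<subseteq> (\<Union>x\<in>C. ball x (r x / 2))"
    using compactE_image[OF K, of K "\<lambda>x. ball x (r x / 2)"] by auto
  \<comment> \<open>Radii are halved so that \<open>x\<close> and \<open>y\<close> both land in one
    ball on which \<open>f\<close> oscillates little; the 1 keeps the minimum defined for empty
    \<open>C\<close>.\<close>
  define d where "d = Min (insert 1 ((\<lambda>x. r x / 2) ` C))"
  have "d > 0" unfolding d_def using C(2) r(1) by (subst Min_gr_iff) auto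
  moreover have "norm (f y - f x) < e" if "x \<in> K" "norm (y - x) < d" for x y
  proof -
    obtain z where z: "z \<in> C" "norm (x - z) < r z / 2" using C(3) \<open>x \<in> K\<close> by (auto simp: dist_norm norm_minus_commute)
    have "d \<le> r z / 2" unfolding d_def using C(2) z(1) by (intro Min_le) auto
    then have "norm (y - z) < r z" using that(2) z(2) norm_triangle_ineq[of "y - x" "x - z"] by simp
    then have "norm (f y - f z) < e / 2" by (rule r(2))
    moreover have "norm (f x - f z) < e / 2" using r(1)[of z] z(2) by (intro r(2)) linarith
    ultimately show ?thesis using norm_triangle_ineq4[of "f y - f z" "f x - f z"] by simp
  qed
  ultimately show ?thesis by blast
qed

lemma compact_continuous_bounded:
  fixes f :: "'c::topological_space \<Rightarrow> 'd::real_normed_vector"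
  assumes K: "compact K" and f: "continuous_on UNIV f"
  shows "\<exists>M. \<forall>x\<in>K. norm (f x) \<le> M"
proof -
  have "compact (f ` K)"
    by (rule compact_continuous_image[OF continuous_on_subset[OF f subset_UNIV] K])
  then have "bounded (f ` K)" by (rule compact_imp_bounded)
  then show ?thesis unfolding bounded_iff by simp
qed

lemma linearization_bound:
  fixes F :: "'c::real_normed_vector \<Rightarrow> 'd::real_normed_vector" and F' :: "'c \<Rightarrow> 'c \<Rightarrow>\<^sub>L 'd"
  assumes F: "\<And>x. (F has_derivative F' x) (at x)"
    and B: "\<And>y. norm (y - x) \<le> norm h \<Longrightarrow> norm (F' y - F' x) \<le> B"
  shows "norm (F (x + h) - F x - F' x h) \<le> norm h * B"
proof -
  let ?S = "cball x (norm h)"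
  have S: "x + t *\<^sub>R (x + h - x) \<in> ?S" if "t \<in> {0..1}" for t :: real
    using that by (simp add: dist_norm mult_left_le_one_le)
  have d: "(F has_derivative F' y) (at y within ?S)" for y
    using F by (rule has_derivative_at_withinI)
  have o: "onorm (blinfun_apply (F' y) - blinfun_apply (F' x)) \<le> B" if "y \<in> ?S" for y
  proof -
    have "blinfun_apply (F' y) - blinfun_apply (F' x) = blinfun_apply (F' y - F' x)"
      by (simp add: fun_eq_iff blinfun.diff_left)
    then show ?thesis using B[of y] that by (simp add: dist_norm norm_minus_commute norm_blinfun.rep_eq)
  qed
  have "norm (F (x + h) - F x - F' x (x + h - x)) \<le> norm (x + h - x) * B"
    by (rule differentiable_bound_linearization[OF S d o]) auto
  then show ?thesis by simp
qed

section \<open>Integrals over compact intervals\<close>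

lemma set_integral_split_interval:
  fixes f :: "real \<Rightarrow> real"
  assumes "s \<le> t" "t \<le> u" and f: "set_integrable lebesgue {s..u} f"
  shows "(LINT x:{s..u}|lebesgue. f x) = (LINT x:{s..t}|lebesgue. f x) + (LINT x:{t..u}|lebesgue. f x)"
proof -
  have "AE x in lebesgue. x \<noteq> t" by (rule AE_completion[OF AE_lborel_singleton])
  then have "AE x in lebesgue. \<not> (x \<in> {s..t} \<and> x \<in> {t..u})" by eventually_elim auto
  moreover have "{s..u} = {s..t} \<union> {t..u}" using assms by auto
  moreover have "set_integrable lebesgue {s..t} f" "set_integrable lebesgue {t..u} f"
    using assms by (auto intro: set_integrable_subset[OF f])
  ultimately show ?thesis using set_integral_Un_AE[of "{s..t}" "{t..u}" lebesgue f] by simp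
qed

text \<open>Both sides are additive over adjacent intervals, so a bound on short intervals sums up
  to a bound on long ones. The induction counts the pieces of length d/2.\<close>

lemma additive_interval_bound:
  fixes D I :: "real \<Rightarrow> real \<Rightarrow> real"
  assumes D: "\<And>s t u. S \<le> s \<Longrightarrow> s \<le> t \<Longrightarrow> t \<le> u \<Longrightarrow> u \<le> T \<Longrightarrow> D s u = D s t + D t u"
    and I: "\<And>s t u. S \<le> s \<Longrightarrow> s \<le> t \<Longrightarrow> t \<le> u \<Longrightarrow> u \<le> T \<Longrightarrow> I s u = I s t + I t u"
    and d: "d > 0" and le: "\<And>s t. S \<le> s \<Longrightarrow> s \<le> t \<Longrightarrow> t \<le> T \<Longrightarrow> t - s < d \<Longrightarrow> \<bar>D s t\<bar> \<le> I s t"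
    and "S \<le> T"
  shows "\<bar>D S T\<bar> \<le> I S T"
proof -
  have *: "S \<le> s \<Longrightarrow> s \<le> t \<Longrightarrow> t \<le> T \<Longrightarrow> t - s \<le> real n * (d / 2) \<Longrightarrow> \<bar>D s t\<bar> \<le> I s t" for n s t
  proof (induction n arbitrary: t)
    case 0 then show ?case using le[of s t] d by auto
  next
    case (Suc n)
    \<comment> \<open>Half of \<open>d\<close> keeps the last piece strictly shorter than
      \<open>d\<close>; the maximum keeps its left end inside the interval.\<close>
    define r where "r = max s (t - d / 2)"
    have r: "s \<le> r" "r \<le> t" "t - r < d" "r - s \<le> real n * (d / 2)"
      using Suc.prems d unfolding r_def max_def by (auto simp: algebra_simps)
    have "\<bar>D s r\<bar> \<le> I s r" using Suc r by auto
    moreover have "\<bar>D r t\<bar> \<le> I r t" using Suc.prems r by (intro le) auto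
    ultimately show ?case using D[of s r t] I[of s r t] Suc.prems r by auto
  qed
  obtain n where "T - S \<le> real n * (d / 2)"
    using real_arch_simple[of "(T - S) / (d / 2)"] d by (auto simp: field_simps)
  then show ?thesis using *[of S T n] \<open>S \<le> T\<close> by auto
qed

text \<open>A norm is at most 1 plus its square, and the constant 1 is integrable over a bounded
  interval.\<close>

lemma L2_set_integrable:
  fixes f :: "real \<Rightarrow> real" and v :: "real \<Rightarrow> 'c::real_normed_vector"
  assumes f: "f \<in> borel_measurable lebesgue" and v: "v \<in> L2"
    and le: "\<And>x. x \<in> {s..t} \<Longrightarrow> \<bar>f x\<bar> \<le> c * norm (v x)"
  shows "set_integrable lebesgue {s..t} f"
  unfolding set_integrable_def
proof (rule Bochner_Integration.integrable_bound)
  show "integrable lebesgue (\<lambda>x. \<bar>c\<bar> * (indicator {s..t} x + (norm (v x))\<^sup>2))"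
    using L2_integrable_square[OF v]
    by (intro integrable_mult_right Bochner_Integration.integrable_add integrable_real_indicator)
      (auto simp: emeasure_lborel_Icc_eq)
  show "(\<lambda>x. indicator {s..t} x *\<^sub>R f x) \<in> borel_measurable lebesgue"
    using f by (intro borel_measurable_scaleR borel_measurable_indicator) auto
  have "norm (indicator {s..t} x *\<^sub>R f x) \<le> norm (\<bar>c\<bar> * (indicator {s..t} x + (norm (v x))\<^sup>2))" for x
  proof (cases "x \<in> {s..t}")
    case True
    have "\<bar>f x\<bar> \<le> \<bar>c\<bar> * norm (v x)" using le[OF True] by (meson abs_ge_self mult_right_mono norm_ge_zero order_trans)
    also have "\<dots> \<le> \<bar>c\<bar> * (1 + (norm (v x))\<^sup>2)"
      using sum_squares_bound[of 1 "norm (v x)"] norm_ge_zero[of "v x"] by (intro mult_left_mono) (simp_all del: norm_ge_zero)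
    finally show ?thesis using True by (simp add: abs_mult abs_if)
  qed simp
  then show "AE x in lebesgue. norm (indicator {s..t} x *\<^sub>R f x) \<le> norm (\<bar>c\<bar> * (indicator {s..t} x + (norm (v x))\<^sup>2))"
    by simp
qed

lemma L2_set_integrable_norm: "v \<in> L2 \<Longrightarrow> set_integrable lebesgue {s..t} (\<lambda>x. norm (v x))"
  by (rule L2_set_integrable[of _ v _ _ 1]) (simp_all add: strongly_measurable_norm L2_strongly_measurable)

lemma L2_set_integrable_inner: "v \<in> L2 \<Longrightarrow> set_integrable lebesgue {s..t} (\<lambda>x. inner e (v x))"
  by (rule L2_set_integrable[of _ v _ _ "norm e"])
     (simp_all add: strongly_measurable_inner strongly_measurable_const L2_strongly_measurable Cauchy_Schwarz_ineq2)

lemma abs_set_integral_le: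
  fixes f :: "real \<Rightarrow> real"
  assumes "set_integrable lebesgue {s..t} f" "set_integrable lebesgue {s..t} g"
    and "\<And>x. x \<in> {s..t} \<Longrightarrow> \<bar>f x\<bar> \<le> g x"
  shows "\<bar>LINT x:{s..t}|lebesgue. f x\<bar> \<le> (LINT x:{s..t}|lebesgue. g x)"
proof -
  have "\<bar>LINT x:{s..t}|lebesgue. f x\<bar> \<le> (LINT x:{s..t}|lebesgue. \<bar>f x\<bar>)"
    using set_integral_norm_bound[OF assms(1)] by simp
  also have "\<dots> \<le> (LINT x:{s..t}|lebesgue. g x)"
    using assms set_integrable_abs[OF assms(1)] by (intro set_integral_mono) auto
  finally show ?thesis .
qed


text \<open>Cauchy-Schwarz on a unit interval, obtained from Young's inequality with a free weight
  \<open>e\<close>. The optimal weight is the square root of the integral of the squared norm; when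
  that integral is zero, \<open>e\<close> tends to 0 instead.\<close>

lemma set_integral_norm_le_sqrt:
  assumes v: "v \<in> L2"
  shows "(LINT x:{s..s+1}|lebesgue. norm (v x)) \<le> sqrt (LINT x:{s..s+1}|lebesgue. (norm (v x))\<^sup>2)"
proof -
  let ?c = "LINT x:{s..s+1}|lebesgue. (norm (v x))\<^sup>2"
  have iv: "set_integrable lebesgue {s..s+1} (\<lambda>x. norm (v x))" by (rule L2_set_integrable_norm[OF v])
  have isq: "set_integrable lebesgue {s..s+1} (\<lambda>x. (norm (v x))\<^sup>2)"
    by (rule set_integrable_subset[of lebesgue UNIV])
       (use L2_integrable_square[OF v] in \<open>auto simp: set_integrable_def\<close>)
  have i1: "set_integrable lebesgue {s..s+1} (\<lambda>x. c)" for c :: real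
    unfolding set_integrable_def by (intro integrable_scaleR_left integrable_real_indicator)
      (auto simp: emeasure_lborel_Icc_eq)
  have c0: "?c \<ge> 0" unfolding set_lebesgue_integral_def by (rule integral_nonneg_AE) auto
  have bound: "(LINT x:{s..s+1}|lebesgue. norm (v x)) \<le> e / 2 + ?c / (2 * e)" if e: "e > 0" for e
  proof -
    have "(LINT x:{s..s+1}|lebesgue. norm (v x)) \<le> (LINT x:{s..s+1}|lebesgue. e / 2 + 1 / (2 * e) * (norm (v x))\<^sup>2)"
    proof (rule set_integral_mono[OF iv])
      show "set_integrable lebesgue {s..s+1} (\<lambda>x. e / 2 + 1 / (2 * e) * (norm (v x))\<^sup>2)"
        using i1 isq by (intro set_integral_add set_integrable_mult_right) auto
      show "norm (v x) \<le> e / 2 + 1 / (2 * e) * (norm (v x))\<^sup>2" for x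
        using sum_squares_bound[of e "norm (v x)"] e by (simp add: field_simps power2_eq_square)
    qed
    also have "\<dots> = e / 2 + 1 / (2 * e) * ?c"
      using i1[of "e/2"] isq by (subst set_integral_add) (auto simp: set_lebesgue_integral_def)
    finally show ?thesis by simp
  qed
  show ?thesis
  proof (cases "?c = 0")
    case True
    have "(LINT x:{s..s+1}|lebesgue. norm (v x)) \<le> 0 + e" if "e > 0" for e
      using bound[of e] that True by simp
    then have "(LINT x:{s..s+1}|lebesgue. norm (v x)) \<le> 0" by (rule field_le_epsilon)
    then show ?thesis using True by simp
  next
    case False
    then have "?c > 0" using c0 by simp
    then show ?thesis using bound[of "sqrt ?c"] by (simp add: real_div_sqrt field_simps)
  qed
qed

text \<open>The Bochner integral of the library needs a second countable target, so the integral of \<open>v\<close> is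
  tested against vectors.\<close>

definition has_ac_derivative :: "(real \<Rightarrow> 'c::real_inner) \<Rightarrow> (real \<Rightarrow> 'c) \<Rightarrow> bool" where
  "has_ac_derivative f v \<longleftrightarrow>
     (\<forall>s t e. s \<le> t \<longrightarrow> (LINT x:{s..t}|lebesgue. inner e (v x)) = inner e (f t - f s))"

lemma has_ac_derivativeD:
  "has_ac_derivative f v \<Longrightarrow> s \<le> t \<Longrightarrow> (LINT x:{s..t}|lebesgue. inner e (v x)) = inner e (f t - f s)"
  by (simp add: has_ac_derivative_def)

text \<open>Testing against the increment itself turns the scalar identities into a norm bound after
  division by the length of the increment.\<close>

lemma ac_norm_diff_le:
  assumes ac: "has_ac_derivative f v" and v: "v \<in> L2" and st: "s \<le> t"
  shows "norm (f t - f s) \<le> (LINT x:{s..t}|lebesgue. norm (v x))"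
proof -
  let ?d = "f t - f s"
  have iv: "set_integrable lebesgue {s..t} (\<lambda>x. norm (v x))" by (rule L2_set_integrable_norm[OF v])
  have "(norm ?d)\<^sup>2 = (LINT x:{s..t}|lebesgue. inner ?d (v x))"
    using has_ac_derivativeD[OF ac st] by (simp add: power2_norm_eq_inner)
  also have "\<dots> \<le> \<bar>LINT x:{s..t}|lebesgue. inner ?d (v x)\<bar>" by simp
  also have "\<dots> \<le> (LINT x:{s..t}|lebesgue. norm ?d * norm (v x))"
    using iv by (intro abs_set_integral_le L2_set_integrable_inner v set_integrable_mult_right Cauchy_Schwarz_ineq2)
  also have "\<dots> = norm ?d * (LINT x:{s..t}|lebesgue. norm (v x))" by simp
  finally have *: "norm ?d * norm ?d \<le> norm ?d * (LINT x:{s..t}|lebesgue. norm (v x))"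
    by (simp add: power2_eq_square)
  have "0 \<le> (LINT x:{s..t}|lebesgue. norm (v x))"
    unfolding set_lebesgue_integral_def by (rule integral_nonneg_AE) auto
  then show ?thesis using * by (cases "norm ?d = 0") auto
qed

text \<open>On short intervals the two sides differ by at most \<open>\<epsilon> \<integral>\<bar>v\<bar>\<close>; this bound is additive, so it holds
  on all intervals. Linear functionals enter through Riesz representation because the absolutely
  continuous derivative is tested against vectors only.\<close>

lemma ac_chain_rule:
  fixes F :: "'c::{real_inner, banach} \<Rightarrow> 'd::real_inner" and F' :: "'c \<Rightarrow> 'c \<Rightarrow>\<^sub>L 'd"
  assumes F: "\<And>x. (F has_derivative F' x) (at x)" and F': "continuous_on UNIV F'"
    and f: "continuous_on UNIV f" and ac: "has_ac_derivative f v" and v: "v \<in> L2" and ST: "S \<le> T"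
  shows "set_integrable lebesgue {S..T} (\<lambda>x. inner e (F' (f x) (v x)))"
    and "(LINT x:{S..T}|lebesgue. inner e (F' (f x) (v x))) = inner e (F (f T) - F (f S))"
proof -
  have sm: "strongly_measurable (\<lambda>x. F' (f x))" 
    by (intro strongly_measurable_continuous continuous_on_compose2[OF F' f]) auto
  have m: "(\<lambda>x. inner e (F' (f x) (v x))) \<in> borel_measurable lebesgue"
    by (rule strongly_measurable_inner[OF strongly_measurable_const
        strongly_measurable_blinfun_apply[OF sm L2_strongly_measurable[OF v]]])
  define K where "K = f ` {S..T}"
  have K: "compact K" unfolding K_def by (rule compact_continuous_image[OF continuous_on_subset[OF f]]) auto
  obtain M where M: "\<And>x. x \<in> K \<Longrightarrow> norm (F' x) \<le> M"
    using compact_continuous_bounded[OF K F'] by auto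
  have int: "set_integrable lebesgue {s..t} (\<lambda>x. inner e (F' (f x) (v x)))" if "S \<le> s" "t \<le> T" for s t
  proof (rule L2_set_integrable[OF m v, of _ _ "norm e * M"])
    fix x assume "x \<in> {s..t}"
    then have "norm (F' (f x)) \<le> M" using that by (intro M) (auto simp: K_def)
    have "\<bar>inner e (F' (f x) (v x))\<bar> \<le> norm e * norm (F' (f x) (v x))" by (rule Cauchy_Schwarz_ineq2)
    also have "\<dots> \<le> norm e * (norm (F' (f x)) * norm (v x))" by (intro mult_left_mono norm_blinfun) simp
    also have "\<dots> \<le> norm e * (M * norm (v x))"
      by (intro mult_left_mono mult_right_mono) (auto simp: \<open>norm (F' (f x)) \<le> M\<close>)
    finally show "\<bar>inner e (F' (f x) (v x))\<bar> \<le> norm e * M * norm (v x)" by (simp add: mult.assoc)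
  qed
  then show "set_integrable lebesgue {S..T} (\<lambda>x. inner e (F' (f x) (v x)))" by simp
  define D where "D s t = inner e (F (f t) - F (f s)) - (LINT x:{s..t}|lebesgue. inner e (F' (f x) (v x)))" for s t
  define I where "I s t = (LINT x:{s..t}|lebesgue. norm (v x))" for s t
  have I: "I s u = I s t + I t u" if "s \<le> t" "t \<le> u" for s t u
    unfolding I_def using that by (intro set_integral_split_interval L2_set_integrable_norm v)
  have Dadd: "D s u = D s t + D t u" if "S \<le> s" "s \<le> t" "t \<le> u" "u \<le> T" for s t u
  proof -
    have "S \<le> s" "u \<le> T" using that by auto
    note split = set_integral_split_interval[OF that(2,3) int[OF this]]
    show ?thesis unfolding D_def split inner_diff_right by linarith
  qed
  \<comment> \<open>The factor 2 counts two errors of equal size: linearising \<open>F\<close> at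
    \<open>f s\<close>, and freezing \<open>F'\<close> at \<open>f s\<close> under the
    integral.\<close>
  have bound: "\<bar>D S T\<bar> \<le> (2 * norm e * \<epsilon>) * I S T" if eps: "\<epsilon> > 0" for \<epsilon>
  proof -
    obtain d0 where d0: "d0 > 0" "\<And>x y. x \<in> K \<Longrightarrow> norm (y - x) < d0 \<Longrightarrow> norm (F' y - F' x) < \<epsilon>"
      using continuous_near_compact[OF K F' eps] by auto
    have "uniformly_continuous_on {S..T} f"
      by (rule compact_uniformly_continuous[OF continuous_on_subset[OF f]]) auto
    then have "\<exists>d>0. \<forall>s\<in>{S..T}. \<forall>t\<in>{S..T}. dist t s < d \<longrightarrow> dist (f t) (f s) < d0"
      unfolding uniformly_continuous_on_def using d0(1) by (elim allE impE)
    then obtain d where d: "d > 0" "\<And>s t. s \<in> {S..T} \<Longrightarrow> t \<in> {S..T} \<Longrightarrow> dist t s < d \<Longrightarrow> dist (f t) (f s) < d0"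
      by (elim exE conjE) blast
    show ?thesis
    proof (rule additive_interval_bound[where D=D and I="\<lambda>s t. (2 * norm e * \<epsilon>) * I s t", OF _ _ d(1) _ ST])
      fix s t assume st: "S \<le> s" "s \<le> t" "t \<le> T" "t - s < d"
      have fs: "f s \<in> K" using st by (auto simp: K_def)
      have close: "norm (f x - f s) < d0" if "x \<in> {s..t}" for x
        using d(2)[of s x] that st by (auto simp: dist_norm)
      obtain w where w: "\<And>u. inner e (F' (f s) u) = inner w u"
        using riesz_representation[OF bounded_linear_compose[OF bounded_linear_inner_right blinfun.bounded_linear_right]]
        by metis
      have 1: "norm (F (f t) - F (f s) - F' (f s) (f t - f s)) \<le> norm (f t - f s) * \<epsilon>"
      proof (rule linearization_bound[OF F, of "f s" "f t - f s" \<epsilon>, simplified])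
        fix y assume "norm (y - f s) \<le> norm (f t - f s)"
        then have "norm (y - f s) < d0" using close[of t] st by simp
        then show "norm (F' y - F' (f s)) \<le> \<epsilon>" using d0(2)[OF fs, of y] by simp
      qed
      let ?J = "\<lambda>x. inner e (F' (f s) (v x))"
      have iJ: "set_integrable lebesgue {s..t} ?J" unfolding w by (rule L2_set_integrable_inner[OF v])
      have J: "inner e (F' (f s) (f t - f s)) = (LINT x:{s..t}|lebesgue. ?J x)"
        unfolding w using has_ac_derivativeD[OF ac st(2)] by simp
      have i: "set_integrable lebesgue {s..t} (\<lambda>x. inner e (F' (f x) (v x)))" using st by (intro int)
      have 2: "\<bar>LINT x:{s..t}|lebesgue. ?J x - inner e (F' (f x) (v x))\<bar> \<le> (LINT x:{s..t}|lebesgue. (norm e * \<epsilon>) * norm (v x))"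
      proof (rule abs_set_integral_le)
        show "set_integrable lebesgue {s..t} (\<lambda>x. ?J x - inner e (F' (f x) (v x)))" using iJ i by (rule set_integral_diff)
        show "set_integrable lebesgue {s..t} (\<lambda>x. (norm e * \<epsilon>) * norm (v x))"
          using L2_set_integrable_norm[OF v] by simp
        fix x assume x: "x \<in> {s..t}"
        have "?J x - inner e (F' (f x) (v x)) = inner e ((F' (f s) - F' (f x)) (v x))"
          by (simp add: blinfun.diff_left inner_diff_right)
        also have "\<bar>\<dots>\<bar> \<le> norm e * norm ((F' (f s) - F' (f x)) (v x))" by (rule Cauchy_Schwarz_ineq2)
        also have "\<dots> \<le> norm e * (norm (F' (f s) - F' (f x)) * norm (v x))" by (intro mult_left_mono norm_blinfun) simp
        also have "\<dots> \<le> norm e * (\<epsilon> * norm (v x))"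
          using d0(2)[OF fs close[OF x]] by (intro mult_left_mono mult_right_mono) (auto simp: norm_minus_commute)
        finally show "\<bar>?J x - inner e (F' (f x) (v x))\<bar> \<le> norm e * \<epsilon> * norm (v x)" by (simp add: mult.assoc)
      qed
      have "D s t = inner e (F (f t) - F (f s) - F' (f s) (f t - f s)) + (LINT x:{s..t}|lebesgue. ?J x - inner e (F' (f x) (v x)))"
        unfolding D_def using J iJ i by (simp add: set_integral_diff inner_diff_right)
      then have "\<bar>D s t\<bar> \<le> \<bar>inner e (F (f t) - F (f s) - F' (f s) (f t - f s))\<bar> + norm e * \<epsilon> * I s t"
        using 2 unfolding I_def by simp
      also have "\<bar>inner e (F (f t) - F (f s) - F' (f s) (f t - f s))\<bar> \<le> norm e * (norm (f t - f s) * \<epsilon>)"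
        by (rule order_trans[OF Cauchy_Schwarz_ineq2 mult_left_mono[OF 1 norm_ge_zero]])
      also have "norm e * (norm (f t - f s) * \<epsilon>) \<le> norm e * (I s t * \<epsilon>)"
        unfolding I_def using ac_norm_diff_le[OF ac v st(2)] eps by (intro mult_left_mono mult_right_mono) auto
      finally show "\<bar>D s t\<bar> \<le> (2 * norm e * \<epsilon>) * I s t" by (simp add: algebra_simps)
    next
      fix s t u :: real assume "s \<le> t" "t \<le> u"
      then show "2 * norm e * \<epsilon> * I s u = 2 * norm e * \<epsilon> * I s t + 2 * norm e * \<epsilon> * I t u"
        by (subst I[of s t u]) (auto simp: distrib_left)
    qed (rule Dadd)
  qed
  have "\<bar>D S T\<bar> \<le> 0 + r" if "r > 0" for r
  proof -
    \<comment> \<open>Since \<open>c\<close> may be zero, the bound is used with r/(c + 1).\<close>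
    define c where "c = 2 * norm e * I S T"
    have "c \<ge> 0" unfolding c_def I_def set_lebesgue_integral_def
      by (intro mult_nonneg_nonneg integral_nonneg_AE) auto
    then have "\<bar>D S T\<bar> \<le> c * (r / (c + 1))" using bound[of "r / (c + 1)"] that by (simp add: c_def mult_ac)
    also have "\<dots> \<le> r" using \<open>c \<ge> 0\<close> that by (simp add: field_simps)
    finally show ?thesis by simp
  qed
  then have "\<bar>D S T\<bar> \<le> 0" by (rule field_le_epsilon)
  then show "(LINT x:{S..T}|lebesgue. inner e (F' (f x) (v x))) = inner e (F (f T) - F (f S))"
    by (simp add: D_def)
qed

section \<open>Weak derivatives\<close>

text \<open>The measures with densities the positive and the negative part of \<open>h\<close> agree
  on all upper rays, hence coincide; uniqueness of densities then equates the two parts.\<close>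

lemma AE_zero_of_interval_integrals_real:
  fixes h :: "real \<Rightarrow> real"
  assumes h: "integrable lborel h"
    and zero: "\<And>a. (LINT x|lborel. indicator {a<..} x * h x) = 0"
  shows "AE x in lborel. h x = 0"
proof -
  have [measurable]: "h \<in> borel_measurable lborel" using h by (rule borel_measurable_integrable)
  let ?p = "\<lambda>x. ennreal (max 0 (h x))" and ?n = "\<lambda>x. ennreal (max 0 (- h x))"
  have ip: "integrable lborel (\<lambda>x. indicator {a<..} x * max 0 (h x))" for a
    by (rule Bochner_Integration.integrable_bound[OF h]) (auto simp: indicator_def)
  have im: "integrable lborel (\<lambda>x. indicator {a<..} x * max 0 (- h x))" for a
    by (rule Bochner_Integration.integrable_bound[OF h]) (auto simp: indicator_def)
  have P: "emeasure (density lborel ?p) {a<..} = ennreal (LINT x|lborel. indicator {a<..} x * max 0 (h x))" for a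
  proof -
    have "emeasure (density lborel ?p) {a<..} = (\<integral>\<^sup>+x. ennreal (indicator {a<..} x * max 0 (h x)) \<partial>lborel)"
      by (subst emeasure_density) (auto intro!: nn_integral_cong simp: indicator_def)
    then show ?thesis using nn_integral_eq_integral[OF ip] by simp
  qed
  have N: "emeasure (density lborel ?n) {a<..} = ennreal (LINT x|lborel. indicator {a<..} x * max 0 (- h x))" for a
  proof -
    have "emeasure (density lborel ?n) {a<..} = (\<integral>\<^sup>+x. ennreal (indicator {a<..} x * max 0 (- h x)) \<partial>lborel)"
      by (subst emeasure_density) (auto intro!: nn_integral_cong simp: indicator_def)
    then show ?thesis using nn_integral_eq_integral[OF im] by simp
  qed
  have eq: "(LINT x|lborel. indicator {a<..} x * max 0 (h x)) = (LINT x|lborel. indicator {a<..} x * max 0 (- h x))" for a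
  proof -
    have "(LINT x|lborel. indicator {a<..} x * max 0 (h x)) - (LINT x|lborel. indicator {a<..} x * max 0 (- h x))
        = (LINT x|lborel. indicator {a<..} x * max 0 (h x) - indicator {a<..} x * max 0 (- h x))"
      by (rule Bochner_Integration.integral_diff[OF ip im, symmetric])
    also have "\<dots> = (LINT x|lborel. indicator {a<..} x * h x)"
      by (rule Bochner_Integration.integral_cong) (auto simp: indicator_def max_def)
    finally show ?thesis using zero[of a] by simp
  qed
  have "density lborel ?p = density lborel ?n"
    by (rule measure_eqI_lessThan) (simp_all add: P N eq)
  then have "AE x in lborel. ?p x = ?n x"
    by (intro sigma_finite_measure.density_unique[OF lborel.sigma_finite_measure_axioms]) auto
  then show ?thesis by eventually_elim (auto simp: max_def split: if_splits)
qed

text \<open>Reduced to the preceding case by passing to a Borel representative \<open>g\<close> and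
  cutting it off to [-n, n], which makes it globally integrable.\<close>

lemma AE_zero_of_interval_integrals:
  fixes f :: "real \<Rightarrow> real"
  assumes f: "f \<in> borel_measurable lebesgue"
    and int: "\<And>s t. set_integrable lebesgue {s..t} f"
    and zero: "\<And>s t. s \<le> t \<Longrightarrow> (LINT x:{s..t}|lebesgue. f x) = 0"
  shows "AE x in lebesgue. f x = 0"
proof -
  obtain g where g: "g \<in> borel_measurable lborel" and eq: "AE x in lborel. f x = g x"
    using completion_ex_borel_measurable_real[OF f] by auto
  have eqc: "AE x in lebesgue. f x = g x" by (rule AE_completion[OF eq])
  have gm: "(\<lambda>x. indicator {s..t} x * g x) \<in> borel_measurable lborel" for s t :: real
    using g by simp
  have i: "integrable lborel (\<lambda>x. indicator {s..t} x * g x)"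
    and z: "(LINT x|lborel. indicator {s..t} x * g x) = 0" if "s \<le> t" for s t
  proof -
    have ae: "AE x in lebesgue. indicator {s..t} x *\<^sub>R f x = indicator {s..t} x * g x"
      using eqc by eventually_elim simp
    have gl: "(\<lambda>x. indicator {s..t} x * g x) \<in> borel_measurable lebesgue"
      by (rule measurable_completion[OF gm])
    have fl: "(\<lambda>x. indicator {s..t} x *\<^sub>R f x) \<in> borel_measurable lebesgue"
      using int[of s t] unfolding set_integrable_def by (rule borel_measurable_integrable)
    have "integrable lebesgue (\<lambda>x. indicator {s..t} x * g x)"
      using integrable_cong_AE[OF fl gl ae] int[of s t] unfolding set_integrable_def by simp
    then show "integrable lborel (\<lambda>x. indicator {s..t} x * g x)"
      using integrable_completion[OF gm[of s t]] by simp
    show "(LINT x|lborel. indicator {s..t} x * g x) = 0"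
      using integral_cong_AE[OF fl gl ae] zero[OF that] integral_completion[OF gm[of s t]]
      unfolding set_lebesgue_integral_def by simp
  qed
  have "AE x in lborel. indicator {- real n..real n} x * g x = 0" for n
  proof (rule AE_zero_of_interval_integrals_real)
    fix a :: real
    \<comment> \<open>Intersecting the ray with [-n, n] gives a closed interval up to the single
      point \<open>a\<close>.\<close>
    have ae: "AE x in lborel. indicator {a<..} x * (indicator {- real n..real n} x * g x)
      = (if a \<le> real n then indicator {max a (- real n)..real n} x * g x else 0)"
      using AE_lborel_singleton[of a] by eventually_elim (auto simp: indicator_def)
    have "(LINT x|lborel. indicator {a<..} x * (indicator {- real n..real n} x * g x))
      = (LINT x|lborel. (if a \<le> real n then indicator {max a (- real n)..real n} x * g x else 0))"
      using g by (intro integral_cong_AE ae) auto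
    also have "\<dots> = 0" using z[of "max a (- real n)" "real n"] by (cases "a \<le> real n") auto
    finally show "(LINT x|lborel. indicator {a<..} x * (indicator {- real n..real n} x * g x)) = 0" .
  qed (rule i, simp)
  then have "AE x in lborel. \<forall>n. indicator {- real n..real n} x * g x = 0"
    unfolding AE_all_countable by (rule allI)
  then have "AE x in lborel. g x = 0"
  proof eventually_elim
    case (elim x)
    obtain n where "\<bar>x\<bar> \<le> real n" using real_arch_simple by blast
    then have "indicator {- real n..real n} x = (1::real)" by (auto simp: indicator_def)
    then show ?case using elim[rule_format, of n] by simp
  qed
  then have "AE x in lebesgue. g x = 0" by (rule AE_completion)
  with eqc show ?thesis by eventually_elim simp
qed

text \<open>Each test vector gives its own null set, and there may be uncountably many. Strong
  measurability supplies countably many that suffice: the values of simple functions approximating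
  the difference \<open>u\<close>. Pairing \<open>u\<close> with its own approximants gives |u|^2 =
  0 in the limit.\<close>

lemma has_ac_derivative_unique:
  assumes ac: "has_ac_derivative f v" "has_ac_derivative f w" and L2: "v \<in> L2" "w \<in> L2"
  shows "AE x in lebesgue. v x = w x"
proof -
  define u where "u x = v x - w x" for x
  have u: "u \<in> L2" unfolding u_def using L2 by (rule L2_diff)
  obtain F where F: "\<And>n. simple_function lebesgue (F n)"
    and lim: "AE s in lebesgue. (\<lambda>n::nat. F n s) \<longlonglongrightarrow> u s"
    using L2_strongly_measurable[OF u] unfolding strongly_measurable_def by auto
  define E where "E = (\<Union>n. range (F n))"
  have "finite (range (F n))" for n using F[of n] unfolding simple_function_def by simp
  then have E: "countable E" unfolding E_def by (intro countable_UN[OF countableI_type countable_finite])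
  have "AE x in lebesgue. inner e (u x) = 0" for e
  proof (rule AE_zero_of_interval_integrals)
    show "(\<lambda>x. inner e (u x)) \<in> borel_measurable lebesgue"
      by (rule strongly_measurable_inner[OF strongly_measurable_const L2_strongly_measurable[OF u]])
    show "set_integrable lebesgue {s..t} (\<lambda>x. inner e (u x))" for s t
      by (rule L2_set_integrable_inner[OF u])
    fix s t :: real assume st: "s \<le> t"
    have "(LINT x:{s..t}|lebesgue. inner e (u x)) = (LINT x:{s..t}|lebesgue. inner e (v x) - inner e (w x))"
      unfolding u_def inner_diff_right ..
    also have "\<dots> = (LINT x:{s..t}|lebesgue. inner e (v x)) - (LINT x:{s..t}|lebesgue. inner e (w x))"
      by (rule set_integral_diff(2)[OF L2_set_integrable_inner[OF L2(1)] L2_set_integrable_inner[OF L2(2)]])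
    also have "\<dots> = 0" using has_ac_derivativeD[OF ac(1) st] has_ac_derivativeD[OF ac(2) st] by simp
    finally show "(LINT x:{s..t}|lebesgue. inner e (u x)) = 0" .
  qed
  then have "AE x in lebesgue. \<forall>e\<in>E. inner e (u x) = 0" by (simp add: AE_ball_countable[OF E])
  with lim have "AE x in lebesgue. u x = 0"
  proof eventually_elim
    case (elim x)
    have "(\<lambda>n. inner (F n x) (u x)) \<longlonglongrightarrow> inner (u x) (u x)"
      by (intro tendsto_intros elim)
    moreover have "inner (F n x) (u x) = 0" for n
      using elim(2) by (auto simp: E_def)
    ultimately have "inner (u x) (u x) = 0" by (simp add: LIMSEQ_const_iff)
    then show ?case by simp
  qed
  then show ?thesis by eventually_elim (simp add: u_def)
qed


section \<open>A C1 cutoff and the associated mollifier\<close>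

text \<open>The piecewise quadratic C1 transition from 0 to 1 on the unit interval. C1 is exactly
  the regularity asked of test functions for weak derivatives.\<close>

definition ramp :: "real \<Rightarrow> real" where
  "ramp x = 2 * ((max 0 x)\<^sup>2 - 2 * (max 0 (x - 1/2))\<^sup>2 + (max 0 (x - 1))\<^sup>2)"

text \<open>The derivative of \<open>ramp\<close>: the tent over the unit interval with peak 2 at
  1/2, hence of integral 1.\<close>

definition hat :: "real \<Rightarrow> real" where
  "hat x = 4 * (max 0 x - 2 * max 0 (x - 1/2) + max 0 (x - 1))"

text \<open>Only the point 0 needs care; there the difference quotient is at most |h|.\<close>

lemma DERIV_max_0_power2: "((\<lambda>x::real. (max 0 x)\<^sup>2) has_real_derivative 2 * max 0 x) (at x)"
proof -
  consider "x < 0" | "x = 0" | "x > 0" by linarith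
  then show ?thesis
  proof cases
    case 1
    have "((\<lambda>x. 0) has_real_derivative 0) (at x)" by simp
    then have "((\<lambda>x::real. (max 0 x)\<^sup>2) has_real_derivative 0) (at x)"
      by (rule DERIV_cong_ev[THEN iffD1, rotated 3, OF _ refl _ refl])
        (use eventually_nhds_in_open[of "{..<0}" x] 1 in \<open>auto elim!: eventually_mono simp: max_def\<close>)
    then show ?thesis using 1 by simp
  next
    case 2
    have "((\<lambda>h. ((max 0 (0 + h))\<^sup>2 - (max 0 (0::real))\<^sup>2) / h) \<longlongrightarrow> 0) (at 0)"
    proof (rule tendsto_rabs_zero_cancel, rule tendsto_sandwich[of "\<lambda>h. 0" _ _ "\<lambda>h. \<bar>h\<bar>"])
      have "\<bar>((max 0 (0 + h))\<^sup>2 - (max 0 (0::real))\<^sup>2) / h\<bar> \<le> \<bar>h\<bar>" for h :: real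
        by (auto simp: max_def power2_eq_square)
      then show "\<forall>\<^sub>F h in at 0. \<bar>((max 0 (0 + h))\<^sup>2 - (max 0 (0::real))\<^sup>2) / h\<bar> \<le> \<bar>h\<bar>"
        by (rule always_eventually[OF allI])
      show "((\<lambda>h. \<bar>h\<bar>) \<longlongrightarrow> (0::real)) (at 0)" by (rule tendsto_rabs_zero) (rule tendsto_ident_at)
    qed auto
    then show ?thesis using 2 by (simp add: DERIV_def)
  next
    case 3
    have "((\<lambda>x. x\<^sup>2) has_real_derivative 2 * x) (at x)" by (auto intro!: derivative_eq_intros)
    then have "((\<lambda>x::real. (max 0 x)\<^sup>2) has_real_derivative 2 * x) (at x)"
      by (rule DERIV_cong_ev[THEN iffD1, rotated 3, OF _ refl _ refl])
        (use eventually_nhds_in_open[of "{0<..}" x] 3 in \<open>auto elim!: eventually_mono simp: max_def\<close>)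
    then show ?thesis using 3 by simp
  qed
qed

lemma DERIV_ramp: "(ramp has_real_derivative hat x) (at x)"
proof -
  have sh: "((\<lambda>x. (max 0 (x - a))\<^sup>2) has_real_derivative 2 * max 0 (x - a)) (at x)" for a
    using DERIV_shift[of "\<lambda>x. (max 0 x)\<^sup>2" "2 * max 0 (x - a)" x "- a"] DERIV_max_0_power2[of "x - a"] by simp
  show ?thesis unfolding ramp_def[abs_def] hat_def
    by (rule DERIV_cong, rule DERIV_cmult[OF DERIV_add[OF DERIV_diff[OF DERIV_max_0_power2 DERIV_cmult[OF sh]] sh]]) simp
qed

lemma ramp_eq_0: "x \<le> 0 \<Longrightarrow> ramp x = 0"
  by (simp add: ramp_def)

lemma ramp_eq_1: "x \<ge> 1 \<Longrightarrow> ramp x = 1"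
  by (simp add: ramp_def max_def power2_eq_square algebra_simps)

lemma hat_nonneg: "hat x \<ge> 0"
  by (auto simp: hat_def max_def)

lemma hat_eq_0: "x \<le> 0 \<or> x \<ge> 1 \<Longrightarrow> hat x = 0"
  by (auto simp: hat_def max_def)

lemma continuous_hat: "continuous_on UNIV hat"
  unfolding hat_def[abs_def] by (intro continuous_intros)

lemma ramp_bounds: "0 \<le> ramp x" "ramp x \<le> 1"
proof -
  have mono: "ramp x \<le> ramp y" if "x \<le> y" for x y
    using DERIV_nonneg_imp_nondecreasing[OF that, of ramp] DERIV_ramp hat_nonneg by blast
  show "0 \<le> ramp x" using mono[of "min 0 x" x] ramp_eq_0[of "min 0 x"] by simp
  show "ramp x \<le> 1" using mono[of x "max 1 x"] ramp_eq_1[of "max 1 x"] by simp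
qed

lemma DERIV_scaled_ramp: "((\<lambda>x. ramp (c * (x - s))) has_real_derivative c * hat (c * (x - s))) (at x)"
proof -
  have "((\<lambda>x. c * (x - s)) has_real_derivative c) (at x)" by (auto intro!: derivative_eq_intros)
  from DERIV_chain2[OF DERIV_ramp this] show ?thesis by (simp add: mult.commute)
qed

text \<open>The rescaled tent is a probability density supported in [s, s + 1/c], so the integral is
  an average of values close to \<open>g s\<close>.\<close>

lemma scaled_hat_average:
  fixes g :: "real \<Rightarrow> real"
  assumes g: "continuous_on UNIV g" and c: "c > 0"
    and close: "\<And>x. x \<in> {s..s + 1 / c} \<Longrightarrow> \<bar>g x - g s\<bar> \<le> \<epsilon>"
  shows "integrable lborel (\<lambda>x. c * hat (c * (x - s)) * g x)"
    and "\<bar>(LINT x|lborel. c * hat (c * (x - s)) * g x) - g s\<bar> \<le> \<epsilon>"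
proof -
  let ?k = "\<lambda>x. c * hat (c * (x - s))"
  let ?I = "{s..s + 1 / c}"
  have k0: "?k x = 0" if "x \<notin> ?I" for x
    using that c hat_eq_0[of "c * (x - s)"] by (auto simp: field_simps mult_le_0_iff not_le)
  have kc: "continuous_on UNIV ?k"
    by (intro continuous_intros continuous_on_compose2[OF continuous_hat]) auto
  have i: "integrable lborel (\<lambda>x. ?k x * f x)" if "continuous_on UNIV f" for f
  proof -
    have "integrable lborel (\<lambda>x. indicator ?I x *\<^sub>R (?k x * f x))"
      by (intro borel_integrable_compact continuous_intros continuous_on_subset[OF kc] continuous_on_subset[OF that]) auto
    moreover have "(\<lambda>x. indicator ?I x *\<^sub>R (?k x * f x)) = (\<lambda>x. ?k x * f x)"
      using k0 by (auto simp: fun_eq_iff indicator_def)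
    ultimately show ?thesis by simp
  qed
  show ig: "integrable lborel (\<lambda>x. ?k x * g x)" by (rule i[OF g])
  have ik: "integrable lborel ?k" using i[of "\<lambda>x. 1"] by simp
  \<comment> \<open>The total mass is read off from the antiderivative, as ramp 1 - ramp 0.\<close>
  have "(LINT x|lborel. ?k x * indicator ?I x) = ramp (c * (s + 1 / c - s)) - ramp (c * (s - s))"
    using c continuous_on_eq_continuous_at[OF open_UNIV, THEN iffD1, OF kc]
    by (intro integral_FTC_Icc_real DERIV_scaled_ramp) auto
  moreover have "(\<lambda>x. ?k x * indicator ?I x) = ?k"
    using k0 by (auto simp: fun_eq_iff indicator_def)
  ultimately have one: "(LINT x|lborel. ?k x) = 1"
    using c ramp_eq_0[of 0] ramp_eq_1[of 1] by simp
  have "(LINT x|lborel. ?k x * g x) - g s = (LINT x|lborel. ?k x * g x) - (LINT x|lborel. ?k x * g s)"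
    using one by simp
  also have "\<dots> = (LINT x|lborel. ?k x * g x - ?k x * g s)"
    using ig i[of "\<lambda>x. g s"] by (intro Bochner_Integration.integral_diff[symmetric]) auto
  finally have "\<bar>(LINT x|lborel. ?k x * g x) - g s\<bar> = \<bar>LINT x|lborel. ?k x * g x - ?k x * g s\<bar>" by simp
  also have "\<dots> \<le> (LINT x|lborel. \<bar>?k x * g x - ?k x * g s\<bar>)"
    by (rule integral_abs_bound)
  also have "\<dots> \<le> (LINT x|lborel. ?k x * \<epsilon>)"
  proof (rule integral_mono)
    show "integrable lborel (\<lambda>x. \<bar>?k x * g x - ?k x * g s\<bar>)" using ig i[of "\<lambda>x. g s"] by simp
    show "integrable lborel (\<lambda>x. ?k x * \<epsilon>)" using i[of "\<lambda>x. \<epsilon>"] by simp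
    fix x
    show "\<bar>?k x * g x - ?k x * g s\<bar> \<le> ?k x * \<epsilon>"
    proof (cases "x \<in> ?I")
      case True
      have "\<bar>?k x * g x - ?k x * g s\<bar> = ?k x * \<bar>g x - g s\<bar>"
        using c hat_nonneg[of "c * (x - s)"] by (simp add: right_diff_distrib[symmetric] abs_mult)
      also have "\<dots> \<le> ?k x * \<epsilon>" using close[OF True] c hat_nonneg by (intro mult_left_mono) auto
      finally show ?thesis .
    next
      case False
      show ?thesis by (simp only: k0[OF False] mult_zero_left diff_self abs_zero order_refl)
    qed
  qed
  also have "\<dots> = \<epsilon>" using one by simp
  finally show "\<bar>(LINT x|lborel. ?k x * g x) - g s\<bar> \<le> \<epsilon>" .
qed

lemma scaled_hat_tendsto:
  fixes g :: "real \<Rightarrow> real"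
  assumes g: "continuous_on UNIV g"
  shows "(\<lambda>n. LINT x|lborel. real (Suc n) * hat (real (Suc n) * (x - s)) * g x) \<longlonglongrightarrow> g s"
proof (rule LIMSEQ_I)
  fix r :: real assume r: "r > 0"
  have "isCont g s" using g continuous_on_eq_continuous_at[OF open_UNIV] by blast
  then obtain d where d: "d > 0" "\<And>x. \<bar>x - s\<bar> < d \<Longrightarrow> \<bar>g x - g s\<bar> < r / 2"
    using r unfolding continuous_at_eps_delta dist_real_def by (metis half_gt_zero)
  obtain N where N: "1 / real (Suc N) < d" using d(1) reals_Archimedean[of d] by (auto simp: inverse_eq_divide)
  have "norm ((LINT x|lborel. real (Suc n) * hat (real (Suc n) * (x - s)) * g x) - g s) < r" if "n \<ge> N" for n
  proof -
    have "1 / real (Suc n) \<le> 1 / real (Suc N)" using that by (simp add: frac_le)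
    then have lt: "1 / real (Suc n) < d" using N by linarith
    have close: "\<bar>g x - g s\<bar> \<le> r / 2" if "x \<in> {s..s + 1 / real (Suc n)}" for x
    proof -
      have "\<bar>x - s\<bar> \<le> 1 / real (Suc n)" using that by auto
      then show ?thesis using lt by (intro less_imp_le d(2)) linarith
    qed
    have "\<bar>(LINT x|lborel. real (Suc n) * hat (real (Suc n) * (x - s)) * g x) - g s\<bar> \<le> r / 2"
      by (rule scaled_hat_average(2)[OF g _ close]) auto
    then show ?thesis using r by simp
  qed
  then show "\<exists>no. \<forall>n\<ge>no. norm ((LINT x|lborel. real (Suc n) * hat (real (Suc n) * (x - s)) * g x) - g s) < r"
    by blast
qed


text \<open>Tests with smoothed indicators of [s, t] times the fixed vector \<open>e\<close>: one
  ramp rises at \<open>s\<close>, another is subtracted at \<open>t\<close>. Their derivatives are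
  mollifiers that pick out the values of \<open>f\<close> at the two ends, while the other side
  converges to the integral by domination.\<close>

lemma weak_imp_ac_derivative:
  assumes f: "continuous_on UNIV f" and v: "v \<in> L2" and weak: "has_weak_derivative f v"
  shows "has_ac_derivative f v"
  unfolding has_ac_derivative_def
proof (intro allI impI)
  fix s t :: real and e :: 'a assume st: "s \<le> t"
  define g where "g x = inner e (f x)" for x
  have g: "continuous_on UNIV g" unfolding g_def by (intro continuous_intros f)
  have gm: "g \<in> borel_measurable lborel" using borel_measurable_continuous_onI[OF g] by simp
  define w where "w x = inner e (v x)" for x
  have wm: "w \<in> borel_measurable lebesgue" unfolding w_def
    by (rule strongly_measurable_inner[OF strongly_measurable_const L2_strongly_measurable[OF v]])
  define c where "c n = real (Suc n)" for n
  have c: "c n > 0" "c n \<ge> 1" for n by (simp_all add: c_def)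
  define \<rho> where "\<rho> n x = ramp (c n * (x - s)) - ramp (c n * (x - t))" for n x
  define \<rho>' where "\<rho>' n x = c n * hat (c n * (x - s)) - c n * hat (c n * (x - t))" for n x
  have d\<rho>: "(\<rho> n has_real_derivative \<rho>' n x) (at x)" for n x
    unfolding \<rho>_def[abs_def] \<rho>'_def by (intro DERIV_diff DERIV_scaled_ramp)
  have c\<rho>: "continuous_on UNIV (\<rho> n)" for n
    by (simp add: continuous_on_eq_continuous_at DERIV_isCont[OF d\<rho>])
  have c\<rho>': "continuous_on UNIV (\<rho>' n)" for n
    unfolding \<rho>'_def[abs_def] by (intro continuous_intros continuous_on_compose2[OF continuous_hat]) auto
  \<comment> \<open>As \<open>c n\<close> is at least 1, both ramps have saturated by t + 1. The
    support is thus bounded uniformly in \<open>n\<close>, which provides the dominating function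
    below.\<close>
  have \<rho>0: "\<rho> n x = 0" if "x \<notin> {s..t + 1}" for n x
  proof -
    consider "x < s" | "x > t + 1" using \<open>x \<notin> {s..t + 1}\<close> by force
    then show ?thesis
    proof cases
      case 1
      then have "c n * (x - s) \<le> 0" "c n * (x - t) \<le> 0" using c[of n] st by (auto simp: mult_le_0_iff)
      then show ?thesis by (simp add: \<rho>_def ramp_eq_0)
    next
      case 2
      have "1 * 1 \<le> c n * (x - s)" "1 * 1 \<le> c n * (x - t)"
        using c[of n] st 2 by (intro mult_mono; simp)+
      then show ?thesis by (simp add: \<rho>_def ramp_eq_1)
    qed
  qed
  have eq: "(LINT x|lebesgue. \<rho>' n x * g x) = - (LINT x|lebesgue. \<rho> n x * w x)" for n
  proof -
    have "(\<forall>x. ((\<lambda>x. \<rho> n x *\<^sub>R e) has_vector_derivative \<rho>' n x *\<^sub>R e) (at x)) \<and>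
        continuous_on UNIV (\<lambda>x. \<rho>' n x *\<^sub>R e) \<and> (\<exists>R. \<forall>x. \<bar>x\<bar> > R \<longrightarrow> \<rho> n x *\<^sub>R e = 0)"
    proof (intro conjI allI exI impI)
      show "((\<lambda>x. \<rho> n x *\<^sub>R e) has_vector_derivative \<rho>' n x *\<^sub>R e) (at x)" for x
        using has_vector_derivative_scaleR[OF d\<rho> has_vector_derivative_const] by simp
      show "continuous_on UNIV (\<lambda>x. \<rho>' n x *\<^sub>R e)" by (intro continuous_intros c\<rho>')
      show "\<rho> n x *\<^sub>R e = 0" if "\<bar>s\<bar> + \<bar>t\<bar> + 1 < \<bar>x\<bar>" for x
        using that by (subst \<rho>0) auto
    qed
    then have "(LINT x|lebesgue. inner (\<rho>' n x *\<^sub>R e) (f x)) = - (LINT x|lebesgue. inner (\<rho> n x *\<^sub>R e) (v x))"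
      by (rule weak[unfolded has_weak_derivative_def, THEN spec, THEN spec, THEN mp])
    then show ?thesis by (simp add: g_def w_def)
  qed
  \<comment> \<open>Only integrability is wanted here, so any bound for the oscillation on the
    support serves as \<epsilon>.\<close>
  have i: "integrable lborel (\<lambda>x. c n * hat (c n * (x - a)) * g x)" for n a
  proof -
    have "compact ((\<lambda>x. \<bar>g x - g a\<bar>) ` {a..a + 1 / c n})"
      by (intro compact_continuous_image continuous_intros continuous_on_subset[OF g]) auto
    then have "bounded ((\<lambda>x. \<bar>g x - g a\<bar>) ` {a..a + 1 / c n})" by (rule compact_imp_bounded)
    then obtain M where "\<forall>y\<in>(\<lambda>x. \<bar>g x - g a\<bar>) ` {a..a + 1 / c n}. norm y \<le> M" unfolding bounded_iff by (elim exE)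
    then show ?thesis by (intro scaled_hat_average(1)[OF g c(1), where \<epsilon>=M]) auto
  qed
  have "(LINT x|lebesgue. \<rho>' n x * g x) =
      (LINT x|lborel. c n * hat (c n * (x - s)) * g x) - (LINT x|lborel. c n * hat (c n * (x - t)) * g x)" for n
  proof -
    have "(\<lambda>x. \<rho>' n x * g x) \<in> borel_measurable lborel"
      using borel_measurable_continuous_onI[OF c\<rho>'[of n]] gm by simp
    then have "(LINT x|lebesgue. \<rho>' n x * g x) = (LINT x|lborel. \<rho>' n x * g x)" by (rule integral_completion)
    also have "\<dots> = (LINT x|lborel. c n * hat (c n * (x - s)) * g x - c n * hat (c n * (x - t)) * g x)"
      by (simp add: \<rho>'_def left_diff_distrib)
    also have "\<dots> = (LINT x|lborel. c n * hat (c n * (x - s)) * g x) - (LINT x|lborel. c n * hat (c n * (x - t)) * g x)"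
      by (rule Bochner_Integration.integral_diff[OF i i])
    finally show ?thesis .
  qed
  moreover have "(\<lambda>n. (LINT x|lborel. c n * hat (c n * (x - s)) * g x) - (LINT x|lborel. c n * hat (c n * (x - t)) * g x))
      \<longlonglongrightarrow> g s - g t"
    unfolding c_def by (intro tendsto_diff scaled_hat_tendsto g)
  ultimately have lim1: "(\<lambda>n. - (LINT x|lebesgue. \<rho> n x * w x)) \<longlonglongrightarrow> g s - g t" unfolding eq[symmetric] by simp
  have "(\<lambda>n. LINT x|lebesgue. \<rho> n x * w x) \<longlonglongrightarrow> (LINT x|lebesgue. indicator {s..t} x *\<^sub>R w x)"
  proof (rule integral_dominated_convergence[where w="\<lambda>x. 2 * norm (indicator {s..t+1} x *\<^sub>R w x)"])
    show "(\<lambda>x. indicator {s..t} x *\<^sub>R w x) \<in> borel_measurable lebesgue"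
      using wm by (intro borel_measurable_scaleR borel_measurable_indicator) auto
    have "\<rho> n \<in> borel_measurable lebesgue" for n
      using borel_measurable_continuous_onI[OF c\<rho>[of n]] by (intro measurable_completion) simp
    then show "(\<lambda>x. \<rho> n x * w x) \<in> borel_measurable lebesgue" for n using wm by (intro borel_measurable_times)
    have "set_integrable lebesgue {s..t+1} w" unfolding w_def[abs_def] by (rule L2_set_integrable_inner[OF v])
    then show "integrable lebesgue (\<lambda>x. 2 * norm (indicator {s..t+1} x *\<^sub>R w x))"
      unfolding set_integrable_def by (intro integrable_mult_right integrable_norm)
    show "AE x in lebesgue. norm (\<rho> n x * w x) \<le> 2 * norm (indicator {s..t+1} x *\<^sub>R w x)" for n
    proof (rule AE_I2)
      fix x
      show "norm (\<rho> n x * w x) \<le> 2 * norm (indicator {s..t+1} x *\<^sub>R w x)"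
      proof (cases "x \<in> {s..t+1}")
        case True
        have "\<bar>\<rho> n x\<bar> \<le> 2"
          using ramp_bounds[of "c n * (x - s)"] ramp_bounds[of "c n * (x - t)"] unfolding \<rho>_def by linarith
        then have "\<bar>\<rho> n x\<bar> * \<bar>w x\<bar> \<le> 2 * \<bar>w x\<bar>" by (intro mult_right_mono) auto
        then show ?thesis using True by (simp add: abs_mult)
      qed (simp add: \<rho>0)
    qed
    \<comment> \<open>The pointwise limit is the indicator of the half-open interval without
      \<open>s\<close>; discarding the endpoints removes the discrepancy.\<close>
    have nh: "AE x in lebesgue. x \<noteq> s \<and> x \<noteq> t"
      using AE_completion[OF AE_lborel_singleton[of s]] AE_completion[OF AE_lborel_singleton[of t]]
      by eventually_elim simp
    have lim: "(\<lambda>n. ramp (c n * y)) \<longlonglongrightarrow> (if y > 0 then 1 else 0)" for y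
    proof (cases "y > 0")
      case True
      obtain N where N: "1 / y < real N" using reals_Archimedean2 by blast
      have "ramp (c n * y) = 1" if "n \<ge> N" for n
      proof (rule ramp_eq_1)
        have "1 / y \<le> c n" using N that unfolding c_def by linarith
        then show "1 \<le> c n * y" using True by (simp add: pos_divide_le_eq)
      qed
      then have "\<forall>\<^sub>F n in sequentially. ramp (c n * y) = 1" by (auto simp: eventually_sequentially)
      then show ?thesis using True by (simp add: tendsto_eventually)
    next
      case False
      then have "ramp (c n * y) = 0" for n using c(1)[of n] by (intro ramp_eq_0) (simp add: mult_le_0_iff)
      then show ?thesis using False by simp
    qed
    show "AE x in lebesgue. (\<lambda>n. \<rho> n x * w x) \<longlonglongrightarrow> indicator {s..t} x *\<^sub>R w x"
      using nh
    proof eventually_elim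
      case (elim x)
      have "(\<lambda>n. \<rho> n x * w x) \<longlonglongrightarrow> ((if x - s > 0 then 1 else 0) - (if x - t > 0 then 1 else 0)) * w x"
        unfolding \<rho>_def by (intro tendsto_intros lim)
      moreover have "((if x - s > 0 then 1 else 0) - (if x - t > 0 then 1 else (0::real))) = indicator {s..t} x"
        using elim st by (auto simp: indicator_def)
      ultimately show ?case by simp
    qed
  qed
  then have "(\<lambda>n. - (LINT x|lebesgue. \<rho> n x * w x)) \<longlonglongrightarrow> - (LINT x:{s..t}|lebesgue. w x)"
    unfolding set_lebesgue_integral_def by (rule tendsto_minus)
  then have "- (LINT x:{s..t}|lebesgue. w x) = g s - g t" using lim1 by (rule LIMSEQ_unique)
  then show "(LINT x:{s..t}|lebesgue. inner e (v x)) = inner e (f t - f s)"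
    unfolding w_def g_def by (simp add: inner_diff_right)
qed


section \<open>Integration by parts\<close>

lemma has_ac_derivative_C1:
  fixes f :: "real \<Rightarrow> 'c::real_inner"
  assumes f: "\<And>x. (f has_vector_derivative f' x) (at x)" and f': "continuous_on UNIV f'"
  shows "has_ac_derivative f f'"
  unfolding has_ac_derivative_def
proof (intro allI impI)
  fix s t :: real and e assume st: "s \<le> t"
  have c: "continuous_on UNIV (\<lambda>x. inner e (f' x))" by (intro continuous_intros f')
  have "((\<lambda>x. inner e (f x)) has_vector_derivative inner e (f' x)) (at x)" for x
    using bounded_linear.has_vector_derivative[OF bounded_linear_inner_right f] .
  then have "(LINT x|lborel. inner e (f' x) * indicator {s..t} x) = inner e (f t) - inner e (f s)"
    using continuous_on_eq_continuous_at[OF open_UNIV, THEN iffD1, OF c] st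
    by (intro integral_FTC_Icc_real) (auto simp: has_real_derivative_iff_has_vector_derivative)
  moreover have "(LINT x:{s..t}|lebesgue. inner e (f' x)) = (LINT x|lborel. indicator {s..t} x *\<^sub>R inner e (f' x))"
    unfolding set_lebesgue_integral_def using borel_measurable_continuous_onI[OF c]
    by (intro integral_completion borel_measurable_scaleR borel_measurable_indicator) auto
  ultimately show "(LINT x:{s..t}|lebesgue. inner e (f' x)) = inner e (f t - f s)"
    by (simp add: mult.commute inner_diff_right)
qed

text \<open>Makes the chain rule applicable to functions of two curves; it is used for the inner
  product and for the map sending (x, a) to the derivative of \<phi> at x applied to a.\<close>

lemma has_ac_derivative_Pair:
  assumes "has_ac_derivative f v" "has_ac_derivative g w" "v \<in> L2" "w \<in> L2"
  shows "has_ac_derivative (\<lambda>x. (f x, g x)) (\<lambda>x. (v x, w x))"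
  unfolding has_ac_derivative_def
proof (intro allI impI)
  fix s t :: real and e :: "'a \<times> 'b" assume st: "s \<le> t"
  have "(LINT x:{s..t}|lebesgue. inner e (v x, w x)) = (LINT x:{s..t}|lebesgue. inner (fst e) (v x) + inner (snd e) (w x))"
    by (simp add: inner_prod_def)
  also have "\<dots> = inner (fst e) (f t - f s) + inner (snd e) (g t - g s)"
    using has_ac_derivativeD[OF assms(1) st] has_ac_derivativeD[OF assms(2) st]
      set_integral_add(2)[OF L2_set_integrable_inner[OF assms(3)] L2_set_integrable_inner[OF assms(4)]] by simp
  finally show "(LINT x:{s..t}|lebesgue. inner e (v x, w x)) = inner e ((f t, g t) - (f s, g s))"
    by (simp add: inner_prod_def)
qed

lemma L2_compact_support:
  fixes f :: "real \<Rightarrow> 'c::real_normed_vector"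
  assumes f: "continuous_on UNIV f" and supp: "\<And>x. \<bar>x\<bar> > R \<Longrightarrow> f x = 0"
  shows "f \<in> L2"
proof -
  have sm: "strongly_measurable f" by (rule strongly_measurable_continuous[OF f])
  have c: "continuous_on UNIV (\<lambda>x. (norm (f x))\<^sup>2)" by (intro continuous_intros f)
  have "integrable lborel (\<lambda>x. indicator {- R..R} x *\<^sub>R (norm (f x))\<^sup>2)"
    by (intro borel_integrable_compact continuous_on_subset[OF c]) auto
  moreover have "(\<lambda>x. indicator {- R..R} x *\<^sub>R (norm (f x))\<^sup>2) = (\<lambda>x. (norm (f x))\<^sup>2)"
  proof
    fix x show "indicator {- R..R} x *\<^sub>R (norm (f x))\<^sup>2 = (norm (f x))\<^sup>2"
      using supp[of x] by (cases "\<bar>x\<bar> > R") (auto simp: indicator_def)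
  qed
  ultimately have "integrable lborel (\<lambda>x. (norm (f x))\<^sup>2)" by simp
  then have "integrable lebesgue (\<lambda>x. (norm (f x))\<^sup>2)"
    using integrable_completion[of "\<lambda>x. (norm (f x))\<^sup>2" lborel] borel_measurable_continuous_onI[OF c] by simp
  then show ?thesis using sm by (simp add: L2_def)
qed

text \<open>This is the chain rule for the inner product along the pair of \<psi> and
  \<open>f\<close>; compact support of \<psi> removes the boundary terms.\<close>

lemma ac_imp_weak_derivative:
  fixes f :: "real \<Rightarrow> 'c::{real_inner, banach}"
  assumes f: "continuous_on UNIV f" and v: "v \<in> L2" and ac: "has_ac_derivative f v"
  shows "has_weak_derivative f v"
  unfolding has_weak_derivative_def
proof (intro allI impI)
  fix \<psi> \<psi>' :: "real \<Rightarrow> 'c"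
  assume "(\<forall>s. (\<psi> has_vector_derivative \<psi>' s) (at s)) \<and> continuous_on UNIV \<psi>' \<and> (\<exists>R. \<forall>s. R < \<bar>s\<bar> \<longrightarrow> \<psi> s = 0)"
  then obtain R where d: "\<And>s. (\<psi> has_vector_derivative \<psi>' s) (at s)" and c': "continuous_on UNIV \<psi>'"
    and supp: "\<And>s. R < \<bar>s\<bar> \<Longrightarrow> \<psi> s = 0" by auto
  \<comment> \<open>The region where \<psi> is known to vanish is open, so the derivative vanishes
    there too.\<close>
  have supp': "\<psi>' s = 0" if s: "R < \<bar>s\<bar>" for s
  proof -
    have "open {x::real. R < \<bar>x\<bar>}" by (intro open_Collect_less continuous_intros)
    then have "((\<lambda>x. 0) has_vector_derivative \<psi>' s) (at s)"
      using has_vector_derivative_transform_within_open[OF d, of "{x. R < \<bar>x\<bar>}" s "\<lambda>x. 0"] s supp by simp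
    then show ?thesis using vector_derivative_unique_at has_vector_derivative_const by blast
  qed
  have c: "continuous_on UNIV \<psi>"
    by (intro continuous_at_imp_continuous_on ballI has_vector_derivative_continuous[OF d])
  have L': "\<psi>' \<in> L2" by (rule L2_compact_support[OF c' supp'])
  define F where "F p = inner (fst p) (snd p)" for p :: "'c \<times> 'c"
  define F' where "F' p = (blinfun_inner_right (fst p) o\<^sub>L snd_blinfun) + (blinfun_inner_left (snd p) o\<^sub>L fst_blinfun)"
    for p :: "'c \<times> 'c"
  have dF: "(F has_derivative F' p) (at p)" for p
    unfolding F_def[abs_def] F'_def
    by (rule has_derivative_eq_rhs, (rule derivative_intros)+)
       (simp add: fun_eq_iff plus_blinfun.rep_eq)
  have cF: "continuous_on UNIV F'"
    unfolding F'_def[abs_def]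
    by (intro continuous_intros bounded_linear.continuous_on[OF bounded_linear_blinfun_inner_right]
      bounded_linear.continuous_on[OF bounded_linear_blinfun_inner_left])
  \<comment> \<open>Both -r and r lie strictly in the region where \<psi> vanishes, and -r \<le> r
    even if \<open>R\<close> is negative.\<close>
  define r where "r = \<bar>R\<bar> + 1"
  have cp: "continuous_on UNIV (\<lambda>x. (\<psi> x, f x))" by (intro continuous_intros c f)
  have acp: "has_ac_derivative (\<lambda>x. (\<psi> x, f x)) (\<lambda>x. (\<psi>' x, v x))"
    by (rule has_ac_derivative_Pair[OF has_ac_derivative_C1[OF d c'] ac L' v])
  have "(LINT x:{-r..r}|lebesgue. inner 1 (F' (\<psi> x, f x) (\<psi>' x, v x))) = inner 1 (F (\<psi> r, f r) - F (\<psi> (-r), f (-r)))"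
    by (rule ac_chain_rule(2)[OF dF cF cp acp L2_Pair[OF L' v]]) (simp add: r_def)
  also have "\<dots> = 0" using supp[of r] supp[of "-r"] by (simp add: r_def F_def)
  finally have 0: "(LINT x:{-r..r}|lebesgue. inner (\<psi> x) (v x) + inner (\<psi>' x) (f x)) = 0"
    by (simp add: F'_def plus_blinfun.rep_eq)
  have z: "\<psi> x = 0" "\<psi>' x = 0" if "x \<notin> {-r..r}" for x
  proof -
    have "R < \<bar>x\<bar>" using that by (auto simp: r_def)
    then show "\<psi> x = 0" "\<psi>' x = 0" using supp supp' by auto
  qed
  have "(LINT x:{-r..r}|lebesgue. inner (\<psi> x) (v x) + inner (\<psi>' x) (f x)) = (LINT x|lebesgue. inner (\<psi> x) (v x) + inner (\<psi>' x) (f x))"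
    unfolding set_lebesgue_integral_def
  proof (rule Bochner_Integration.integral_cong[OF refl])
    fix x show "indicator {-r..r} x *\<^sub>R (inner (\<psi> x) (v x) + inner (\<psi>' x) (f x)) = inner (\<psi> x) (v x) + inner (\<psi>' x) (f x)"
      using z[of x] by (cases "x \<in> {-r..r}") auto
  qed
  also have "\<dots> = (LINT x|lebesgue. inner (\<psi> x) (v x)) + (LINT x|lebesgue. inner (\<psi>' x) (f x))"
  proof (rule Bochner_Integration.integral_add)
    show "integrable lebesgue (\<lambda>x. inner (\<psi> x) (v x))"
      by (rule L2_inner_integrable[OF L2_compact_support[OF c supp] v])
    have cc: "continuous_on UNIV (\<lambda>x. inner (\<psi>' x) (f x))" by (intro continuous_intros c' f)
    have "integrable lborel (\<lambda>x. indicator {-r..r} x *\<^sub>R inner (\<psi>' x) (f x))"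
      by (intro borel_integrable_compact continuous_on_subset[OF cc]) auto
    moreover have "(\<lambda>x. indicator {-r..r} x *\<^sub>R inner (\<psi>' x) (f x)) = (\<lambda>x. inner (\<psi>' x) (f x))"
    proof
      fix x show "indicator {-r..r} x *\<^sub>R inner (\<psi>' x) (f x) = inner (\<psi>' x) (f x)"
        using z(2)[of x] by (cases "x \<in> {-r..r}") auto
    qed
    ultimately show "integrable lebesgue (\<lambda>x. inner (\<psi>' x) (f x))"
      using integrable_completion[of "\<lambda>x. inner (\<psi>' x) (f x)" lborel] borel_measurable_continuous_onI[OF cc] by simp
  qed
  finally show "(LINT x|lebesgue. inner (\<psi>' x) (f x)) = - (LINT x|lebesgue. inner (\<psi> x) (v x))"
    using 0 by simp
qed

section \<open>Curves in the path space\<close>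

lemma integral_unit_interval_tail:
  fixes g :: "real \<Rightarrow> real"
  assumes g: "integrable lebesgue g" and pos: "\<And>x. g x \<ge> 0" and e: "e > 0"
  shows "\<exists>R. \<forall>t. \<bar>t\<bar> > R \<longrightarrow> (LINT x:{t - 1..t}|lebesgue. g x) < e"
proof -
  have gm: "g \<in> borel_measurable lebesgue" using g by (rule borel_measurable_integrable)
  have "(\<lambda>n. LINT x|lebesgue. indicator {- real n..real n} x *\<^sub>R g x) \<longlonglongrightarrow> (LINT x|lebesgue. g x)"
  proof (rule integral_dominated_convergence[where w=g])
    show "(\<lambda>x. indicator {- real n..real n} x *\<^sub>R g x) \<in> borel_measurable lebesgue" for n
      using gm by (intro borel_measurable_scaleR borel_measurable_indicator) auto
    show "AE x in lebesgue. (\<lambda>n. indicator {- real n..real n} x *\<^sub>R g x) \<longlonglongrightarrow> g x"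
    proof (rule AE_I2)
      fix x
      obtain N where N: "\<bar>x\<bar> \<le> real N" using real_arch_simple by blast
      have "indicator {- real n..real n} x *\<^sub>R g x = g x" if "n \<ge> N" for n
        using N that by (auto simp: indicator_def)
      then show "(\<lambda>n. indicator {- real n..real n} x *\<^sub>R g x) \<longlonglongrightarrow> g x"
        by (intro tendsto_eventually) (auto simp: eventually_sequentially)
    qed
    show "AE x in lebesgue. norm (indicator {- real n..real n} x *\<^sub>R g x) \<le> g x" for n
      using pos by (auto simp: indicator_def)
  qed (use g gm in auto)
  then obtain n where n: "norm ((LINT x|lebesgue. indicator {- real n..real n} x *\<^sub>R g x) - (LINT x|lebesgue. g x)) < e"
    using LIMSEQ_D[OF _ e] by blast
  have ii: "integrable lebesgue (\<lambda>x. indicator A x *\<^sub>R g x)" if "A \<in> sets lebesgue" for A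
    using integrable_mult_indicator[OF that g] .
  \<comment> \<open>The extra 1 makes the window [t - 1, t] disjoint from [-n, n] on either
    side.\<close>
  have "(LINT x:{t - 1..t}|lebesgue. g x) < e" if t: "\<bar>t\<bar> > real n + 1" for t
  proof -
    have "(LINT x:{t - 1..t}|lebesgue. g x) \<le> (LINT x|lebesgue. g x - indicator {- real n..real n} x *\<^sub>R g x)"
      unfolding set_lebesgue_integral_def
    proof (rule integral_mono)
      show "integrable lebesgue (\<lambda>x. indicator {t - 1..t} x *\<^sub>R g x)" by (rule ii) simp
      show "integrable lebesgue (\<lambda>x. g x - indicator {- real n..real n} x *\<^sub>R g x)"
        by (rule Bochner_Integration.integrable_diff[OF g ii]) simp
      fix x show "indicator {t - 1..t} x *\<^sub>R g x \<le> g x - indicator {- real n..real n} x *\<^sub>R g x"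
        using t pos[of x] by (auto simp: indicator_def)
    qed
    also have "\<dots> = (LINT x|lebesgue. g x) - (LINT x|lebesgue. indicator {- real n..real n} x *\<^sub>R g x)"
      by (rule Bochner_Integration.integral_diff[OF g ii]) simp
    also have "\<dots> < e" using n by (simp add: abs_less_iff)
    finally show ?thesis .
  qed
  then show ?thesis by blast
qed

text \<open>The value at \<open>t\<close> differs from that at any \<open>s\<close> of the preceding
  unit interval by at most the integral of |v|; averaging over \<open>s\<close> and Cauchy-Schwarz
  give the bound. Being local, it yields both the supremum bound and the decay at infinity.\<close>

lemma ac_norm_le_local:
  assumes f: "f \<in> L2" and v: "v \<in> L2" and ac: "has_ac_derivative f v"
  shows "norm (f t) \<le> sqrt (LINT x:{t - 1..t}|lebesgue. (norm (f x))\<^sup>2) + sqrt (LINT x:{t - 1..t}|lebesgue. (norm (v x))\<^sup>2)"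
proof -
  let ?V = "LINT x:{t - 1..t}|lebesgue. norm (v x)"
  have one: "set_integrable lebesgue {t - 1..t} (\<lambda>x. c)" for c :: real
    unfolding set_integrable_def by (intro integrable_scaleR_left integrable_real_indicator)
      (auto simp: emeasure_lborel_Icc_eq)
  have int1: "(LINT x:{t - 1..t}|lebesgue. c) = c" for c :: real
    by (simp add: set_lebesgue_integral_def)
  have nn: "0 \<le> (LINT x:{a..b}|lebesgue. norm (v x))" for a b
    unfolding set_lebesgue_integral_def by (rule integral_nonneg_AE) auto
  have le: "norm (f t) \<le> norm (f s) + ?V" if "s \<in> {t - 1..t}" for s
  proof -
    have "norm (f t - f s) \<le> (LINT x:{s..t}|lebesgue. norm (v x))"
      using that by (intro ac_norm_diff_le ac v) auto
    also have "\<dots> \<le> ?V"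
      using that set_integral_split_interval[of "t - 1" s t "\<lambda>x. norm (v x)"] L2_set_integrable_norm[OF v] nn[of "t - 1" s]
      by auto
    finally show ?thesis using norm_triangle_sub[of "f t" "f s"] by linarith
  qed
  have "norm (f t) = (LINT x:{t - 1..t}|lebesgue. norm (f t))" using int1 by simp
  also have "\<dots> \<le> (LINT x:{t - 1..t}|lebesgue. norm (f x) + ?V)"
    using le by (intro set_integral_mono set_integral_add one L2_set_integrable_norm f) auto
  also have "\<dots> = (LINT x:{t - 1..t}|lebesgue. norm (f x)) + ?V"
    using set_integral_add(2)[OF L2_set_integrable_norm[OF f] one[of ?V]] int1[of ?V] by simp
  finally show ?thesis
    using set_integral_norm_le_sqrt[OF f, of "t - 1"] set_integral_norm_le_sqrt[OF v, of "t - 1"] by simp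
qed

lemma set_integral_square_le_L2_norm:
  assumes "f \<in> L2"
  shows "sqrt (LINT x:{s..t}|lebesgue. (norm (f x))\<^sup>2) \<le> L2_norm f"
  unfolding L2_norm_def set_lebesgue_integral_def
  by (intro real_sqrt_le_mono integral_mono integrable_mult_indicator L2_integrable_square[OF assms])
     (auto simp: indicator_def)

lemma ac_norm_le:
  assumes "f \<in> L2" "v \<in> L2" "has_ac_derivative f v"
  shows "norm (f t) \<le> L2_norm f + L2_norm v"
  using ac_norm_le_local[OF assms, of t] set_integral_square_le_L2_norm[OF assms(1), of "t-1" t]
    set_integral_square_le_L2_norm[OF assms(2), of "t-1" t] by linarith

lemma ac_vanishes_at_infinity:
  assumes f: "f \<in> L2" and v: "v \<in> L2" and ac: "has_ac_derivative f v" and e: "e > 0"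
  shows "\<exists>R. \<forall>t. \<bar>t\<bar> > R \<longrightarrow> norm (f t) < e"
proof -
  have "(e / 2)\<^sup>2 > 0" using e by simp
  then obtain R1 R2 where R: "\<And>t. \<bar>t\<bar> > R1 \<Longrightarrow> (LINT x:{t - 1..t}|lebesgue. (norm (f x))\<^sup>2) < (e / 2)\<^sup>2"
    "\<And>t. \<bar>t\<bar> > R2 \<Longrightarrow> (LINT x:{t - 1..t}|lebesgue. (norm (v x))\<^sup>2) < (e / 2)\<^sup>2"
    using integral_unit_interval_tail[OF L2_integrable_square[OF f], of "(e/2)\<^sup>2"]
      integral_unit_interval_tail[OF L2_integrable_square[OF v], of "(e/2)\<^sup>2"] by auto
  have "norm (f t) < e" if "\<bar>t\<bar> > max R1 R2" for t
  proof -
    have "sqrt (LINT x:{t - 1..t}|lebesgue. (norm (f x))\<^sup>2) < sqrt ((e / 2)\<^sup>2)"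
      "sqrt (LINT x:{t - 1..t}|lebesgue. (norm (v x))\<^sup>2) < sqrt ((e / 2)\<^sup>2)"
      by (intro real_sqrt_less_mono R; use that in simp)+
    then show ?thesis using ac_norm_le_local[OF f v ac, of t] e by simp
  qed
  then show ?thesis by blast
qed

text \<open>The member of the cover that contains 0 swallows both tails of the curve, and the rest
  is the image of a compact interval. The limit 0 has to be added because the curve may never attain
  it.\<close>

lemma compact_insert_zero_range:
  fixes f :: "real \<Rightarrow> 'c::real_normed_vector"
  assumes f: "continuous_on UNIV f" and lim: "\<And>e. e > 0 \<Longrightarrow> \<exists>R. \<forall>t. \<bar>t\<bar> > R \<longrightarrow> norm (f t) < e"
  shows "compact (insert 0 (range f))"
proof (rule compactI)
  fix C assume C: "\<forall>t\<in>C. open t" "insert 0 (range f) \<subseteq> \<Union>C"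
  then obtain U where U: "U \<in> C" "0 \<in> U" by auto
  then obtain e where e: "e > 0" "ball 0 e \<subseteq> U" using C(1) open_contains_ball by blast
  obtain R where R: "\<And>t. \<bar>t\<bar> > R \<Longrightarrow> norm (f t) < e" using lim[OF e(1)] by auto
  have "compact (f ` {-R..R})" by (rule compact_continuous_image[OF continuous_on_subset[OF f]]) auto
  moreover have "f ` {-R..R} \<subseteq> \<Union>C" using C(2) by auto
  ultimately obtain C' where C': "C' \<subseteq> C" "finite C'" "f ` {-R..R} \<subseteq> \<Union>C'"
    using C(1) compact_eq_Heine_Borel by metis
  have "f t \<in> \<Union>(insert U C')" for t
  proof (cases "\<bar>t\<bar> > R")
    case True
    then have "f t \<in> ball 0 e" using R by simp
    then show ?thesis using e(2) by auto
  next
    case False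
    then have "f t \<in> f ` {-R..R}" by (intro imageI) auto
    then show ?thesis using C'(3) by auto
  qed
  then have "insert 0 (range f) \<subseteq> \<Union>(insert U C')" using U(2) by auto
  then show "\<exists>C'\<subseteq>C. finite C' \<and> insert 0 (range f) \<subseteq> \<Union>C'"
    using C' U(1) by (intro exI[of _ "insert U C'"]) auto
qed

text \<open>The set is the cone over the range with vertex 0, an image of a compact product.
  Star-shapedness keeps segments from 0 inside the compact set, as needed for expansions at
  0.\<close>

lemma ac_range_compact_starlike:
  assumes f: "continuous_on UNIV f" "f \<in> L2" and v: "v \<in> L2" and ac: "has_ac_derivative f v"
  shows "\<exists>K. compact K \<and> range f \<subseteq> K \<and> (\<forall>x\<in>K. \<forall>t\<in>{0..1}. t *\<^sub>R x \<in> K)"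
proof (intro exI conjI)
  let ?K = "(\<lambda>(t, x). t *\<^sub>R x) ` ({0..1::real} \<times> insert 0 (range f))"
  have "compact (insert 0 (range f))"
    by (rule compact_insert_zero_range[OF f(1) ac_vanishes_at_infinity[OF f(2) v ac]])
  then show "compact ?K"
    by (intro compact_continuous_image compact_Times) (auto simp: case_prod_unfold intro!: continuous_intros)
  show "range f \<subseteq> ?K"
  proof
    fix x assume "x \<in> range f"
    then show "x \<in> ?K" by (intro image_eqI[of _ _ "(1, x)"]) auto
  qed
  show "\<forall>x\<in>?K. \<forall>t\<in>{0..1}. t *\<^sub>R x \<in> ?K"
  proof (intro ballI)
    fix x and t :: real assume x: "x \<in> ?K" and t: "t \<in> {0..1}"
    from x obtain p where "x = (\<lambda>(t, x). t *\<^sub>R x) p" "p \<in> {0..1} \<times> insert 0 (range f)" by (rule imageE)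
    then obtain s y where "x = s *\<^sub>R y" "s \<in> {0..1}" "y \<in> insert 0 (range f)" by (cases p) auto
    then show "t *\<^sub>R x \<in> ?K" using t
      by (intro image_eqI[of _ _ "(t * s, y)"]) (auto simp: mult_le_one)
  qed
qed

text \<open>Membership in \<open>W_space\<close> with explicit witnesses: \<open>v\<close> for the weak derivative and \<open>u\<close> for the lift to
  \<open>H\<^sub>2\<close>. It avoids the choice operators in \<open>weak_deriv\<close> and \<open>inv\<close>.\<close>

definition W_data :: "('b::real_inner \<Rightarrow> 'a::real_inner) \<Rightarrow> (real \<Rightarrow> 'a) \<Rightarrow> (real \<Rightarrow> 'a) \<Rightarrow> (real \<Rightarrow> 'b) \<Rightarrow> bool" where
  "W_data j f v u \<longleftrightarrow> continuous_on UNIV f \<and> has_ac_derivative f v \<and> v \<in> L2 \<and> u \<in> L2 \<and>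
     (AE s in lebesgue. f s = j (u s))"

lemma W_dataD:
  assumes "W_data j f v u"
  shows "continuous_on UNIV f" "has_ac_derivative f v" "v \<in> L2" "u \<in> L2" "AE s in lebesgue. f s = j (u s)"
  using assms by (auto simp: W_data_def)

lemma W_data_L2:
  assumes W: "W_data j f v u" and j: "\<And>x. norm (j x) \<le> norm x"
  shows "f \<in> L2" "L2_norm f \<le> L2_norm u"
proof -
  note D = W_dataD[OF W]
  have sm: "strongly_measurable f" by (rule strongly_measurable_continuous[OF D(1)])
  have le: "AE s in lebesgue. norm (f s) \<le> norm (u s)"
    using D(5) by eventually_elim (simp add: j)
  then have "AE s in lebesgue. norm (f s) \<le> 1 * norm (u s)" by simp
  then show "f \<in> L2" by (rule L2_dominated1(1)[OF sm D(4), of 1, rotated]) simp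
  show "L2_norm f \<le> L2_norm u" by (rule L2_norm_mono[OF sm D(4) le])
qed

text \<open>The Sobolev bound in the supremum norm; the L2 norm of the curve in H1 is absorbed by
  that of its lift.\<close>

lemma W_data_norm_le:
  assumes W: "W_data j f v u" and j: "\<And>x. norm (j x) \<le> norm x"
  shows "norm (f t) \<le> L2_norm u + L2_norm v"
  using ac_norm_le[OF W_data_L2(1)[OF W j] W_dataD(3,2)[OF W], of t] W_data_L2(2)[OF W j] by linarith

lemma weak_deriv_properties:
  fixes f :: "real \<Rightarrow> 'c::{real_inner, banach}"
  assumes "f \<in> W12"
  shows "weak_deriv f \<in> L2" "has_ac_derivative f (weak_deriv f)"
proof -
  have "\<exists>v. v \<in> L2 \<and> has_weak_derivative f v" using assms by (auto simp: W12_def)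
  then have *: "weak_deriv f \<in> L2 \<and> has_weak_derivative f (weak_deriv f)"
    unfolding weak_deriv_def by (rule someI_ex)
  then show "weak_deriv f \<in> L2" by simp
  show "has_ac_derivative f (weak_deriv f)"
    by (rule weak_imp_ac_derivative) (use assms * in \<open>auto simp: W12_def\<close>)
qed

lemma W_space_data:
  fixes j :: "'b::real_inner \<Rightarrow> 'a::{real_inner, banach}"
  assumes "f \<in> W_space j"
  shows "W_data j f (weak_deriv f) (\<lambda>s. inv j (f s))"
proof -
  have W12: "f \<in> W12" and ae: "AE s in lebesgue. f s \<in> range j" and u: "(\<lambda>s. inv j (f s)) \<in> L2"
    using assms by (auto simp: W_space_def)
  have "AE s in lebesgue. f s = j (inv j (f s))"
    using ae by eventually_elim (simp add: f_inv_into_f)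
  moreover have "continuous_on UNIV f" using W12 by (simp add: W12_def)
  ultimately show ?thesis using u weak_deriv_properties[OF W12] unfolding W_data_def by (intro conjI)
qed

lemma W_norm_eq: "W_norm j f = sqrt ((L2_norm (weak_deriv f))\<^sup>2 + (L2_norm (\<lambda>s. inv j (f s)))\<^sup>2)"
  by (simp add: W_norm_def L2_norm_power2)

text \<open>Uniqueness of the derivative and injectivity of \<open>j\<close> identify the chosen
  \<open>weak_deriv\<close> and \<open>inv j\<close> with the given witnesses almost everywhere, so
  the norm can be computed from any witnesses.\<close>

lemma W_data_imp_W_space:
  fixes j :: "'b::real_inner \<Rightarrow> 'a::{real_inner, banach}"
  assumes W: "W_data j f v u" and inj: "inj j" and j: "\<And>x. norm (j x) \<le> norm x"
  shows "f \<in> W_space j" "W_norm j f = sqrt ((L2_norm v)\<^sup>2 + (L2_norm u)\<^sup>2)"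
proof -
  note D = W_dataD[OF W]
  have W12: "f \<in> W12"
    using W_data_L2(1)[OF W j] D ac_imp_weak_derivative[OF D(1,3,2)] by (auto simp: W12_def)
  have ae: "AE s in lebesgue. u s = inv j (f s)"
    using D(5) by eventually_elim (simp add: inv_f_f[OF inj])
  have "AE s in lebesgue. f s \<in> range j" using D(5) by eventually_elim simp
  then show "f \<in> W_space j" using W12 L2_norm_AE_cong(1)[OF D(4) ae] by (simp add: W_space_def)
  have "AE s in lebesgue. v s = weak_deriv f s"
    by (rule has_ac_derivative_unique[OF D(2) weak_deriv_properties(2)[OF W12] D(3) weak_deriv_properties(1)[OF W12]])
  then have "L2_norm (weak_deriv f) = L2_norm v" by (rule L2_norm_AE_cong(2)[OF D(3)])
  moreover have "L2_norm (\<lambda>s. inv j (f s)) = L2_norm u" by (rule L2_norm_AE_cong(2)[OF D(4) ae])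
  ultimately show "W_norm j f = sqrt ((L2_norm v)\<^sup>2 + (L2_norm u)\<^sup>2)"
    unfolding W_norm_eq by (simp only:)
qed

section \<open>Calculus of maps of class C2\<close>

lemma fderiv_works:
  assumes "f differentiable (at x)"
  shows "(f has_derivative fderiv f x) (at x)"
  using assms frechet_derivative_works[of f "at x"]
    bounded_linear_Blinfun_apply[OF has_derivative_bounded_linear[of f "frechet_derivative f (at x)" "at x"]]
  by (simp add: fderiv_def)

lemma C2_on_UNIV_D:
  assumes "C2_on UNIV f"
  shows "(f has_derivative fderiv f x) (at x)"
    and "(fderiv f has_derivative fderiv (fderiv f) x) (at x)"
    and "continuous_on UNIV (fderiv f)" "continuous_on UNIV (fderiv (fderiv f))"
proof -
  show "(f has_derivative fderiv f x) (at x)" using assms by (intro fderiv_works) (simp add: C2_on_def)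
  show *: "(fderiv f has_derivative fderiv (fderiv f) x) (at x)" for x
    using assms by (intro fderiv_works) (simp add: C2_on_def)
  show "continuous_on UNIV (fderiv f)"
    by (intro continuous_at_imp_continuous_on ballI has_derivative_continuous[OF *])
  show "continuous_on UNIV (fderiv (fderiv f))" using assms by (simp add: C2_on_def)
qed

text \<open>One radius serves all base points of \<open>K\<close>. The second estimate is the
  uniform o(h) expansion of the first derivative, deduced from the first by the mean value
  inequality.\<close>

lemma C2_near_compact:
  assumes f: "C2_on UNIV f" and K: "compact K" and e: "e > 0"
  shows "\<exists>d>0. \<forall>x\<in>K. \<forall>h. norm h < d \<longrightarrow> norm (fderiv (fderiv f) (x + h) - fderiv (fderiv f) x) \<le> e \<and>
    norm (fderiv f (x + h) - fderiv f x - fderiv (fderiv f) x h) \<le> norm h * e"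
proof -
  obtain d where d: "d > 0" "\<And>x y. x \<in> K \<Longrightarrow> norm (y - x) < d \<Longrightarrow> norm (fderiv (fderiv f) y - fderiv (fderiv f) x) < e"
    using continuous_near_compact[OF K C2_on_UNIV_D(4)[OF f] e] by auto
  have 1: "norm (fderiv (fderiv f) (x + h) - fderiv (fderiv f) x) \<le> e" if "x \<in> K" "norm h < d" for x h
    using d(2)[OF that(1), of "x + h"] that(2) by simp
  have "norm (fderiv f (x + h) - fderiv f x - fderiv (fderiv f) x h) \<le> norm h * e" if "x \<in> K" "norm h < d" for x h
  proof (rule linearization_bound[OF C2_on_UNIV_D(2)[OF f]])
    fix y assume "norm (y - x) \<le> norm h"
    then show "norm (fderiv (fderiv f) y - fderiv (fderiv f) x) \<le> e" using d(2)[OF that(1), of y] that(2) by simp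
  qed
  then show ?thesis using d(1) 1 by blast
qed

section \<open>Symmetry of the second derivative\<close>

text \<open>The mean value inequality is used twice: for the first difference of \<open>f\<close> by
  \<open>v\<close>, moved in direction \<open>u\<close>, and inside it for \<open>fderiv f\<close>
  moved in direction \<open>v\<close>. The constant 9 is 6 for the outer linearisation plus 3 for
  evaluating its linear term.\<close>

lemma second_difference_bound:
  assumes f: "C2_on UNIV f" and e: "\<And>y. norm (y - x) < d \<Longrightarrow> norm (fderiv (fderiv f) y - fderiv (fderiv f) x) \<le> e"
    and small: "norm u + norm v < d"
  shows "norm (f (x + u + v) - f (x + u) - f (x + v) + f x - fderiv (fderiv f) x v u) \<le> 9 * (e * norm u * norm v)"
proof -
  let ?A = "fderiv f" and ?B = "fderiv (fderiv f)"
  define g where "g y = f (y + v) - f y" for y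
  have g: "(g has_derivative blinfun_apply (?A (y + v) - ?A y)) (at y)" for y
  proof -
    have "((\<lambda>y. f (y + v)) has_derivative ?A (y + v)) (at y)"
      by (rule has_derivative_compose[where g=f and f="\<lambda>y. y + v" and f'="\<lambda>h. h", OF _ C2_on_UNIV_D(1)[OF f]])
        (auto intro!: derivative_eq_intros)
    from has_derivative_diff[OF this C2_on_UNIV_D(1)[OF f]]
    show ?thesis unfolding g_def[abs_def] by (simp add: blinfun.diff_left[abs_def])
  qed
  \<comment> \<open>Of the 3, two come from linearising at \<open>y\<close> and one from replacing
    the second derivative at \<open>y\<close> by that at \<open>x\<close>.\<close>
  have e': "norm (?A (y + v) - ?A y - ?B x v) \<le> 3 * (e * norm v)" if y: "norm (y - x) \<le> norm u" for y
  proof -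
    have b: "norm (?B z - ?B x) \<le> e" if "norm (z - y) \<le> norm v" for z
      using norm_triangle_ineq[of "z - y" "y - x"] that y small by (intro e) simp
    have "norm (?A (y + v) - ?A y - ?B y v) \<le> norm v * (2 * e)"
    proof (rule linearization_bound[OF C2_on_UNIV_D(2)[OF f]])
      fix z assume "norm (z - y) \<le> norm v"
      then have "norm (?B z - ?B x) \<le> e" by (rule b)
      moreover have "norm (?B y - ?B x) \<le> e" by (rule b) simp
      ultimately show "norm (?B z - ?B y) \<le> 2 * e"
        using norm_triangle_ineq4[of "?B z - ?B x" "?B y - ?B x"] by simp
    qed
    moreover have "norm (?B y v - ?B x v) \<le> norm v * e"
    proof -
      have "norm (?B y v - ?B x v) = norm ((?B y - ?B x) v)" by (simp add: blinfun.diff_left)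
      also have "\<dots> \<le> norm (?B y - ?B x) * norm v" by (rule norm_blinfun)
      also have "\<dots> \<le> e * norm v" by (rule mult_right_mono[OF b]) auto
      finally show ?thesis by (simp add: mult.commute)
    qed
    ultimately show ?thesis
      using norm_triangle_ineq[of "?A (y + v) - ?A y - ?B y v" "?B y v - ?B x v"] by (simp add: mult_ac)
  qed
  \<comment> \<open>Both derivatives of \<open>g\<close>, at \<open>y\<close> and at
    \<open>x\<close>, are within 3 of the same operator, hence 6.\<close>
  have "norm (g (x + u) - g x - (?A (x + v) - ?A x) u) \<le> norm u * (6 * (e * norm v))"
  proof (rule linearization_bound[OF g])
    fix y assume y: "norm (y - x) \<le> norm u"
    have "norm (?A (y + v) - ?A y - ?B x v) \<le> 3 * (e * norm v)" by (rule e'[OF y])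
    moreover have "norm (?A (x + v) - ?A x - ?B x v) \<le> 3 * (e * norm v)" by (rule e') simp
    ultimately show "norm (?A (y + v) - ?A y - (?A (x + v) - ?A x)) \<le> 6 * (e * norm v)"
      using norm_triangle_ineq4[of "?A (y + v) - ?A y - ?B x v" "?A (x + v) - ?A x - ?B x v"] by simp
  qed
  moreover have "norm ((?A (x + v) - ?A x) u - ?B x v u) \<le> norm u * (3 * (e * norm v))"
  proof -
    have "norm ((?A (x + v) - ?A x) u - ?B x v u) = norm ((?A (x + v) - ?A x - ?B x v) u)"
      by (simp add: blinfun.diff_left)
    also have "\<dots> \<le> norm (?A (x + v) - ?A x - ?B x v) * norm u" by (rule norm_blinfun)
    also have "\<dots> \<le> (3 * (e * norm v)) * norm u" by (rule mult_right_mono[OF e']) auto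
    finally show ?thesis by (simp add: mult.commute)
  qed
  ultimately have "norm (g (x + u) - g x - ?B x v u) \<le> norm u * (6 * (e * norm v)) + norm u * (3 * (e * norm v))"
    by (rule norm_diff_triangle_le)
  moreover have eq: "f (x + u + v) - f (x + u) - f (x + v) + f x = g (x + u) - g x"
    by (simp add: g_def)
  ultimately show ?thesis unfolding eq by (simp add: algebra_simps)
qed

text \<open>The second difference is symmetric in its two increments and approximates both orders.
  Scaling the increments by \<open>t\<close> and dividing by the square of \<open>t\<close> leaves
  an error proportional to an arbitrary \<open>e\<close>.\<close>

lemma second_fderiv_symmetric:
  assumes f: "C2_on UNIV f"
  shows "fderiv (fderiv f) x u v = fderiv (fderiv f) x v u"
proof -
  let ?B = "fderiv (fderiv f)"
  define c where "c = 18 * norm u * norm v"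
  have c: "c \<ge> 0" by (simp add: c_def)
  have bound: "norm (?B x u v - ?B x v u) \<le> e * c" if e: "e > 0" for e
  proof -
    obtain d where d: "d > 0" "\<And>y. norm (y - x) < d \<Longrightarrow> norm (?B y - ?B x) < e"
      using continuous_near_compact[OF compact_sing[of x] C2_on_UNIV_D(4)[OF f] e] by auto
    \<comment> \<open>Chosen so that the scaled increments together stay below \<open>d\<close>; the
      1 covers u = v = 0.\<close>
    define t where "t = d / (norm u + norm v + 1)"
    have n: "norm u + norm v + 1 > 0" using norm_ge_zero[of u] norm_ge_zero[of v] by linarith
    have t: "t > 0" unfolding t_def using d(1) n by simp
    have "t * (norm u + norm v) < t * (norm u + norm v + 1)" using t by simp
    also have "\<dots> = d" using n by (simp add: t_def)
    finally have td: "norm (t *\<^sub>R u) + norm (t *\<^sub>R v) < d" using t by (simp add: distrib_left)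
    have dd: "norm (?B y - ?B x) \<le> e" if "norm (y - x) < d" for y using d(2)[OF that] by simp
    let ?D = "f (x + t *\<^sub>R u + t *\<^sub>R v) - f (x + t *\<^sub>R u) - f (x + t *\<^sub>R v) + f x"
    have 1: "norm (?D - ?B x (t *\<^sub>R v) (t *\<^sub>R u)) \<le> 9 * (e * norm (t *\<^sub>R u) * norm (t *\<^sub>R v))"
      by (rule second_difference_bound[OF f dd td])
    have "f (x + t *\<^sub>R v + t *\<^sub>R u) - f (x + t *\<^sub>R v) - f (x + t *\<^sub>R u) + f x = ?D"
      by (simp add: algebra_simps)
    moreover have "norm (t *\<^sub>R v) + norm (t *\<^sub>R u) < d" using td by simp
    from second_difference_bound[OF f dd this]
    have "norm (f (x + t *\<^sub>R v + t *\<^sub>R u) - f (x + t *\<^sub>R v) - f (x + t *\<^sub>R u) + f x - ?B x (t *\<^sub>R u) (t *\<^sub>R v))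
        \<le> 9 * (e * norm (t *\<^sub>R v) * norm (t *\<^sub>R u))" .
    ultimately have 2: "norm (?D - ?B x (t *\<^sub>R u) (t *\<^sub>R v)) \<le> 9 * (e * norm (t *\<^sub>R v) * norm (t *\<^sub>R u))"
      by (simp only:)
    have "norm (?B x (t *\<^sub>R u) (t *\<^sub>R v) - ?B x (t *\<^sub>R v) (t *\<^sub>R u)) \<le> t\<^sup>2 * (e * c)"
      using norm_triangle_ineq4[of "?D - ?B x (t *\<^sub>R v) (t *\<^sub>R u)" "?D - ?B x (t *\<^sub>R u) (t *\<^sub>R v)"] 1 2 t
      by (simp add: c_def power2_eq_square algebra_simps)
    moreover have "?B x (t *\<^sub>R u) (t *\<^sub>R v) - ?B x (t *\<^sub>R v) (t *\<^sub>R u) = (t * t) *\<^sub>R (?B x u v - ?B x v u)"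
      by (simp add: blinfun.scaleR_right blinfun.scaleR_left scaleR_diff_right)
    ultimately have "t\<^sup>2 * norm (?B x u v - ?B x v u) \<le> t\<^sup>2 * (e * c)" using t by (simp add: power2_eq_square)
    then show ?thesis using t by simp
  qed
  have "norm (?B x u v - ?B x v u) \<le> 0 + r" if "r > 0" for r
  proof -
    have "norm (?B x u v - ?B x v u) \<le> (r / (c + 1)) * c" using c that by (intro bound) simp
    also have "\<dots> \<le> r" using c that by (simp add: field_simps)
    finally show ?thesis by simp
  qed
  then have "norm (?B x u v - ?B x v u) \<le> 0" by (rule field_le_epsilon)
  then show ?thesis by simp
qed

section \<open>Mean value and Taylor estimates along segments\<close>

lemma unit_interval_mean_value:
  fixes p :: "real \<Rightarrow> 'c::real_normed_vector"
  assumes "\<And>t. (p has_vector_derivative p' t) (at t)" "\<And>t. t \<in> {0..1} \<Longrightarrow> norm (p' t) \<le> c"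
  shows "norm (p 1 - p 0) \<le> c"
proof -
  have "norm (p 1 - p 0) \<le> c * norm (1 - 0 :: real)"
  proof (rule differentiable_bound[of "{0..1}" p "\<lambda>t h. h *\<^sub>R p' t"])
    show "(p has_derivative (\<lambda>h. h *\<^sub>R p' t)) (at t within {0..1})" for t
      using assms(1)[of t] unfolding has_vector_derivative_def by (rule has_derivative_at_withinI)
    show "onorm (\<lambda>h. h *\<^sub>R p' t) \<le> c" if "t \<in> {0..1}" for t
      using assms(2)[OF that] by (intro onorm_le) (simp add: mult.commute[of c] mult_left_mono)
  qed auto
  then show ?thesis by simp
qed

lemma has_vector_derivative_along_line:
  assumes "\<And>x. (F has_derivative blinfun_apply (F' x)) (at x)"
  shows "((\<lambda>t. F (y + t *\<^sub>R a)) has_vector_derivative F' (y + t *\<^sub>R a) a) (at t)"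
proof -
  have "((\<lambda>t. y + t *\<^sub>R a) has_vector_derivative a) (at t)"
    by (auto intro!: derivative_eq_intros simp: has_vector_derivative_def)
  from vector_derivative_diff_chain_within[OF this has_derivative_at_withinI[OF assms]] 
  show ?thesis by (simp add: o_def)
qed

text \<open>The hypothesis bounds the second derivative only on the pair (a, u), not in operator
  norm: the tame estimate has mixed norms and would lose its H1 factors in an operator norm on
  H2.\<close>

lemma fderiv_increment_bound:
  assumes g: "C2_on UNIV g" and c: "\<And>t. t \<in> {0..1} \<Longrightarrow> norm (fderiv (fderiv g) (y + t *\<^sub>R a) a u) \<le> c"
  shows "norm (fderiv g (y + a) u - fderiv g y u) \<le> c"
proof -
  have "((\<lambda>t. fderiv g (y + t *\<^sub>R a) u) has_vector_derivative fderiv (fderiv g) (y + t *\<^sub>R a) a u) (at t)" for t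
    using bounded_linear.has_vector_derivative[OF blinfun.bounded_linear_left
        has_vector_derivative_along_line[OF C2_on_UNIV_D(2)[OF g]]] .
  from unit_interval_mean_value[OF this c] show ?thesis by simp
qed

text \<open>The derivative in \<open>t\<close> of the remainder along the segment is an increment of
  \<open>fderiv g\<close> by \<open>t\<close> times \<open>a\<close>. The factor \<open>t\<close> is
  estimated by 1, so the usual 1/2 does not appear.\<close>

lemma taylor_remainder_bound:
  assumes g: "C2_on UNIV g" and c: "\<And>t. t \<in> {0..1} \<Longrightarrow> norm (fderiv (fderiv g) (y + t *\<^sub>R a) a a) \<le> c"
  shows "norm (g (y + a) - g y - fderiv g y a) \<le> c"
proof -
  have "((\<lambda>t. g (y + t *\<^sub>R a) - t *\<^sub>R fderiv g y a) has_vector_derivative fderiv g (y + t *\<^sub>R a) a - fderiv g y a) (at t)" for t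
    by (intro has_vector_derivative_diff has_vector_derivative_along_line[OF C2_on_UNIV_D(1)[OF g]])
      (auto intro!: derivative_eq_intros simp: has_vector_derivative_def)
  moreover have "norm (fderiv g (y + t *\<^sub>R a) a - fderiv g y a) \<le> c" if t: "t \<in> {0..1}" for t
  proof (rule fderiv_increment_bound[OF g])
    fix r :: real assume r: "r \<in> {0..1}"
    have "norm (fderiv (fderiv g) (y + r *\<^sub>R t *\<^sub>R a) (t *\<^sub>R a) a) = t * norm (fderiv (fderiv g) (y + (r * t) *\<^sub>R a) a a)"
      using t by (simp add: blinfun.scaleR_right blinfun.scaleR_left)
    also have "\<dots> \<le> 1 * c"
      using t r by (intro mult_mono c) (auto simp: mult_le_one)
    finally show "norm (fderiv (fderiv g) (y + r *\<^sub>R t *\<^sub>R a) (t *\<^sub>R a) a) \<le> c" by simp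
  qed
  ultimately have "norm ((g (y + 1 *\<^sub>R a) - 1 *\<^sub>R fderiv g y a) - (g (y + 0 *\<^sub>R a) - 0 *\<^sub>R fderiv g y a)) \<le> c"
    by (rule unit_interval_mean_value)
  then show ?thesis by (simp add: algebra_simps)
qed

section \<open>Tame maps\<close>

lemma has_ac_derivative_compose:
  fixes \<phi> :: "'a::{real_inner, banach} \<Rightarrow> 'c::real_inner"
  assumes "C2_on UNIV \<phi>" "continuous_on UNIV f" "has_ac_derivative f v" "v \<in> L2"
  shows "has_ac_derivative (\<lambda>s. \<phi> (f s)) (\<lambda>s. fderiv \<phi> (f s) (v s))"
  unfolding has_ac_derivative_def
  using ac_chain_rule(2)[OF C2_on_UNIV_D(1,3)[OF assms(1)] assms(2-4)] by blast

text \<open>The chain rule for the map (x, a) to \<open>fderiv \<phi> x a\<close> along the pair of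
  curves.\<close>

lemma has_ac_derivative_fderiv_apply:
  fixes \<phi> :: "'a::{real_inner, banach} \<Rightarrow> 'c::real_inner"
  assumes \<phi>: "C2_on UNIV \<phi>" and f: "continuous_on UNIV f" "has_ac_derivative f v" "v \<in> L2"
    and a: "continuous_on UNIV a" "has_ac_derivative a b" "b \<in> L2"
  shows "has_ac_derivative (\<lambda>s. fderiv \<phi> (f s) (a s))
    (\<lambda>s. fderiv (fderiv \<phi>) (f s) (v s) (a s) + fderiv \<phi> (f s) (b s))"
proof -
  let ?A = "fderiv \<phi>" and ?B = "fderiv (fderiv \<phi>)"
  note ev = bounded_bilinear_blinfun_apply
  define F where "F p = ?A (fst p) (snd p)" for p
  \<comment> \<open>Assembled from bounded linear operations so that continuity in operator norm
    follows from that of the two derivatives of \<phi>.\<close>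
  define F' where "F' p = (bounded_bilinear.prod_left blinfun_apply (snd p) o\<^sub>L (?B (fst p) o\<^sub>L fst_blinfun)) +
    (?A (fst p) o\<^sub>L snd_blinfun)" for p
  have F'_apply: "F' p h = ?B (fst p) (fst h) (snd p) + ?A (fst p) (snd h)" for p h
    by (simp add: F'_def plus_blinfun.rep_eq bounded_bilinear.prod_left.rep_eq[OF ev])
  have dF: "(F has_derivative F' p) (at p)" for p
  proof -
    have "((\<lambda>p. ?A (fst p)) has_derivative (\<lambda>h. ?B (fst p) (fst h))) (at p)"
      by (rule has_derivative_compose[where g="?A" and f=fst and f'=fst, OF _ C2_on_UNIV_D(2)[OF \<phi>]])
        (intro derivative_intros)
    from bounded_bilinear.FDERIV[OF ev this has_derivative_snd[OF has_derivative_ident]]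
    show ?thesis unfolding F_def[abs_def] F'_apply[abs_def] by (simp add: add.commute)
  qed
  have cB: "continuous_on UNIV (\<lambda>p::'a \<times> 'a. ?B (fst p))" "continuous_on UNIV (\<lambda>p::'a \<times> 'a. ?A (fst p))"
    by (intro continuous_on_compose2[OF C2_on_UNIV_D(4)[OF \<phi>]] continuous_on_compose2[OF C2_on_UNIV_D(3)[OF \<phi>]]
        continuous_intros subset_UNIV)+
  have cF: "continuous_on UNIV F'"
    unfolding F'_def[abs_def]
    by (intro continuous_intros cB bounded_linear.continuous_on[OF bounded_bilinear.bounded_linear_prod_left[OF ev]])
  have c: "continuous_on UNIV (\<lambda>s. (f s, a s))" by (intro continuous_intros f a)
  show ?thesis
    unfolding has_ac_derivative_def
    using ac_chain_rule(2)[OF dF cF c has_ac_derivative_Pair[OF f(2) a(2) f(3) a(3)] L2_Pair[OF f(3) a(3)]]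
    by (simp add: F'_apply F_def)
qed

lemma has_ac_derivative_add:
  assumes "has_ac_derivative f v" "has_ac_derivative g w" "v \<in> L2" "w \<in> L2"
  shows "has_ac_derivative (\<lambda>x. f x + g x) (\<lambda>x. v x + w x)"
  unfolding has_ac_derivative_def
proof (intro allI impI)
  fix s t :: real and e assume st: "s \<le> t"
  show "(LINT x:{s..t}|lebesgue. inner e (v x + w x)) = inner e (f t + g t - (f s + g s))"
    using has_ac_derivativeD[OF assms(1) st] has_ac_derivativeD[OF assms(2) st]
      set_integral_add(2)[OF L2_set_integrable_inner[OF assms(3)] L2_set_integrable_inner[OF assms(4)]]
    by (simp add: inner_add_right inner_diff_right)
qed

lemma has_ac_derivative_diff:
  assumes "has_ac_derivative f v" "has_ac_derivative g w" "v \<in> L2" "w \<in> L2"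
  shows "has_ac_derivative (\<lambda>x. f x - g x) (\<lambda>x. v x - w x)"
  unfolding has_ac_derivative_def
proof (intro allI impI)
  fix s t :: real and e assume st: "s \<le> t"
  show "(LINT x:{s..t}|lebesgue. inner e (v x - w x)) = inner e (f t - g t - (f s - g s))"
    using has_ac_derivativeD[OF assms(1) st, of e] has_ac_derivativeD[OF assms(2) st, of e]
      set_integral_diff(2)[OF L2_set_integrable_inner[OF assms(3)] L2_set_integrable_inner[OF assms(4)]]
    by (simp add: inner_diff_right)
qed

lemma W_data_add:
  assumes j: "bounded_linear j" and W: "W_data j f v u" "W_data j g w z"
  shows "W_data j (\<lambda>s. f s + g s) (\<lambda>s. v s + w s) (\<lambda>s. u s + z s)"
proof -
  note D = W_dataD[OF W(1)] W_dataD[OF W(2)]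
  have "AE s in lebesgue. f s + g s = j (u s + z s)"
    using D(5,10) by eventually_elim (simp add: linear_add[OF bounded_linear.linear[OF j]])
  moreover have "continuous_on UNIV (\<lambda>s. f s + g s)" by (intro continuous_intros D)
  ultimately show ?thesis
    unfolding W_data_def using D by (intro conjI has_ac_derivative_add L2_add)
qed

lemma W_data_diff:
  assumes j: "bounded_linear j" and W: "W_data j f v u" "W_data j g w z"
  shows "W_data j (\<lambda>s. f s - g s) (\<lambda>s. v s - w s) (\<lambda>s. u s - z s)"
proof -
  note D = W_dataD[OF W(1)] W_dataD[OF W(2)]
  have "AE s in lebesgue. f s - g s = j (u s - z s)"
    using D(5,10) by eventually_elim (simp add: linear_diff[OF bounded_linear.linear[OF j]])
  moreover have "continuous_on UNIV (\<lambda>s. f s - g s)" by (intro continuous_intros D)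
  ultimately show ?thesis
    unfolding W_data_def using D by (intro conjI has_ac_derivative_diff L2_diff)
qed

section \<open>Pointwise estimates for a tame map\<close>

locale tame_on_Hilbert_pair =
  fixes j :: "'b::{real_inner, banach} \<Rightarrow> 'a::{real_inner, banach}" and \<phi> :: "'a \<Rightarrow> 'a"
  assumes j_linear: "bounded_linear j" and j_inj: "inj j" and j_norm: "\<And>x. norm (j x) \<le> norm x"
    and tame: "tame j UNIV \<phi>" and \<phi>_0: "\<phi> 0 = 0"
begin

abbreviation "A \<equiv> fderiv \<phi>"
abbreviation "B \<equiv> fderiv (fderiv \<phi>)"
abbreviation "g \<equiv> restr j \<phi>"

lemma C2_\<phi>: "C2_on UNIV \<phi>"
  using tame by (simp add: tame_def)

lemma C2_g: "C2_on UNIV g"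
  using tame by (simp add: tame_def)

lemma j_0: "j 0 = 0"
  by (rule linear_0[OF bounded_linear.linear[OF j_linear]])

lemma j_g: "j (g y) = \<phi> (j y)"
proof -
  have "\<phi> (j y) \<in> range j" using tame by (auto simp: tame_def)
  then show ?thesis unfolding restr_def by (rule f_inv_into_f)
qed

lemma g_0: "g 0 = 0"
  using j_inj by (simp add: restr_def j_0 \<phi>_0 inv_f_eq)

text \<open>Both sides differentiate the same map, as \<open>j\<close> after \<open>g\<close> equals
  \<phi> after \<open>j\<close>.\<close>

lemma j_fderiv_g: "j (fderiv g y u) = A (j y) (j u)"
proof -
  have "((\<lambda>y. j (g y)) has_derivative (\<lambda>u. j (fderiv g y u))) (at y)"
    by (rule bounded_linear.has_derivative[OF j_linear C2_on_UNIV_D(1)[OF C2_g]])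
  moreover have "((\<lambda>y. \<phi> (j y)) has_derivative (\<lambda>u. A (j y) (j u))) (at y)"
    by (rule has_derivative_compose[OF bounded_linear_imp_has_derivative[OF j_linear] C2_on_UNIV_D(1)[OF C2_\<phi>]])
  ultimately have "(\<lambda>u. j (fderiv g y u)) = (\<lambda>u. A (j y) (j u))"
    unfolding j_g by (rule has_derivative_unique)
  then show ?thesis by (rule fun_cong)
qed

text \<open>Indexed by the point of H1 rather than its lift, so that it can be made uniform near
  compact subsets of H1. It is vacuous off the range of \<open>j\<close>.\<close>

definition tame_bound :: "real \<Rightarrow> 'a \<Rightarrow> bool" where
  "tame_bound \<kappa> x \<longleftrightarrow> (\<forall>y u v. j y = x \<longrightarrow> norm (fderiv (fderiv g) y u v)
     \<le> \<kappa> * (norm (j u) * norm v + norm u * norm (j v) + norm y * norm (j u) * norm (j v)))"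

lemma tame_bound_mono:
  assumes "tame_bound \<kappa> x" "\<kappa> \<le> \<kappa>'"
  shows "tame_bound \<kappa>' x"
  unfolding tame_bound_def
proof (intro allI impI)
  fix y u v assume "j y = x"
  then have "norm (fderiv (fderiv g) y u v)
      \<le> \<kappa> * (norm (j u) * norm v + norm u * norm (j v) + norm y * norm (j u) * norm (j v))"
    using assms(1) unfolding tame_bound_def by blast
  also have "\<dots> \<le> \<kappa>' * (norm (j u) * norm v + norm u * norm (j v) + norm y * norm (j u) * norm (j v))"
    using assms(2) by (intro mult_right_mono) auto
  finally show "norm (fderiv (fderiv g) y u v)
      \<le> \<kappa>' * (norm (j u) * norm v + norm u * norm (j v) + norm y * norm (j u) * norm (j v))" .
qed

text \<open>A finite subcover by half-radius balls gives the largest constant and the smallest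
  radius; points near \<open>K\<close>, not just in it, are covered because increments leave
  \<open>K\<close>.\<close>

lemma tame_bound_near_compact:
  assumes K: "compact K"
  shows "\<exists>\<kappa>\<ge>0. \<exists>r>0. \<forall>x\<in>K. \<forall>z. norm (z - x) < r \<longrightarrow> tame_bound \<kappa> z"
proof -
  have "\<forall>x. \<exists>\<kappa> r. r > 0 \<and> (\<forall>z. norm (z - x) < r \<longrightarrow> tame_bound \<kappa> z)"
  proof
    fix x
    obtain W \<kappa> where W: "open W" "x \<in> W" "\<And>z. z \<in> W \<Longrightarrow> tame_bound \<kappa> z"
      using tame unfolding tame_def tame_bound_def by (metis UNIV_I)
    then obtain r where "r > 0" "ball x r \<subseteq> W" using open_contains_ball by metis
    then have "r > 0 \<and> (\<forall>z. norm (z - x) < r \<longrightarrow> tame_bound \<kappa> z)"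
      using W(3) by (auto simp: subset_iff dist_norm norm_minus_commute)
    then show "\<exists>\<kappa> r. r > 0 \<and> (\<forall>z. norm (z - x) < r \<longrightarrow> tame_bound \<kappa> z)" by blast
  qed
  then obtain \<kappa> r where r: "\<And>x. r x > 0" "\<And>x z. norm (z - x) < r x \<Longrightarrow> tame_bound (\<kappa> x) z" by metis
  have "K \<subseteq> (\<Union>x\<in>K. ball x (r x / 2))" using r(1) by fastforce
  then obtain C where C: "C \<subseteq> K" "finite C" "K \<subseteq> (\<Union>x\<in>C. ball x (r x / 2))"
    using compactE_image[OF K, of K "\<lambda>x. ball x (r x / 2)"] by auto
  define d where "d = Min (insert 1 ((\<lambda>x. r x / 2) ` C))"
  define k where "k = Max (insert 0 (\<kappa> ` C))"
  have "d > 0" unfolding d_def using C(2) r(1) by (subst Min_gr_iff) auto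
  moreover have "k \<ge> 0" unfolding k_def using C(2) by (intro Max_ge) auto
  moreover have "tame_bound k z" if "x \<in> K" "norm (z - x) < d" for x z
  proof -
    obtain c where c: "c \<in> C" "norm (x - c) < r c / 2" using C(3) \<open>x \<in> K\<close> by (auto simp: dist_norm norm_minus_commute)
    have "d \<le> r c / 2" unfolding d_def using C(2) c(1) by (intro Min_le) auto
    then have "norm (z - c) < r c" using that(2) c(2) norm_triangle_ineq[of "z - x" "x - c"] by simp
    then have "tame_bound (\<kappa> c) z" by (rule r(2))
    moreover have "\<kappa> c \<le> k" unfolding k_def using C(2) c(1) by (intro Max_ge) auto
    ultimately show ?thesis by (rule tame_bound_mono)
  qed
  ultimately show ?thesis by blast
qed

text \<open>The first two bounds expand at 0 along the segment to \<open>y\<close>, which stays in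
  \<open>K\<close> by star-shapedness; the last two expand at \<open>y\<close> along a segment that
  stays within \<open>r\<close> of \<open>K\<close> in H1. Every term keeps a single H2 factor, so
  each becomes square integrable along curves bounded in H1.\<close>

lemma H2_bounds:
  assumes K: "compact K" and star: "\<forall>x\<in>K. \<forall>t\<in>{0..1}. t *\<^sub>R x \<in> K"
  shows "\<exists>C\<ge>0. \<exists>r>0. \<forall>y. j y \<in> K \<longrightarrow>
    norm (g y) \<le> C * norm y \<and>
    (\<forall>u. norm (fderiv g y u) \<le> C * norm u + C * norm y * norm (j u)) \<and>
    (\<forall>a. norm (j a) < r \<longrightarrow>
      norm (g (y + a) - g y - fderiv g y a)
        \<le> C * (2 * norm (j a) * norm a + (norm y + norm a) * norm (j a) * norm (j a)) \<and>
      (\<forall>u. norm (fderiv g (y + a) u - fderiv g y u)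
        \<le> C * (norm (j a) * norm u + norm a * norm (j u) + (norm y + norm a) * norm (j a) * norm (j u))))"
proof -
  obtain \<kappa> r where \<kappa>: "\<kappa> \<ge> 0" "r > 0" "\<And>x z. x \<in> K \<Longrightarrow> norm (z - x) < r \<Longrightarrow> tame_bound \<kappa> z"
    using tame_bound_near_compact[OF K] by auto
  obtain R where "\<forall>x\<in>K. norm x \<le> R" using compact_imp_bounded[OF K] bounded_iff by metis
  then have R: "\<And>x. x \<in> K \<Longrightarrow> norm x \<le> max R 0" by (auto simp: le_max_iff_disj)
  \<comment> \<open>The bound \<open>R\<close> may be negative when \<open>K\<close> is
    empty.\<close>
  define R' where "R' = max R 0"
  have R': "R' \<ge> 0" "\<And>x. x \<in> K \<Longrightarrow> norm x \<le> R'" using R by (auto simp: R'_def)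
  have bound: "norm (fderiv (fderiv g) (y + t *\<^sub>R a) a u)
      \<le> \<kappa> * (norm (j a) * norm u + norm a * norm (j u) + (norm y + norm a) * norm (j a) * norm (j u))"
    if "tame_bound \<kappa> (j y + t *\<^sub>R j a)" "t \<in> {0..1}" for y a u t
  proof -
    have "norm (y + t *\<^sub>R a) \<le> norm y + norm (t *\<^sub>R a)" by (rule norm_triangle_ineq)
    also have "\<dots> \<le> norm y + norm a" using that(2) by (simp add: mult_left_le_one_le)
    finally have n: "norm (y + t *\<^sub>R a) \<le> norm y + norm a" .
    have "j (y + t *\<^sub>R a) = j y + t *\<^sub>R j a"
      by (simp add: linear_add[OF bounded_linear.linear[OF j_linear]] linear_scale[OF bounded_linear.linear[OF j_linear]])
    then have "norm (fderiv (fderiv g) (y + t *\<^sub>R a) a u)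
      \<le> \<kappa> * (norm (j a) * norm u + norm a * norm (j u) + norm (y + t *\<^sub>R a) * norm (j a) * norm (j u))"
      using that(1) unfolding tame_bound_def by blast
    also have "\<dots> \<le> \<kappa> * (norm (j a) * norm u + norm a * norm (j u) + (norm y + norm a) * norm (j a) * norm (j u))"
      using n \<kappa>(1) by (intro mult_left_mono add_left_mono mult_right_mono) auto
    finally show ?thesis .
  qed
  \<comment> \<open>A common majorant for all constants below; the powers of \<open>R'\<close> come
    from bounding the H1 norm of \<open>y\<close> in the tame estimate.\<close>
  define C where "C = norm (fderiv g 0) + \<kappa> * (1 + 2 * R' + R' * R')"
  have C: "C \<ge> 0" "\<kappa> \<le> C" "norm (fderiv g 0) + \<kappa> * (2 * R' + R' * R') \<le> C" "norm (fderiv g 0) + \<kappa> * R' \<le> C"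
    "\<kappa> * (1 + R') \<le> C"
  proof -
    have p: "0 \<le> \<kappa> * R'" "0 \<le> \<kappa> * (R' * R')" "0 \<le> \<kappa>" "0 \<le> norm (fderiv g 0)" using \<kappa>(1) R'(1) by auto
    show "C \<ge> 0" "\<kappa> \<le> C" "norm (fderiv g 0) + \<kappa> * (2 * R' + R' * R') \<le> C" "norm (fderiv g 0) + \<kappa> * R' \<le> C"
      "\<kappa> * (1 + R') \<le> C"
      unfolding C_def distrib_left mult.left_commute[of \<kappa> 2] mult_1_right using p by linarith+
  qed
  have "norm (g y) \<le> C * norm y" and "\<forall>u. norm (fderiv g y u) \<le> C * norm u + C * norm y * norm (j u)" if y: "j y \<in> K" for y
  proof -
    \<comment> \<open>The whole segment from 0 lies in \<open>K\<close>, so no smallness of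
      \<open>y\<close> is needed.\<close>
    have tb: "tame_bound \<kappa> (j 0 + t *\<^sub>R j y)" if "t \<in> {0..1}" for t
      using \<kappa>(3)[of "t *\<^sub>R j y" "t *\<^sub>R j y"] star y that \<kappa>(2) by (simp add: j_0)
    have jy: "norm (j y) \<le> R'" by (rule R'(2)[OF y])
    have A0: "norm (fderiv g 0 u) \<le> norm (fderiv g 0) * norm u" for u by (rule norm_blinfun)
    have inc: "norm (fderiv g (0 + y) u - fderiv g 0 u)
        \<le> \<kappa> * (norm (j y) * norm u + norm y * norm (j u) + (norm (0::'b) + norm y) * norm (j y) * norm (j u))" for u
      by (rule fderiv_increment_bound[OF C2_g bound]) (use tb in auto)
    have tay: "norm (g (0 + y) - g 0 - fderiv g 0 y)
        \<le> \<kappa> * (norm (j y) * norm y + norm y * norm (j y) + (norm (0::'b) + norm y) * norm (j y) * norm (j y))"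
      by (rule taylor_remainder_bound[OF C2_g bound]) (use tb in auto)
    show "norm (g y) \<le> C * norm y"
    proof -
      have "norm (g y) \<le> norm (g y - fderiv g 0 y) + norm (fderiv g 0 y)"
        using norm_triangle_ineq[of "g y - fderiv g 0 y" "fderiv g 0 y"] by simp
      also have "\<dots> \<le> \<kappa> * (R' * norm y + norm y * R' + norm y * (R' * R')) + norm (fderiv g 0) * norm y"
      proof (rule add_mono[OF _ A0])
        have "norm (g y - fderiv g 0 y) \<le> \<kappa> * (norm (j y) * norm y + norm y * norm (j y) + norm y * (norm (j y) * norm (j y)))"
          using tay by (simp add: g_0 mult.assoc)
        also have "\<dots> \<le> \<kappa> * (R' * norm y + norm y * R' + norm y * (R' * R'))"
          using jy R'(1) \<kappa>(1) by (intro mult_left_mono add_mono mult_mono) auto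
        finally show "norm (g y - fderiv g 0 y) \<le> \<kappa> * (R' * norm y + norm y * R' + norm y * (R' * R'))" .
      qed
      also have "\<dots> = (norm (fderiv g 0) + \<kappa> * (2 * R' + R' * R')) * norm y" by (simp add: algebra_simps)
      also have "\<dots> \<le> C * norm y" by (rule mult_right_mono[OF C(3)]) simp
      finally show ?thesis .
    qed
    show "\<forall>u. norm (fderiv g y u) \<le> C * norm u + C * norm y * norm (j u)"
    proof
      fix u
      have "norm (fderiv g y u) \<le> norm (fderiv g y u - fderiv g 0 u) + norm (fderiv g 0 u)"
        using norm_triangle_ineq[of "fderiv g y u - fderiv g 0 u" "fderiv g 0 u"] by simp
      also have "\<dots> \<le> \<kappa> * (R' * norm u + norm y * norm (j u) + norm y * R' * norm (j u)) + norm (fderiv g 0) * norm u"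
      proof (rule add_mono[OF _ A0])
        have "norm (fderiv g y u - fderiv g 0 u) \<le> \<kappa> * (norm (j y) * norm u + norm y * norm (j u) + norm y * norm (j y) * norm (j u))"
          using inc[of u] by simp
        also have "\<dots> \<le> \<kappa> * (R' * norm u + norm y * norm (j u) + norm y * R' * norm (j u))"
          using jy R'(1) \<kappa>(1) by (intro mult_left_mono add_mono mult_mono mult_nonneg_nonneg) auto
        finally show "norm (fderiv g y u - fderiv g 0 u) \<le> \<kappa> * (R' * norm u + norm y * norm (j u) + norm y * R' * norm (j u))" .
      qed
      also have "\<dots> = (norm (fderiv g 0) + \<kappa> * R') * norm u + \<kappa> * (1 + R') * (norm y * norm (j u))" by (simp add: algebra_simps)
      also have "\<dots> \<le> C * norm u + C * (norm y * norm (j u))"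
        by (intro add_mono mult_right_mono C) auto
      finally show "norm (fderiv g y u) \<le> C * norm u + C * norm y * norm (j u)" by (simp add: mult.assoc)
    qed
  qed
  moreover have "norm (g (y + a) - g y - fderiv g y a)
        \<le> C * (2 * norm (j a) * norm a + (norm y + norm a) * norm (j a) * norm (j a))"
    and "\<forall>u. norm (fderiv g (y + a) u - fderiv g y u)
        \<le> C * (norm (j a) * norm u + norm a * norm (j u) + (norm y + norm a) * norm (j a) * norm (j u))"
    if y: "j y \<in> K" and a: "norm (j a) < r" for y a
  proof -
    have tb: "tame_bound \<kappa> (j y + t *\<^sub>R j a)" if "t \<in> {0..1}" for t
    proof (rule \<kappa>(3)[OF y])
      have "norm (t *\<^sub>R j a) \<le> norm (j a)" using that by (simp add: mult_left_le_one_le)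
      then show "norm (j y + t *\<^sub>R j a - j y) < r" using a by simp
    qed
    have "norm (g (y + a) - g y - fderiv g y a)
        \<le> \<kappa> * (norm (j a) * norm a + norm a * norm (j a) + (norm y + norm a) * norm (j a) * norm (j a))"
      by (rule taylor_remainder_bound[OF C2_g bound[OF tb]])
    also have "\<dots> = \<kappa> * (2 * norm (j a) * norm a + (norm y + norm a) * norm (j a) * norm (j a))" by (simp add: mult_ac)
    also have "\<dots> \<le> C * (2 * norm (j a) * norm a + (norm y + norm a) * norm (j a) * norm (j a))"
      by (intro mult_right_mono C) auto
    finally show "norm (g (y + a) - g y - fderiv g y a)
        \<le> C * (2 * norm (j a) * norm a + (norm y + norm a) * norm (j a) * norm (j a))" .
    show "\<forall>u. norm (fderiv g (y + a) u - fderiv g y u)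
        \<le> C * (norm (j a) * norm u + norm a * norm (j u) + (norm y + norm a) * norm (j a) * norm (j u))"
    proof
      fix u
      have "norm (fderiv g (y + a) u - fderiv g y u)
          \<le> \<kappa> * (norm (j a) * norm u + norm a * norm (j u) + (norm y + norm a) * norm (j a) * norm (j u))"
        by (rule fderiv_increment_bound[OF C2_g bound[OF tb]])
      also have "\<dots> \<le> C * (norm (j a) * norm u + norm a * norm (j u) + (norm y + norm a) * norm (j a) * norm (j u))"
        by (intro mult_right_mono C) auto
      finally show "norm (fderiv g (y + a) u - fderiv g y u)
        \<le> C * (norm (j a) * norm u + norm a * norm (j u) + (norm y + norm a) * norm (j a) * norm (j u))" .
    qed
  qed
  ultimately show ?thesis using C(1) \<kappa>(2) by (intro exI[of _ C] exI[of _ r] conjI allI impI) auto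
qed

end

lemma norm_blinfun2: "norm (blinfun_apply (blinfun_apply T u) v) \<le> norm T * norm u * norm v"
  by (meson mult_right_mono norm_blinfun norm_ge_zero order_trans)

context tame_on_Hilbert_pair
begin

lemma pointwise_derivative_bound:
  assumes "norm (A x) \<le> M" "norm (B x) \<le> M"
  shows "norm (B x a w + A x b) \<le> M * norm a * norm w + M * norm b"
proof -
  have "norm (B x a w + A x b) \<le> norm (B x a w) + norm (A x b)" by (rule norm_triangle_ineq)
  also have "\<dots> \<le> norm (B x) * norm a * norm w + norm (A x) * norm b"
    by (intro add_mono norm_blinfun2 norm_blinfun)
  also have "\<dots> \<le> M * norm a * norm w + M * norm b"
    using assms by (intro add_mono mult_right_mono) auto
  finally show ?thesis .
qed

lemma operator_increment_bound:
  assumes M: "norm (B x) \<le> M" and e: "norm (A (x + h) - A x - B x h) \<le> norm h * \<epsilon>"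
  shows "norm (A (x + h) - A x) \<le> (M + \<epsilon>) * norm h"
proof -
  have "norm (A (x + h) - A x) \<le> norm (A (x + h) - A x - B x h) + norm (B x h)"
    using norm_triangle_ineq[of "A (x + h) - A x - B x h" "B x h"] by simp
  also have "norm (B x h) \<le> M * norm h"
    by (rule order_trans[OF norm_blinfun mult_right_mono[OF M]]) simp
  finally show ?thesis using e by (simp add: distrib_right mult.commute[of \<epsilon>])
qed

text \<open>The bound is linear in \<open>w\<close> and \<open>b\<close>, which along curves are
  only square integrable, while \<open>h\<close> is bounded. The fixed \<open>w\<close> gets the
  small \<epsilon>; the increment \<open>b\<close> gets a bounded factor times
  \<open>h\<close>.\<close>

lemma pointwise_remainder_bound:
  assumes M: "norm (B x) \<le> M" and e: "norm (A (x + h) - A x - B x h) \<le> norm h * \<epsilon>"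
  shows "norm (A (x + h) (w + b) - A x w - (B x h w + A x b)) \<le> \<epsilon> * norm h * norm w + (M + \<epsilon>) * norm h * norm b"
proof -
  have "A (x + h) (w + b) - A x w - (B x h w + A x b) = (A (x + h) - A x - B x h) w + (A (x + h) - A x) b"
    by (simp add: blinfun.diff_left blinfun.add_right)
  also have "norm \<dots> \<le> norm (A (x + h) - A x - B x h) * norm w + norm (A (x + h) - A x) * norm b"
    by (rule order_trans[OF norm_triangle_ineq add_mono[OF norm_blinfun norm_blinfun]])
  also have "\<dots> \<le> (norm h * \<epsilon>) * norm w + ((M + \<epsilon>) * norm h) * norm b"
    by (intro add_mono mult_right_mono e operator_increment_bound[OF M e]) auto
  finally show ?thesis by (simp add: mult_ac)
qed

text \<open>The difference splits into the change of \<open>B\<close> on the old \<open>w\<close>,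
  the new \<open>B\<close> on the increment \<open>b\<close>, and the change of \<open>A\<close> on
  \<open>m\<close>. Each piece is linear in (k, m) and small with the increments.\<close>

lemma pointwise_derivative_increment_bound:
  assumes M: "norm (B x) \<le> M" and e: "norm (A (x + h) - A x - B x h) \<le> norm h * \<epsilon>"
    and e': "norm (B (x + h) - B x) \<le> \<epsilon>"
  shows "norm (B (x + h) k (w + b) + A (x + h) m - (B x k w + A x m))
    \<le> \<epsilon> * norm k * norm w + (M + \<epsilon>) * norm k * norm b + (M + \<epsilon>) * norm h * norm m"
proof -
  have B': "norm (B (x + h)) \<le> M + \<epsilon>"
    using norm_triangle_ineq[of "B (x + h) - B x" "B x"] M e' by simp
  have eq: "B (x + h) k (w + b) + A (x + h) m - (B x k w + A x m)
      = ((B (x + h) - B x) k w + B (x + h) k b) + (A (x + h) - A x) m"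
    by (simp add: blinfun.diff_left blinfun.add_right)
  have "norm (B (x + h) k (w + b) + A (x + h) m - (B x k w + A x m))
      \<le> (norm (B (x + h) - B x) * norm k * norm w + norm (B (x + h)) * norm k * norm b)
      + norm (A (x + h) - A x) * norm m"
    unfolding eq
    by (rule order_trans[OF norm_triangle_ineq add_mono[OF order_trans[OF norm_triangle_ineq
      add_mono[OF norm_blinfun2 norm_blinfun2]] norm_blinfun]])
  also have "\<dots> \<le> (\<epsilon> * norm k * norm w + (M + \<epsilon>) * norm k * norm b) + ((M + \<epsilon>) * norm h) * norm m"
    by (rule add_mono[OF add_mono[OF mult_right_mono[OF mult_right_mono[OF e']] mult_right_mono[OF mult_right_mono[OF B']]]
      mult_right_mono[OF operator_increment_bound[OF M e]]]) simp_all
  finally show ?thesis by simp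
qed

lemma strongly_measurable_fderiv_path:
  assumes "continuous_on UNIV f" "w \<in> L2"
  shows "strongly_measurable (\<lambda>s. A (f s) (w s))"
  by (rule strongly_measurable_blinfun_apply[OF strongly_measurable_continuous L2_strongly_measurable[OF assms(2)]])
     (rule continuous_on_compose2[OF C2_on_UNIV_D(3)[OF C2_\<phi>] assms(1) subset_UNIV])

lemma strongly_measurable_second_fderiv_path:
  assumes "continuous_on UNIV f" "continuous_on UNIV a" "w \<in> L2"
  shows "strongly_measurable (\<lambda>s. B (f s) (a s) (w s))"
  by (rule strongly_measurable_blinfun_apply[OF strongly_measurable_blinfun_apply[OF strongly_measurable_continuous
        strongly_measurable_continuous[OF assms(2)]] L2_strongly_measurable[OF assms(3)]])
     (rule continuous_on_compose2[OF C2_on_UNIV_D(4)[OF C2_\<phi>] assms(1) subset_UNIV])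

lemma strongly_measurable_restr_path:
  assumes "u \<in> L2" "c \<in> L2"
  shows "strongly_measurable (\<lambda>s. g (u s))" "strongly_measurable (\<lambda>s. fderiv g (u s) (c s))"
proof -
  have c: "continuous_on UNIV g"
    by (intro continuous_at_imp_continuous_on ballI has_derivative_continuous[OF C2_on_UNIV_D(1)[OF C2_g]])
  show "strongly_measurable (\<lambda>s. g (u s))"
    by (rule strongly_measurable_compose[OF L2_strongly_measurable[OF assms(1)] c])
  show "strongly_measurable (\<lambda>s. fderiv g (u s) (c s))"
    by (rule strongly_measurable_blinfun_apply[OF strongly_measurable_compose[OF L2_strongly_measurable[OF assms(1)]
        C2_on_UNIV_D(3)[OF C2_g]] L2_strongly_measurable[OF assms(2)]])
qed

section \<open>Estimates along curves\<close>

text \<open>Serves both components: \<open>w\<close> is either the derivative of the base curve or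
  the second component of the point, with \<open>b\<close> the matching part of the
  increment.\<close>

lemma derivative_path_bound:
  assumes f: "continuous_on UNIV f" and M: "M \<ge> 0" "\<And>s. norm (A (f s)) \<le> M" "\<And>s. norm (B (f s)) \<le> M"
    and a: "continuous_on UNIV a" "\<And>s. norm (a s) \<le> N" and w: "w \<in> L2" and b: "b \<in> L2"
  shows "(\<lambda>s. B (f s) (a s) (w s) + A (f s) (b s)) \<in> L2"
    and "L2_norm (\<lambda>s. B (f s) (a s) (w s) + A (f s) (b s)) \<le> 2 * (M * N * L2_norm w + M * L2_norm b)"
proof -
  have N: "N \<ge> 0" using a(2)[of 0] norm_ge_zero order_trans by blast
  have "norm (B (f s) (a s) (w s) + A (f s) (b s)) \<le> M * N * norm (w s) + M * norm (b s)" for s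
  proof -
    have "norm (B (f s) (a s) (w s) + A (f s) (b s)) \<le> M * norm (a s) * norm (w s) + M * norm (b s)"
      by (rule pointwise_derivative_bound[OF M(2,3)])
    also have "\<dots> \<le> M * N * norm (w s) + M * norm (b s)"
      using M(1) a(2) by (intro add_mono mult_right_mono mult_left_mono) auto
    finally show ?thesis .
  qed
  then have "AE s in lebesgue. norm (B (f s) (a s) (w s) + A (f s) (b s)) \<le> M * N * norm (w s) + M * norm (b s)" by simp
  note dom = L2_dominated2[OF strongly_measurable_add[OF strongly_measurable_second_fderiv_path[OF f a(1) w]
      strongly_measurable_fderiv_path[OF f b]] w b mult_nonneg_nonneg[OF M(1) N] M(1) this]
  show "(\<lambda>s. B (f s) (a s) (w s) + A (f s) (b s)) \<in> L2" by (rule dom(1))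
  show "L2_norm (\<lambda>s. B (f s) (a s) (w s) + A (f s) (b s)) \<le> 2 * (M * N * L2_norm w + M * L2_norm b)" by (rule dom(2))
qed

lemma fderiv_path_L2:
  assumes f: "continuous_on UNIV f" and M: "M \<ge> 0" "\<And>s. norm (A (f s)) \<le> M" and b: "b \<in> L2"
  shows "(\<lambda>s. A (f s) (b s)) \<in> L2"
proof -
  have "norm (A (f s) (b s)) \<le> M * norm (b s)" for s
    by (rule order_trans[OF norm_blinfun mult_right_mono[OF M(2)]]) simp
  then have "AE s in lebesgue. norm (A (f s) (b s)) \<le> M * norm (b s)" by simp
  then show ?thesis by (rule L2_dominated1(1)[OF strongly_measurable_fderiv_path[OF f b] b M(1)])
qed

lemma path_constants:
  assumes "W_data j f v u"
  shows "\<exists>K M. compact K \<and> range f \<subseteq> K \<and> (\<forall>x\<in>K. \<forall>t\<in>{0..1}. t *\<^sub>R x \<in> K) \<and> M \<ge> 0 \<and>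
    (\<forall>s. norm (A (f s)) \<le> M) \<and> (\<forall>s. norm (B (f s)) \<le> M)"
proof -
  note D = W_dataD[OF assms]
  obtain K where K: "compact K" "range f \<subseteq> K" "\<forall>x\<in>K. \<forall>t\<in>{0..1}. t *\<^sub>R x \<in> K"
    using ac_range_compact_starlike[OF D(1) W_data_L2(1)[OF assms j_norm] D(3,2)] by (elim exE conjE)
  obtain M1 where M1: "\<forall>x\<in>K. norm (A x) \<le> M1"
    using compact_continuous_bounded[OF K(1) C2_on_UNIV_D(3)[OF C2_\<phi>]] by (elim exE)
  obtain M2 where M2: "\<forall>x\<in>K. norm (B x) \<le> M2"
    using compact_continuous_bounded[OF K(1) C2_on_UNIV_D(4)[OF C2_\<phi>]] by (elim exE)
  define M where "M = max 0 (max M1 M2)"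
  have "norm (A (f s)) \<le> M" "norm (B (f s)) \<le> M" for s
  proof -
    have "f s \<in> K" using K(2) by auto
    then show "norm (A (f s)) \<le> M" "norm (B (f s)) \<le> M"
      using M1 M2 by (auto simp: M_def le_max_iff_disj)
  qed
  moreover have "M \<ge> 0" by (simp add: M_def)
  ultimately show ?thesis using K by (intro exI[of _ K] exI[of _ M]) simp
qed

text \<open>The lift stays in L2 because \<open>g\<close> grows at most linearly in the H2 norm over
  the compact set containing the curve.\<close>

lemma W_data_\<phi>:
  assumes W: "W_data j f v u"
  shows "W_data j (\<lambda>s. \<phi> (f s)) (\<lambda>s. A (f s) (v s)) (\<lambda>s. g (u s))"
  unfolding W_data_def
proof (intro conjI)
  note D = W_dataD[OF W]
  obtain K M where K: "compact K" "range f \<subseteq> K" "\<forall>x\<in>K. \<forall>t\<in>{0..1}. t *\<^sub>R x \<in> K" and M: "M \<ge> 0"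
    "\<And>s. norm (A (f s)) \<le> M" "\<And>s. norm (B (f s)) \<le> M" using path_constants[OF W] by blast
  obtain C where C: "C \<ge> 0" "\<And>y. j y \<in> K \<Longrightarrow> norm (g y) \<le> C * norm y"
    using H2_bounds[OF K(1,3)] by auto
  have c: "continuous_on UNIV \<phi>"
    by (intro continuous_at_imp_continuous_on ballI has_derivative_continuous[OF C2_on_UNIV_D(1)[OF C2_\<phi>]])
  show "continuous_on UNIV (\<lambda>s. \<phi> (f s))" by (rule continuous_on_compose2[OF c D(1) subset_UNIV])
  show "has_ac_derivative (\<lambda>s. \<phi> (f s)) (\<lambda>s. A (f s) (v s))"
    by (rule has_ac_derivative_compose[OF C2_\<phi> D(1,2,3)])
  show "(\<lambda>s. A (f s) (v s)) \<in> L2" by (rule fderiv_path_L2[OF D(1) M(1,2) D(3)])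
  have "AE s in lebesgue. norm (g (u s)) \<le> C * norm (u s)"
    using D(5)
  proof eventually_elim
    case (elim s)
    have "f s \<in> K" using K(2) by auto
    then show ?case using C(2)[of "u s"] elim by simp
  qed
  then show "(\<lambda>s. g (u s)) \<in> L2"
    by (rule L2_dominated1(1)[OF strongly_measurable_restr_path(1)[OF D(4,4)] D(4) C(1)])
  show "AE s in lebesgue. \<phi> (f s) = j (g (u s))"
    using D(5) by eventually_elim (simp add: j_g)
qed

lemma W_data_fderiv:
  assumes W: "W_data j f v u" and Wa: "W_data j a b c"
  shows "W_data j (\<lambda>s. A (f s) (a s)) (\<lambda>s. B (f s) (a s) (v s) + A (f s) (b s)) (\<lambda>s. fderiv g (u s) (c s))"
  unfolding W_data_def
proof (intro conjI)
  note D = W_dataD[OF W] and Da = W_dataD[OF Wa]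
  obtain K M where K: "compact K" "range f \<subseteq> K" "\<forall>x\<in>K. \<forall>t\<in>{0..1}. t *\<^sub>R x \<in> K" and M: "M \<ge> 0"
    "\<And>s. norm (A (f s)) \<le> M" "\<And>s. norm (B (f s)) \<le> M" using path_constants[OF W] by blast
  obtain C where C: "C \<ge> 0" "\<And>y u. j y \<in> K \<Longrightarrow> norm (fderiv g y u) \<le> C * norm u + C * norm y * norm (j u)"
    using H2_bounds[OF K(1,3)] by auto
  define N where "N = L2_norm c + L2_norm b"
  have N: "norm (a s) \<le> N" for s unfolding N_def by (rule W_data_norm_le[OF Wa j_norm])
  have N0: "N \<ge> 0" by (simp add: N_def)
  show "continuous_on UNIV (\<lambda>s. A (f s) (a s))"
    by (intro continuous_intros continuous_on_compose2[OF C2_on_UNIV_D(3)[OF C2_\<phi>] D(1)] Da(1) subset_UNIV)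
  \<comment> \<open>The chain rule puts the velocity in the first slot. Swapping it makes the
    expression the one estimated in \<open>derivative_path_bound\<close>, with bounded
    \<open>a\<close> and square integrable \<open>v\<close>.\<close>
  have eq: "B (f s) (a s) (v s) = B (f s) (v s) (a s)" for s by (rule second_fderiv_symmetric[OF C2_\<phi>])
  show "has_ac_derivative (\<lambda>s. A (f s) (a s)) (\<lambda>s. B (f s) (a s) (v s) + A (f s) (b s))"
    unfolding eq by (rule has_ac_derivative_fderiv_apply[OF C2_\<phi> D(1,2,3) Da(1,2,3)])
  show "(\<lambda>s. B (f s) (a s) (v s) + A (f s) (b s)) \<in> L2"
    by (rule derivative_path_bound(1)[OF D(1) M Da(1) N D(3) Da(3)])
  \<comment> \<open>The mixed term is square integrable since the H1 norm of \<open>a\<close> is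
    bounded by \<open>N\<close>, leaving only the H2 norm of \<open>u\<close>.\<close>
  have "AE s in lebesgue. norm (fderiv g (u s) (c s)) \<le> C * norm (c s) + C * N * norm (u s)"
    using D(5) Da(5)
  proof eventually_elim
    case (elim s)
    have "f s \<in> K" using K(2) by auto
    then have "norm (fderiv g (u s) (c s)) \<le> C * norm (c s) + C * norm (u s) * norm (a s)"
      using C(2)[of "u s" "c s"] elim by simp
    also have "\<dots> \<le> C * norm (c s) + C * norm (u s) * N"
      using N[of s] C(1) by (intro add_left_mono mult_left_mono) auto
    finally show ?case by (simp add: mult_ac)
  qed
  then show "(\<lambda>s. fderiv g (u s) (c s)) \<in> L2"
    by (rule L2_dominated2(1)[OF strongly_measurable_restr_path(2)[OF D(4) Da(4)] Da(4) D(4) C(1)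
        mult_nonneg_nonneg[OF C(1) N0]])
  show "AE s in lebesgue. A (f s) (a s) = j (fderiv g (u s) (c s))"
    using D(5) Da(5) by eventually_elim (simp add: j_fderiv_g)
qed

text \<open>With \<open>N\<close> and the norm of \<open>b\<close> of the size of the increment, the
  first term is \<epsilon> times that size and the second is quadratic in it.\<close>

lemma remainder_path_bound:
  assumes f: "continuous_on UNIV f" and M: "M \<ge> 0" "\<And>s. norm (B (f s)) \<le> M" and \<epsilon>: "\<epsilon> \<ge> 0"
    and e: "\<And>s h. norm h < d \<Longrightarrow> norm (A (f s + h) - A (f s) - B (f s) h) \<le> norm h * \<epsilon>"
    and a: "continuous_on UNIV a" "\<And>s. norm (a s) \<le> N" "N < d" and w: "w \<in> L2" and b: "b \<in> L2"
  shows "L2_norm (\<lambda>s. A (f s + a s) (w s + b s) - A (f s) (w s) - (B (f s) (a s) (w s) + A (f s) (b s)))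
    \<le> 2 * (\<epsilon> * N * L2_norm w + (M + \<epsilon>) * N * L2_norm b)"
proof -
  have N: "N \<ge> 0" using a(2)[of 0] norm_ge_zero order_trans by blast
  have fa: "continuous_on UNIV (\<lambda>s. f s + a s)" by (intro continuous_intros f a)
  have "norm (A (f s + a s) (w s + b s) - A (f s) (w s) - (B (f s) (a s) (w s) + A (f s) (b s)))
      \<le> \<epsilon> * N * norm (w s) + (M + \<epsilon>) * N * norm (b s)" for s
  proof -
    have "norm (a s) < d" using a(2)[of s] a(3) by linarith
    from pointwise_remainder_bound[OF M(2) e[OF this]]
    have "norm (A (f s + a s) (w s + b s) - A (f s) (w s) - (B (f s) (a s) (w s) + A (f s) (b s)))
      \<le> \<epsilon> * norm (a s) * norm (w s) + (M + \<epsilon>) * norm (a s) * norm (b s)" .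
    also have "\<dots> \<le> \<epsilon> * N * norm (w s) + (M + \<epsilon>) * N * norm (b s)"
      using M(1) \<epsilon> a(2)[of s] by (intro add_mono mult_right_mono mult_left_mono) auto
    finally show ?thesis .
  qed
  then have "AE s in lebesgue. norm (A (f s + a s) (w s + b s) - A (f s) (w s) - (B (f s) (a s) (w s) + A (f s) (b s)))
      \<le> \<epsilon> * N * norm (w s) + (M + \<epsilon>) * N * norm (b s)" by simp
  then show ?thesis
    using M(1) N \<epsilon>
    by (intro L2_dominated2(2)[OF _ w b] strongly_measurable_diff
        strongly_measurable_add[OF strongly_measurable_second_fderiv_path[OF f a(1) w] strongly_measurable_fderiv_path[OF f b]]
        strongly_measurable_fderiv_path[OF f w] strongly_measurable_fderiv_path[OF fa L2_add[OF w b]]) auto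
qed

text \<open>Each term is linear in the size of the direction, given by \<open>N'\<close> and
  \<open>m\<close>, with a coefficient that is either \<epsilon> or proportional to the size of the
  increment. This gives convergence in operator norm.\<close>

lemma derivative_increment_path_bound:
  assumes f: "continuous_on UNIV f" and M: "M \<ge> 0" "\<And>s. norm (B (f s)) \<le> M" and \<epsilon>: "\<epsilon> \<ge> 0"
    and e: "\<And>s h. norm h < d \<Longrightarrow> norm (A (f s + h) - A (f s) - B (f s) h) \<le> norm h * \<epsilon>"
      "\<And>s h. norm h < d \<Longrightarrow> norm (B (f s + h) - B (f s)) \<le> \<epsilon>"
    and a: "continuous_on UNIV a" "\<And>s. norm (a s) \<le> N" "N < d" and w: "w \<in> L2" and b: "b \<in> L2"
    and k: "continuous_on UNIV k" "\<And>s. norm (k s) \<le> N'" and m: "m \<in> L2"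
  shows "L2_norm (\<lambda>s. B (f s + a s) (k s) (w s + b s) + A (f s + a s) (m s) - (B (f s) (k s) (w s) + A (f s) (m s)))
    \<le> 2 * (\<epsilon> * N' * L2_norm w + (M + \<epsilon>) * N' * L2_norm b + (M + \<epsilon>) * N * L2_norm m)"
proof -
  have N: "N \<ge> 0" using a(2)[of 0] norm_ge_zero order_trans by blast
  have N': "N' \<ge> 0" using k(2)[of 0] norm_ge_zero order_trans by blast
  have fa: "continuous_on UNIV (\<lambda>s. f s + a s)" by (intro continuous_intros f a)
  have "norm (B (f s + a s) (k s) (w s + b s) + A (f s + a s) (m s) - (B (f s) (k s) (w s) + A (f s) (m s)))
      \<le> \<epsilon> * N' * norm (w s) + (M + \<epsilon>) * N' * norm (b s) + (M + \<epsilon>) * N * norm (m s)" for s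
  proof -
    have "norm (a s) < d" using a(2)[of s] a(3) by linarith
    from pointwise_derivative_increment_bound[OF M(2) e(1)[OF this] e(2)[OF this]]
    have "norm (B (f s + a s) (k s) (w s + b s) + A (f s + a s) (m s) - (B (f s) (k s) (w s) + A (f s) (m s)))
      \<le> \<epsilon> * norm (k s) * norm (w s) + (M + \<epsilon>) * norm (k s) * norm (b s) + (M + \<epsilon>) * norm (a s) * norm (m s)" .
    also have "\<dots> \<le> \<epsilon> * N' * norm (w s) + (M + \<epsilon>) * N' * norm (b s) + (M + \<epsilon>) * N * norm (m s)"
      using M(1) \<epsilon> a(2)[of s] k(2)[of s] by (intro add_mono mult_right_mono mult_left_mono) auto
    finally show ?thesis .
  qed
  then have "AE s in lebesgue. norm (B (f s + a s) (k s) (w s + b s) + A (f s + a s) (m s) - (B (f s) (k s) (w s) + A (f s) (m s)))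
      \<le> \<epsilon> * N' * norm (w s) + (M + \<epsilon>) * N' * norm (b s) + (M + \<epsilon>) * N * norm (m s)" by simp
  then show ?thesis
    using M(1) N N' \<epsilon>
    by (intro L2_dominated(2)[OF _ w b m] strongly_measurable_diff
        strongly_measurable_add[OF strongly_measurable_second_fderiv_path[OF f k(1) w] strongly_measurable_fderiv_path[OF f m]]
        strongly_measurable_add[OF strongly_measurable_second_fderiv_path[OF fa k(1) L2_add[OF w b]] strongly_measurable_fderiv_path[OF fa m]]) auto
qed

end

section \<open>The tangent map\<close>

lemma sqrt_sum_squares_le3:
  fixes x y z :: real
  assumes "x \<ge> 0" "y \<ge> 0" "z \<ge> 0"
  shows "sqrt (x\<^sup>2 + y\<^sup>2 + z\<^sup>2) \<le> x + y + z"
proof (rule real_le_lsqrt)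
  have "0 \<le> x * y" "0 \<le> x * z" "0 \<le> y * z" using assms by auto
  then show "x\<^sup>2 + y\<^sup>2 + z\<^sup>2 \<le> (x + y + z)\<^sup>2" by (simp add: power2_eq_square algebra_simps)
qed (use assms in auto)

text \<open>The threshold in the estimate depends on \<epsilon>, so \<epsilon> is fixed first and
  \<delta> is then shrunk to make the linear term small; each gets half of \<open>e\<close>.
  Restricting to \<epsilon> \<le> 1 lets \<open>S\<close> and \<open>T\<close> be independent of
  \<epsilon>.\<close>

lemma small_of_affine_bound:
  fixes P :: "real \<Rightarrow> real \<Rightarrow> bool"
  assumes S: "S \<ge> 0" and T: "T \<ge> 0"
    and est: "\<And>\<epsilon>. 0 < \<epsilon> \<Longrightarrow> \<epsilon> \<le> 1 \<Longrightarrow> \<exists>\<delta>>0. \<forall>x. 0 \<le> x \<longrightarrow> x < \<delta> \<longrightarrow> P x (\<epsilon> * S + x * T)"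
    and mono: "\<And>x c c'. P x c \<Longrightarrow> c \<le> c' \<Longrightarrow> P x c'"
    and e: "e > 0"
  shows "\<exists>\<delta>>0. \<forall>x. 0 \<le> x \<longrightarrow> x < \<delta> \<longrightarrow> P x e"
proof -
  \<comment> \<open>The added 1 avoids division by zero when \<open>S\<close> vanishes; likewise for
    \<open>T\<close> below.\<close>
  define \<epsilon> where "\<epsilon> = min 1 (e / (2 * (S + 1)))"
  have \<epsilon>: "0 < \<epsilon>" "\<epsilon> \<le> 1" "\<epsilon> \<le> e / (2 * (S + 1))" using S e by (auto simp: \<epsilon>_def)
  obtain \<delta> where \<delta>: "\<delta> > 0" "\<And>x. 0 \<le> x \<Longrightarrow> x < \<delta> \<Longrightarrow> P x (\<epsilon> * S + x * T)" using est[OF \<epsilon>(1,2)] by auto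
  define \<delta>' where "\<delta>' = min \<delta> (e / (2 * (T + 1)))"
  have "\<delta>' > 0" using \<delta>(1) T e by (simp add: \<delta>'_def)
  moreover have "P x e" if x: "0 \<le> x" "x < \<delta>'" for x
  proof (rule mono[OF \<delta>(2)])
    show "0 \<le> x" "x < \<delta>" using x by (auto simp: \<delta>'_def)
    have "\<epsilon> * S \<le> \<epsilon> * (S + 1)" using \<epsilon>(1) by (intro mult_left_mono) auto
    also have "\<dots> \<le> (e / (2 * (S + 1))) * (S + 1)" using S \<epsilon>(3) by (intro mult_right_mono) auto
    also have "\<dots> = e / 2" using S by (simp add: field_simps)
    finally have 1: "\<epsilon> * S \<le> e / 2" .
    have "x * T \<le> x * (T + 1)" using x(1) by (intro mult_left_mono) auto
    also have "\<dots> \<le> (e / (2 * (T + 1))) * (T + 1)" using T x(2) by (intro mult_right_mono) (auto simp: \<delta>'_def)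
    also have "\<dots> = e / 2" using T by (simp add: field_simps)
    finally show "\<epsilon> * S + x * T \<le> e" using 1 by linarith
  qed
  ultimately show ?thesis by blast
qed

context tame_on_Hilbert_pair
begin

lemma E_norm_le:
  assumes "W_data j f v u"
  shows "E_norm j (f, w) \<le> L2_norm v + L2_norm u + L2_norm w"
proof -
  have "(W_norm j f)\<^sup>2 = (L2_norm v)\<^sup>2 + (L2_norm u)\<^sup>2"
    unfolding W_data_imp_W_space(2)[OF assms j_inj j_norm] by simp
  then have "E_norm j (f, w) = sqrt ((L2_norm v)\<^sup>2 + (L2_norm u)\<^sup>2 + (L2_norm w)\<^sup>2)"
    by (simp add: E_norm_def)
  also have "\<dots> \<le> L2_norm v + L2_norm u + L2_norm w" by (rule sqrt_sum_squares_le3) auto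
  finally show ?thesis .
qed

lemma E_space_data:
  assumes "z \<in> E_space j"
  shows "\<exists>v u. W_data j (fst z) v u \<and> snd z \<in> L2 \<and> L2_norm v \<le> E_norm j z \<and> L2_norm u \<le> E_norm j z \<and>
    L2_norm (snd z) \<le> E_norm j z"
proof (intro exI conjI)
  let ?f = "fst z"
  have f: "?f \<in> W_space j" and w: "snd z \<in> L2" using assms by (auto simp: E_space_def)
  show "W_data j ?f (weak_deriv ?f) (\<lambda>s. inv j (?f s))" by (rule W_space_data[OF f])
  show "snd z \<in> L2" by (rule w)
  have E: "E_norm j z = sqrt ((L2_norm (weak_deriv ?f))\<^sup>2 + (L2_norm (\<lambda>s. inv j (?f s)))\<^sup>2 + (L2_norm (snd z))\<^sup>2)"
    unfolding E_norm_def W_norm_eq by simp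
  show "L2_norm (weak_deriv ?f) \<le> E_norm j z" "L2_norm (\<lambda>s. inv j (?f s)) \<le> E_norm j z" "L2_norm (snd z) \<le> E_norm j z"
    unfolding E by (auto intro!: real_le_rsqrt)
qed

lemma E_norm_nonneg: "E_norm j z \<ge> 0"
  by (simp add: E_norm_def)

text \<open>All terms are at least quadratic in the increment: each has a factor \<open>N\<close>
  together with the norm of \<open>c\<close>, or two factors \<open>N\<close> on the fixed
  \<open>u\<close>.\<close>

lemma restr_remainder_path_bound:
  assumes W: "W_data j f v u" "W_data j a b c" and K: "range f \<subseteq> K" and C: "C \<ge> 0"
    and bound: "\<And>y x. j y \<in> K \<Longrightarrow> norm (j x) < r \<Longrightarrow> norm (g (y + x) - g y - fderiv g y x)
        \<le> C * (2 * norm (j x) * norm x + (norm y + norm x) * norm (j x) * norm (j x))"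
    and a: "\<And>s. norm (a s) \<le> N" "N < r"
  shows "L2_norm (\<lambda>s. g (u s + c s) - g (u s) - fderiv g (u s) (c s))
    \<le> 2 * ((2 * C * N + C * N * N) * L2_norm c + C * N * N * L2_norm u)"
proof -
  note D = W_dataD[OF W(1)] and Da = W_dataD[OF W(2)]
  have N: "N \<ge> 0" using a(1)[of 0] norm_ge_zero order_trans by blast
  have "AE s in lebesgue. norm (g (u s + c s) - g (u s) - fderiv g (u s) (c s))
      \<le> (2 * C * N + C * N * N) * norm (c s) + C * N * N * norm (u s)"
    using D(5) Da(5)
  proof eventually_elim
    case (elim s)
    have "j (u s) \<in> K" using K elim(1) by (metis rangeI subsetD)
    moreover have ja: "norm (j (c s)) \<le> N" using a(1)[of s] elim(2) by simp
    ultimately have "norm (g (u s + c s) - g (u s) - fderiv g (u s) (c s))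
        \<le> C * (2 * norm (j (c s)) * norm (c s) + (norm (u s) + norm (c s)) * norm (j (c s)) * norm (j (c s)))"
      using a(2) by (intro bound) auto
    also have "\<dots> \<le> C * (2 * N * norm (c s) + (norm (u s) + norm (c s)) * N * N)"
      using ja C N by (intro mult_left_mono add_mono mult_mono) auto
    finally show ?case by (simp add: algebra_simps)
  qed
  moreover have "strongly_measurable (\<lambda>s. g (u s + c s) - g (u s) - fderiv g (u s) (c s))"
    by (rule strongly_measurable_diff[OF strongly_measurable_diff[OF
        strongly_measurable_restr_path(1)[OF L2_add[OF D(4) Da(4)] D(4)] strongly_measurable_restr_path(1)[OF D(4,4)]]
        strongly_measurable_restr_path(2)[OF D(4) Da(4)]])
  ultimately show ?thesis
    using L2_dominated2(2)[OF _ Da(4) D(4), of _ "2 * C * N + C * N * N" "C * N * N"] C N by simp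
qed

text \<open>Each term has one factor from the direction, \<open>N'\<close> or \<open>m\<close>, and
  at least one from the increment, \<open>N\<close> or \<open>c\<close>.\<close>

lemma restr_derivative_increment_path_bound:
  assumes W: "W_data j f v u" "W_data j a b c" "W_data j k l m" and K: "range f \<subseteq> K" and C: "C \<ge> 0"
    and bound: "\<And>y x z. j y \<in> K \<Longrightarrow> norm (j x) < r \<Longrightarrow> norm (fderiv g (y + x) z - fderiv g y z)
        \<le> C * (norm (j x) * norm z + norm x * norm (j z) + (norm y + norm x) * norm (j x) * norm (j z))"
    and a: "\<And>s. norm (a s) \<le> N" "N < r" and k: "\<And>s. norm (k s) \<le> N'"
  shows "L2_norm (\<lambda>s. fderiv g (u s + c s) (m s) - fderiv g (u s) (m s))
    \<le> 2 * (C * N * L2_norm m + (C * N' + C * N * N') * L2_norm c + C * N * N' * L2_norm u)"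
proof -
  note D = W_dataD[OF W(1)] and Da = W_dataD[OF W(2)] and Dk = W_dataD[OF W(3)]
  have N: "N \<ge> 0" using a(1)[of 0] norm_ge_zero order_trans by blast
  have N': "N' \<ge> 0" using k[of 0] norm_ge_zero order_trans by blast
  have "AE s in lebesgue. norm (fderiv g (u s + c s) (m s) - fderiv g (u s) (m s))
      \<le> C * N * norm (m s) + (C * N' + C * N * N') * norm (c s) + C * N * N' * norm (u s)"
    using D(5) Da(5) Dk(5)
  proof eventually_elim
    case (elim s)
    have "j (u s) \<in> K" using K elim(1) by (metis rangeI subsetD)
    moreover have ja: "norm (j (c s)) \<le> N" using a(1)[of s] elim(2) by simp
    moreover have jk: "norm (j (m s)) \<le> N'" using k[of s] elim(3) by simp
    ultimately have "norm (fderiv g (u s + c s) (m s) - fderiv g (u s) (m s))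
        \<le> C * (norm (j (c s)) * norm (m s) + norm (c s) * norm (j (m s)) + (norm (u s) + norm (c s)) * norm (j (c s)) * norm (j (m s)))"
      using a(2) by (intro bound) auto
    also have "\<dots> \<le> C * (N * norm (m s) + norm (c s) * N' + (norm (u s) + norm (c s)) * N * N')"
      using ja jk C N by (intro mult_left_mono add_mono mult_mono) auto
    finally show ?case by (simp add: algebra_simps)
  qed
  moreover have "strongly_measurable (\<lambda>s. fderiv g (u s + c s) (m s) - fderiv g (u s) (m s))"
    by (rule strongly_measurable_diff[OF strongly_measurable_restr_path(2)[OF L2_add[OF D(4) Da(4)] Dk(4)]
        strongly_measurable_restr_path(2)[OF D(4) Dk(4)]])
  ultimately show ?thesis
    using L2_dominated(2)[OF _ Dk(4) Da(4) D(4), of _ "C * N" "C * N' + C * N * N'" "C * N * N'"] C N N' by simp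
qed

definition tangent_deriv ::
    "(real \<Rightarrow> 'a) \<times> (real \<Rightarrow> 'a) \<Rightarrow> (real \<Rightarrow> 'a) \<times> (real \<Rightarrow> 'a) \<Rightarrow> (real \<Rightarrow> 'a) \<times> (real \<Rightarrow> 'a)" where
  "tangent_deriv z h = ((\<lambda>s. A (fst z s) (fst h s)),
     (\<lambda>s. B (fst z s) (fst h s) (snd z s) + A (fst z s) (snd h s)))"

lemma tangent_map_in_E_space:
  assumes "z \<in> E_space j"
  shows "tangent_map \<phi> z \<in> E_space j"
proof -
  obtain v u where W: "W_data j (fst z) v u" and w: "snd z \<in> L2" using E_space_data[OF assms] by blast
  obtain M where M: "M \<ge> 0" "\<And>s. norm (A (fst z s)) \<le> M" using path_constants[OF W] by blast
  have "(\<lambda>s. \<phi> (fst z s)) \<in> W_space j" by (rule W_data_imp_W_space(1)[OF W_data_\<phi>[OF W] j_inj j_norm])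
  moreover have "(\<lambda>s. A (fst z s) (snd z s)) \<in> L2" by (rule fderiv_path_L2[OF W_dataD(1)[OF W] M w])
  ultimately show ?thesis by (simp add: E_space_def tangent_map_def case_prod_unfold o_def)
qed

lemma bounded_linear_tangent_deriv:
  assumes z: "z \<in> E_space j"
  shows "bounded_linear_between (E_space j) (E_norm j) (E_space j) (E_norm j) (tangent_deriv z)"
proof -
  obtain v u where W: "W_data j (fst z) v u" and w: "snd z \<in> L2" using E_space_data[OF z] by blast
  note D = W_dataD[OF W]
  obtain K M where K: "compact K" "range (fst z) \<subseteq> K" "\<forall>x\<in>K. \<forall>t\<in>{0..1}. t *\<^sub>R x \<in> K" and M: "M \<ge> 0"
    "\<And>s. norm (A (fst z s)) \<le> M" "\<And>s. norm (B (fst z s)) \<le> M" using path_constants[OF W] by blast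
  obtain C where C: "C \<ge> 0" "\<And>y u. j y \<in> K \<Longrightarrow> norm (fderiv g y u) \<le> C * norm u + C * norm y * norm (j u)"
    using H2_bounds[OF K(1,3)] by auto
  \<comment> \<open>The three summands bound the weak derivative, the lift to H2 and the second
    component, per unit norm of \<open>h\<close>.\<close>
  define Q where "Q = 2 * (M * 2 * L2_norm v + M) + 2 * (C + C * 2 * L2_norm u) + 2 * (M * 2 * L2_norm (snd z) + M)"
  have est: "tangent_deriv z h \<in> E_space j \<and> E_norm j (tangent_deriv z h) \<le> Q * E_norm j h" if h: "h \<in> E_space j" for h
  proof -
    obtain b c where Wa: "W_data j (fst h) b c" and m: "snd h \<in> L2" and le: "L2_norm b \<le> E_norm j h"
        "L2_norm c \<le> E_norm j h" "L2_norm (snd h) \<le> E_norm j h"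
      using E_space_data[OF h] by blast
    note Da = W_dataD[OF Wa]
    let ?p = "E_norm j h"
    have p: "?p \<ge> 0" by (rule E_norm_nonneg)
    \<comment> \<open>The supremum bound is a sum of two L2 norms, each at most the full norm; this
      is the source of the factors 2 in the coefficients.\<close>
    have N: "norm (fst h s) \<le> 2 * ?p" for s
      using W_data_norm_le[OF Wa j_norm, of s] le by linarith
    note W1 = W_data_fderiv[OF W Wa]
    have 1: "L2_norm (\<lambda>s. B (fst z s) (fst h s) (v s) + A (fst z s) (b s)) \<le> 2 * (M * (2 * ?p) * L2_norm v + M * L2_norm b)"
      by (rule derivative_path_bound(2)[OF D(1) M Da(1) N D(3) Da(3)])
    have 2: "(\<lambda>s. B (fst z s) (fst h s) (snd z s) + A (fst z s) (snd h s)) \<in> L2"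
      "L2_norm (\<lambda>s. B (fst z s) (fst h s) (snd z s) + A (fst z s) (snd h s)) \<le> 2 * (M * (2 * ?p) * L2_norm (snd z) + M * L2_norm (snd h))"
      by (rule derivative_path_bound[OF D(1) M Da(1) N w m])+
    have "AE s in lebesgue. norm (fderiv g (u s) (c s)) \<le> C * norm (c s) + C * (2 * ?p) * norm (u s)"
      using D(5) Da(5)
    proof eventually_elim
      case (elim s)
      have "fst z s \<in> K" using K(2) by auto
      then have "norm (fderiv g (u s) (c s)) \<le> C * norm (c s) + C * norm (u s) * norm (fst h s)"
        using C(2)[of "u s" "c s"] elim by simp
      also have "\<dots> \<le> C * norm (c s) + C * norm (u s) * (2 * ?p)"
        using N[of s] C(1) by (intro add_left_mono mult_left_mono) auto
      finally show ?case by (simp add: mult_ac)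
    qed
    then have 3: "L2_norm (\<lambda>s. fderiv g (u s) (c s)) \<le> 2 * (C * L2_norm c + C * (2 * ?p) * L2_norm u)"
      using C(1) p by (intro L2_dominated2(2)[OF strongly_measurable_restr_path(2)[OF D(4) Da(4)] Da(4) D(4)]) auto
    have "E_norm j (tangent_deriv z h) \<le> 2 * (M * (2 * ?p) * L2_norm v + M * L2_norm b)
        + 2 * (C * L2_norm c + C * (2 * ?p) * L2_norm u) + 2 * (M * (2 * ?p) * L2_norm (snd z) + M * L2_norm (snd h))"
      unfolding tangent_deriv_def using E_norm_le[OF W1] 1 2(2) 3
      by (meson add_mono order_trans)
    also have "\<dots> \<le> 2 * (M * (2 * ?p) * L2_norm v + M * ?p)
        + 2 * (C * ?p + C * (2 * ?p) * L2_norm u) + 2 * (M * (2 * ?p) * L2_norm (snd z) + M * ?p)"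
      using le M(1) C(1) by (intro add_mono mult_left_mono order_refl) auto
    also have "\<dots> = Q * ?p" by (simp add: Q_def algebra_simps)
    finally have "E_norm j (tangent_deriv z h) \<le> Q * ?p" .
    moreover have "tangent_deriv z h \<in> E_space j"
      using W_data_imp_W_space(1)[OF W1 j_inj j_norm] 2(1) by (simp add: E_space_def tangent_deriv_def)
    ultimately show ?thesis by simp
  qed
  show ?thesis
    unfolding bounded_linear_between_def
  proof (intro conjI ballI allI)
    show "tangent_deriv z x \<in> E_space j" if "x \<in> E_space j" for x using est[OF that] by simp
    show "tangent_deriv z (x + y) = tangent_deriv z x + tangent_deriv z y" for x y
      by (simp add: tangent_deriv_def fun_eq_iff blinfun.add_left blinfun.add_right)
    show "tangent_deriv z (r *\<^sub>R x) = r *\<^sub>R tangent_deriv z x" for r x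
      by (simp add: tangent_deriv_def fun_eq_iff scaleR_fun_def blinfun.scaleR_left blinfun.scaleR_right scaleR_add_right)
    show "\<exists>Q. \<forall>x\<in>E_space j. E_norm j (tangent_deriv z x) \<le> Q * E_norm j x" using est by blast
  qed
qed

lemma tangent_map_remainder:
  assumes z: "z \<in> E_space j" and e: "e > 0"
  shows "\<exists>\<delta>>0. \<forall>h\<in>E_space j. E_norm j h < \<delta> \<longrightarrow>
    E_norm j (tangent_map \<phi> (z + h) - tangent_map \<phi> z - tangent_deriv z h) \<le> e * E_norm j h"
proof -
  obtain v u where W: "W_data j (fst z) v u" and w: "snd z \<in> L2" using E_space_data[OF z] by blast
  note D = W_dataD[OF W]
  obtain K M where K: "compact K" "range (fst z) \<subseteq> K" "\<forall>x\<in>K. \<forall>t\<in>{0..1}. t *\<^sub>R x \<in> K" and M: "M \<ge> 0"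
    "\<And>s. norm (A (fst z s)) \<le> M" "\<And>s. norm (B (fst z s)) \<le> M" using path_constants[OF W] by blast
  obtain C r where C: "C \<ge> 0" "r > 0" "\<And>y x. j y \<in> K \<Longrightarrow> norm (j x) < r \<Longrightarrow> norm (g (y + x) - g y - fderiv g y x)
        \<le> C * (2 * norm (j x) * norm x + (norm y + norm x) * norm (j x) * norm (j x))"
    using H2_bounds[OF K(1,3)] by auto
  \<comment> \<open>\<open>S\<close> collects the coefficients of \<epsilon> and \<open>T\<close>
    those of the quadratic terms, both after one factor of the norm of \<open>h\<close> is taken
    out.\<close>
  define S where "S = 4 * L2_norm v + 4 * L2_norm (snd z)"
  define T where "T = 8 * (M + 1) + 16 * C + 8 * C * L2_norm u"
  \<comment> \<open>Quantifying over all increments of a given norm reduces smallness to a statement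
    about one real variable.\<close>
  define P where "P x c \<longleftrightarrow> (\<forall>h\<in>E_space j. E_norm j h = x \<longrightarrow>
    E_norm j (tangent_map \<phi> (z + h) - tangent_map \<phi> z - tangent_deriv z h) \<le> c * E_norm j h)" for x c
  have "\<exists>\<delta>>0. \<forall>x. 0 \<le> x \<longrightarrow> x < \<delta> \<longrightarrow> P x e"
  proof (rule small_of_affine_bound[where P=P, OF _ _ _ _ e])
    show "S \<ge> 0" by (simp add: S_def)
    show "T \<ge> 0" using M(1) C(1) by (simp add: T_def)
    show "P x c'" if "P x c" "c \<le> c'" for x c c'
      using that unfolding P_def by (meson E_norm_nonneg mult_right_mono order_trans)
    fix \<epsilon> :: real assume \<epsilon>: "0 < \<epsilon>" "\<epsilon> \<le> 1"
    obtain d where d: "d > 0" "\<forall>x\<in>K. \<forall>h. norm h < d \<longrightarrow> norm (B (x + h) - B x) \<le> \<epsilon> \<and> norm (A (x + h) - A x - B x h) \<le> norm h * \<epsilon>"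
      using C2_near_compact[OF C2_\<phi> K(1) \<epsilon>(1)] by auto
    have e1: "norm (A (fst z s + h) - A (fst z s) - B (fst z s) h) \<le> norm h * \<epsilon>" if "norm h < d" for s h
      using d(2) that K(2) by auto
    \<comment> \<open>The halves ensure that the supremum bound 2x stays below \<open>d\<close> and
      \<open>r\<close>; the 1 serves to reduce a cubic term to a quadratic one.\<close>
    define \<delta> where "\<delta> = min 1 (min (d / 2) (r / 2))"
    have "P x (\<epsilon> * S + x * T)" if x: "0 \<le> x" "x < \<delta>" for x
      unfolding P_def
    proof (intro ballI impI)
      fix h assume h: "h \<in> E_space j" and hx: "E_norm j h = x"
      obtain b c where Wa: "W_data j (fst h) b c" and m: "snd h \<in> L2" and le: "L2_norm b \<le> x" "L2_norm c \<le> x" "L2_norm (snd h) \<le> x"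
        using E_space_data[OF h] unfolding hx by blast
      note Da = W_dataD[OF Wa]
      have N: "norm (fst h s) \<le> 2 * x" for s using W_data_norm_le[OF Wa j_norm, of s] le by linarith
      have Nd: "2 * x < d" "2 * x < r" "x \<le> 1" using x by (auto simp: \<delta>_def)
      have W1: "W_data j (\<lambda>s. \<phi> (fst z s + fst h s) - \<phi> (fst z s) - A (fst z s) (fst h s))
          (\<lambda>s. A (fst z s + fst h s) (v s + b s) - A (fst z s) (v s) - (B (fst z s) (fst h s) (v s) + A (fst z s) (b s)))
          (\<lambda>s. g (u s + c s) - g (u s) - fderiv g (u s) (c s))"
        by (rule W_data_diff[OF j_linear W_data_diff[OF j_linear W_data_\<phi>[OF W_data_add[OF j_linear W Wa]] W_data_\<phi>[OF W]]
            W_data_fderiv[OF W Wa]])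
      have 1: "L2_norm (\<lambda>s. A (fst z s + fst h s) (v s + b s) - A (fst z s) (v s) - (B (fst z s) (fst h s) (v s) + A (fst z s) (b s)))
          \<le> 2 * (\<epsilon> * (2 * x) * L2_norm v + (M + \<epsilon>) * (2 * x) * L2_norm b)"
        by (rule remainder_path_bound[OF D(1) M(1,3) less_imp_le[OF \<epsilon>(1)] e1 Da(1) N Nd(1) D(3) Da(3)])
      have 2: "L2_norm (\<lambda>s. A (fst z s + fst h s) (snd z s + snd h s) - A (fst z s) (snd z s) - (B (fst z s) (fst h s) (snd z s) + A (fst z s) (snd h s)))
          \<le> 2 * (\<epsilon> * (2 * x) * L2_norm (snd z) + (M + \<epsilon>) * (2 * x) * L2_norm (snd h))"
        by (rule remainder_path_bound[OF D(1) M(1,3) less_imp_le[OF \<epsilon>(1)] e1 Da(1) N Nd(1) w m])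
      have 3: "L2_norm (\<lambda>s. g (u s + c s) - g (u s) - fderiv g (u s) (c s))
          \<le> 2 * ((2 * C * (2 * x) + C * (2 * x) * (2 * x)) * L2_norm c + C * (2 * x) * (2 * x) * L2_norm u)"
        by (rule restr_remainder_path_bound[OF W Wa K(2) C(1,3) N Nd(2)])
      have eq: "tangent_map \<phi> (z + h) - tangent_map \<phi> z - tangent_deriv z h =
        ((\<lambda>s. \<phi> (fst z s + fst h s) - \<phi> (fst z s) - A (fst z s) (fst h s)),
         (\<lambda>s. A (fst z s + fst h s) (snd z s + snd h s) - A (fst z s) (snd z s) - (B (fst z s) (fst h s) (snd z s) + A (fst z s) (snd h s))))"
        by (simp add: tangent_map_def tangent_deriv_def case_prod_unfold fun_eq_iff)
      have "E_norm j (tangent_map \<phi> (z + h) - tangent_map \<phi> z - tangent_deriv z h) \<le>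
          2 * (\<epsilon> * (2 * x) * L2_norm v + (M + \<epsilon>) * (2 * x) * L2_norm b)
          + 2 * ((2 * C * (2 * x) + C * (2 * x) * (2 * x)) * L2_norm c + C * (2 * x) * (2 * x) * L2_norm u)
          + 2 * (\<epsilon> * (2 * x) * L2_norm (snd z) + (M + \<epsilon>) * (2 * x) * L2_norm (snd h))"
        unfolding eq using E_norm_le[OF W1] 1 2 3 by (meson add_mono order_trans)
      \<comment> \<open>One factor x of the cubic term is replaced by 1, and \<epsilon> in M +
        \<epsilon> by 1, to fit the affine form.\<close>
      also have "\<dots> \<le> 2 * (\<epsilon> * (2 * x) * L2_norm v + (M + 1) * (2 * x) * x)
          + 2 * ((2 * C * (2 * x) + C * (2 * x) * (2 * 1)) * x + C * (2 * x) * (2 * x) * L2_norm u)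
          + 2 * (\<epsilon> * (2 * x) * L2_norm (snd z) + (M + 1) * (2 * x) * x)"
        using le M(1) C(1) \<epsilon> x(1) Nd(3) by (intro add_mono mult_left_mono mult_mono order_refl) auto
      also have "\<dots> = (\<epsilon> * S + x * T) * x" by (simp add: S_def T_def algebra_simps)
      finally show "E_norm j (tangent_map \<phi> (z + h) - tangent_map \<phi> z - tangent_deriv z h) \<le> (\<epsilon> * S + x * T) * E_norm j h"
        unfolding hx .
    qed
    moreover have "\<delta> > 0" using d(1) C(2) by (simp add: \<delta>_def)
    ultimately show "\<exists>\<delta>>0. \<forall>x. 0 \<le> x \<longrightarrow> x < \<delta> \<longrightarrow> P x (\<epsilon> * S + x * T)" by blast
  qed
  then show ?thesis unfolding P_def using E_norm_nonneg by blast
qed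

text \<open>The radii \<open>d\<close> and \<open>r\<close> are chosen before the direction
  \<open>k\<close>, and the estimates are linear in its norm \<open>y\<close>, so convergence is
  uniform over directions.\<close>

lemma tangent_deriv_continuous:
  assumes z: "z \<in> E_space j" and e: "e > 0"
  shows "\<exists>\<delta>>0. \<forall>h\<in>E_space j. E_norm j h < \<delta> \<longrightarrow>
    (\<forall>k\<in>E_space j. E_norm j (tangent_deriv (z + h) k - tangent_deriv z k) \<le> e * E_norm j k)"
proof -
  obtain v u where W: "W_data j (fst z) v u" and w: "snd z \<in> L2" using E_space_data[OF z] by blast
  note D = W_dataD[OF W]
  obtain K M where K: "compact K" "range (fst z) \<subseteq> K" "\<forall>x\<in>K. \<forall>t\<in>{0..1}. t *\<^sub>R x \<in> K" and M: "M \<ge> 0"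
    "\<And>s. norm (A (fst z s)) \<le> M" "\<And>s. norm (B (fst z s)) \<le> M" using path_constants[OF W] by blast
  obtain C r where C: "C \<ge> 0" "r > 0" "\<And>y x u. j y \<in> K \<Longrightarrow> norm (j x) < r \<Longrightarrow> norm (fderiv g (y + x) u - fderiv g y u)
        \<le> C * (norm (j x) * norm u + norm x * norm (j u) + (norm y + norm x) * norm (j x) * norm (j u))"
    using H2_bounds[OF K(1,3)] by auto
  \<comment> \<open>As for the remainder, with one factor of the norm of \<open>k\<close> taken out.
    The coefficient of M + 1 doubles since both the increment and the direction now contribute such
    a term in each component.\<close>
  define S where "S = 4 * L2_norm v + 4 * L2_norm (snd z)"
  define T where "T = 16 * (M + 1) + 16 * C + 8 * C * L2_norm u"
  define P where "P x c \<longleftrightarrow> (\<forall>h\<in>E_space j. E_norm j h = x \<longrightarrow>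
    (\<forall>k\<in>E_space j. E_norm j (tangent_deriv (z + h) k - tangent_deriv z k) \<le> c * E_norm j k))" for x c
  have "\<exists>\<delta>>0. \<forall>x. 0 \<le> x \<longrightarrow> x < \<delta> \<longrightarrow> P x e"
  proof (rule small_of_affine_bound[where P=P, OF _ _ _ _ e])
    show "S \<ge> 0" by (simp add: S_def)
    show "T \<ge> 0" using M(1) C(1) by (simp add: T_def)
    show "P x c'" if "P x c" "c \<le> c'" for x c c'
      using that unfolding P_def by (meson E_norm_nonneg mult_right_mono order_trans)
    fix \<epsilon> :: real assume \<epsilon>: "0 < \<epsilon>" "\<epsilon> \<le> 1"
    obtain d where d: "d > 0" "\<forall>x\<in>K. \<forall>h. norm h < d \<longrightarrow> norm (B (x + h) - B x) \<le> \<epsilon> \<and> norm (A (x + h) - A x - B x h) \<le> norm h * \<epsilon>"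
      using C2_near_compact[OF C2_\<phi> K(1) \<epsilon>(1)] by auto
    have e1: "norm (A (fst z s + h) - A (fst z s) - B (fst z s) h) \<le> norm h * \<epsilon>"
      and e2: "norm (B (fst z s + h) - B (fst z s)) \<le> \<epsilon>" if "norm h < d" for s h
      using d(2) that K(2) by auto
    define \<delta> where "\<delta> = min 1 (min (d / 2) (r / 2))"
    have "P x (\<epsilon> * S + x * T)" if x: "0 \<le> x" "x < \<delta>" for x
      unfolding P_def
    proof (intro ballI impI)
      fix h k assume h: "h \<in> E_space j" and hx: "E_norm j h = x" and k: "k \<in> E_space j"
      define y where "y = E_norm j k"
      have y: "y \<ge> 0" unfolding y_def by (rule E_norm_nonneg)
      obtain b c where Wa: "W_data j (fst h) b c" and m: "snd h \<in> L2" and le: "L2_norm b \<le> x" "L2_norm c \<le> x" "L2_norm (snd h) \<le> x"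
        using E_space_data[OF h] unfolding hx by blast
      note Da = W_dataD[OF Wa]
      obtain l n where Wk: "W_data j (fst k) l n" and q: "snd k \<in> L2" and lek: "L2_norm l \<le> y" "L2_norm n \<le> y" "L2_norm (snd k) \<le> y"
        using E_space_data[OF k] unfolding y_def[symmetric] by blast
      note Dk = W_dataD[OF Wk]
      have N: "norm (fst h s) \<le> 2 * x" for s using W_data_norm_le[OF Wa j_norm, of s] le by linarith
      have N': "norm (fst k s) \<le> 2 * y" for s using W_data_norm_le[OF Wk j_norm, of s] lek by linarith
      have Nd: "2 * x < d" "2 * x < r" "x \<le> 1" using x by (auto simp: \<delta>_def)
      have W1: "W_data j (\<lambda>s. A (fst z s + fst h s) (fst k s) - A (fst z s) (fst k s))
          (\<lambda>s. B (fst z s + fst h s) (fst k s) (v s + b s) + A (fst z s + fst h s) (l s) - (B (fst z s) (fst k s) (v s) + A (fst z s) (l s)))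
          (\<lambda>s. fderiv g (u s + c s) (n s) - fderiv g (u s) (n s))"
        by (rule W_data_diff[OF j_linear W_data_fderiv[OF W_data_add[OF j_linear W Wa] Wk] W_data_fderiv[OF W Wk]])
      have 1: "L2_norm (\<lambda>s. B (fst z s + fst h s) (fst k s) (v s + b s) + A (fst z s + fst h s) (l s) - (B (fst z s) (fst k s) (v s) + A (fst z s) (l s)))
          \<le> 2 * (\<epsilon> * (2 * y) * L2_norm v + (M + \<epsilon>) * (2 * y) * L2_norm b + (M + \<epsilon>) * (2 * x) * L2_norm l)"
        by (rule derivative_increment_path_bound[OF D(1) M(1,3) less_imp_le[OF \<epsilon>(1)] e1 e2 Da(1) N Nd(1) D(3) Da(3) Dk(1) N' Dk(3)])
      have 2: "L2_norm (\<lambda>s. B (fst z s + fst h s) (fst k s) (snd z s + snd h s) + A (fst z s + fst h s) (snd k s) - (B (fst z s) (fst k s) (snd z s) + A (fst z s) (snd k s)))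
          \<le> 2 * (\<epsilon> * (2 * y) * L2_norm (snd z) + (M + \<epsilon>) * (2 * y) * L2_norm (snd h) + (M + \<epsilon>) * (2 * x) * L2_norm (snd k))"
        by (rule derivative_increment_path_bound[OF D(1) M(1,3) less_imp_le[OF \<epsilon>(1)] e1 e2 Da(1) N Nd(1) w m Dk(1) N' q])
      have 3: "L2_norm (\<lambda>s. fderiv g (u s + c s) (n s) - fderiv g (u s) (n s))
          \<le> 2 * (C * (2 * x) * L2_norm n + (C * (2 * y) + C * (2 * x) * (2 * y)) * L2_norm c + C * (2 * x) * (2 * y) * L2_norm u)"
        by (rule restr_derivative_increment_path_bound[OF W Wa Wk K(2) C(1,3) N Nd(2) N'])
      have eq: "tangent_deriv (z + h) k - tangent_deriv z k =
        ((\<lambda>s. A (fst z s + fst h s) (fst k s) - A (fst z s) (fst k s)),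
         (\<lambda>s. B (fst z s + fst h s) (fst k s) (snd z s + snd h s) + A (fst z s + fst h s) (snd k s) - (B (fst z s) (fst k s) (snd z s) + A (fst z s) (snd k s))))"
        by (simp add: tangent_deriv_def fun_eq_iff)
      have "E_norm j (tangent_deriv (z + h) k - tangent_deriv z k) \<le>
          2 * (\<epsilon> * (2 * y) * L2_norm v + (M + \<epsilon>) * (2 * y) * L2_norm b + (M + \<epsilon>) * (2 * x) * L2_norm l)
          + 2 * (C * (2 * x) * L2_norm n + (C * (2 * y) + C * (2 * x) * (2 * y)) * L2_norm c + C * (2 * x) * (2 * y) * L2_norm u)
          + 2 * (\<epsilon> * (2 * y) * L2_norm (snd z) + (M + \<epsilon>) * (2 * y) * L2_norm (snd h) + (M + \<epsilon>) * (2 * x) * L2_norm (snd k))"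
        unfolding eq using E_norm_le[OF W1] 1 2 3 by (meson add_mono order_trans)
      also have "\<dots> \<le> 2 * (\<epsilon> * (2 * y) * L2_norm v + (M + 1) * (2 * y) * x + (M + 1) * (2 * x) * y)
          + 2 * (C * (2 * x) * y + (C * (2 * y) + C * (2 * 1) * (2 * y)) * x + C * (2 * x) * (2 * y) * L2_norm u)
          + 2 * (\<epsilon> * (2 * y) * L2_norm (snd z) + (M + 1) * (2 * y) * x + (M + 1) * (2 * x) * y)"
        using le lek M(1) C(1) \<epsilon> x(1) y Nd(3) by (intro add_mono mult_left_mono mult_mono order_refl) auto
      also have "\<dots> = (\<epsilon> * S + x * T) * y" by (simp add: S_def T_def algebra_simps)
      finally show "E_norm j (tangent_deriv (z + h) k - tangent_deriv z k) \<le> (\<epsilon> * S + x * T) * E_norm j k"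
        unfolding y_def .
    qed
    moreover have "\<delta> > 0" using d(1) C(2) by (simp add: \<delta>_def)
    ultimately show "\<exists>\<delta>>0. \<forall>x. 0 \<le> x \<longrightarrow> x < \<delta> \<longrightarrow> P x (\<epsilon> * S + x * T)" by blast
  qed
  then show ?thesis unfolding P_def using E_norm_nonneg by blast
qed

end

theorem theoremB:
  fixes j :: "'b::{real_inner, banach} \<Rightarrow> 'a::{real_inner, banach}"
    and \<phi> :: "'a \<Rightarrow> 'a"
  assumes "dense_compact_inclusion j"
    and "\<And>x. norm (j x) \<le> norm x"
    and "tame j UNIV \<phi>"
    and "\<phi> 0 = 0"
  shows "(\<forall>z \<in> E_space j. tangent_map \<phi> z \<in> E_space j) \<and>
    (\<forall>\<xi> \<eta> \<eta>'. (\<xi>, \<eta>) \<in> E_space j \<and> (\<xi>, \<eta>') \<in> E_space j \<and> (AE s in lebesgue. \<eta> s = \<eta>' s) \<longrightarrow>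
       (AE s in lebesgue. snd (tangent_map \<phi> (\<xi>, \<eta>)) s = snd (tangent_map \<phi> (\<xi>, \<eta>')) s)) \<and>
    C1_between (E_space j) (E_norm j) (E_space j) (E_norm j) (tangent_map \<phi>)"
proof -
  interpret tame_on_Hilbert_pair j \<phi>
    using assms by (intro tame_on_Hilbert_pair.intro) (auto simp: dense_compact_inclusion_def)
  \<comment> \<open>The base curve is the same on both sides, so equality holds pointwise off the
    given null set.\<close>
  have ae: "AE s in lebesgue. snd (tangent_map \<phi> (\<xi>, \<eta>)) s = snd (tangent_map \<phi> (\<xi>, \<eta>')) s"
    if "AE s in lebesgue. \<eta> s = \<eta>' s" for \<xi> \<eta> \<eta>' :: "real \<Rightarrow> 'a"
    using that by eventually_elim (simp add: tangent_map_def)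
  show ?thesis
    unfolding C1_between_def
    using ae tangent_map_in_E_space bounded_linear_tangent_deriv tangent_map_remainder tangent_deriv_continuous
    by (intro conjI exI[of _ tangent_deriv]) auto
qed

end
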